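(* Let $E_1,\ldots,E_n$ be elliptic curves and let $G$ be a finite group acting holomorphically and faithfully on each $E_i$, such that the induced diagonal action of $G$ on $E_1\times\cdots\times E_n$ is rigid and free. Then: (1) $n\ge 4$; (2) $E_i$ is isomorphic to the Fermat elliptic curve $\mathbb{C}/\mathbb{Z}[\zeta_3]$ for each $1\le i\le n$; (3) $G$ is isomorphic to $\mathbb{Z}_3^2$ or to the Heisenberg group $\mathrm{He}(3)$ of order $27$.
   Context: A holomorphic action of a finite group $G$ on a compact complex manifold $X$ is called rigid (meaning infinitesimally rigid) if $H^1(X,\Theta_X)^G=0$, where $\Theta_X$ is the sheaf of holomorphic vector fields. Given $G$-actions on $X_1,\ldots,X_n$, the diagonal $G$-action on $X_1\times\cdots\times X_n$ is $g(x_1,\ldots,x_n):=(gx_1,\ldots,gx_n)$. Elements of $G$ may act on an elliptic curve by arbitrary automorphisms of the Riemann surface (translations included). Here $\zeta_3=\exp(2\pi i/3)$, $\mathbb{Z}_m=\mathbb{Z}/m\mathbb{Z}$, and $\mathrm{He}(3)$ is the group of upper triangular unipotent matrices in $\mathrm{SL}(3,\mathbb{F}_3)$. *)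

theory Defs
  imports "HOL-Complex_Analysis.Complex_Analysis" "HOL-Algebra.Algebra"
begin

no_notation fps_nth (infixl "$" 75)

section \<open>Complex Euclidean spaces and holomorphic maps between them\<close>

class complex_euclidean = euclidean_space +
  fixes scaleC :: "complex \<Rightarrow> 'a \<Rightarrow> 'a"
  assumes scaleC_add_right: "scaleC c (x + y) = scaleC c x + scaleC c y"
    and scaleC_add_left: "scaleC (c + d) x = scaleC c x + scaleC d x"
    and scaleC_scaleC: "scaleC c (scaleC d x) = scaleC (c * d) x"
    and scaleC_of_real: "scaleC (complex_of_real r) x = r *\<^sub>R x"
    and norm_scaleC: "norm (scaleC c x) = norm c * norm x"

instantiation complex :: complex_euclidean
begin

definition scaleC_complex :: "complex \<Rightarrow> complex \<Rightarrow> complex" where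
  "scaleC_complex c x = c * x"

instance
  by standard (simp_all add: scaleC_complex_def algebra_simps norm_mult scaleR_conv_of_real)

end

instantiation vec :: (complex_euclidean, finite) complex_euclidean
begin

definition scaleC_vec :: "complex \<Rightarrow> 'a ^ 'b \<Rightarrow> 'a ^ 'b" where
  "scaleC_vec c x = (\<chi> i. scaleC c (x $ i))"

instance
proof
  fix c d :: complex and x y :: "'a ^ 'b" and r :: real
  show "scaleC c (x + y) = scaleC c x + scaleC c y"
    by (simp add: scaleC_vec_def vec_eq_iff scaleC_add_right)
  show "scaleC (c + d) x = scaleC c x + scaleC d x"
    by (simp add: scaleC_vec_def vec_eq_iff scaleC_add_left)
  show "scaleC c (scaleC d x) = scaleC (c * d) x"
    by (simp add: scaleC_vec_def vec_eq_iff scaleC_scaleC)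
  show "scaleC (complex_of_real r) x = r *\<^sub>R x"
    by (simp add: scaleC_vec_def vec_eq_iff scaleC_of_real)
  show "norm (scaleC c x) = norm c * norm x"
    by (simp add: scaleC_vec_def norm_vec_def norm_scaleC L2_set_right_distrib)
qed

end

text \<open>Only used for open \<open>S\<close>.\<close>

definition holo_on ::
    "('v::complex_euclidean \<Rightarrow> 'w::complex_euclidean) \<Rightarrow> 'v set \<Rightarrow> bool" where
  "holo_on f S \<longleftrightarrow>
     (\<forall>x\<in>S. \<exists>D. (f has_derivative D) (at x) \<and> (\<forall>c v. D (scaleC c v) = scaleC c (D v)))"

lemma holo_on_complex_iff:
  fixes f :: "complex \<Rightarrow> complex"
  assumes "open S"
  shows "holo_on f S \<longleftrightarrow> f holomorphic_on S"
proof
  assume L: "holo_on f S"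
  have "f field_differentiable at x" if x: "x \<in> S" for x
  proof -
    obtain D where D: "(f has_derivative D) (at x)" "\<And>c v. D (c * v) = c * D v"
      using L x unfolding holo_on_def scaleC_complex_def by blast
    have "D = (*) (D 1)"
    proof
      fix c
      show "D c = D 1 * c" using D(2)[of c 1] by (metis mult.commute mult_1_right)
    qed
    then have "(f has_field_derivative D 1) (at x)"
      using D(1) by (simp add: has_field_derivative_def)
    then show ?thesis by (auto simp: field_differentiable_def)
  qed
  then show "f holomorphic_on S"
    using assms by (simp add: holomorphic_on_def field_differentiable_at_within)
next
  assume R: "f holomorphic_on S"
  show "holo_on f S"
    unfolding holo_on_def
  proof
    fix x assume "x \<in> S"
    then have "(f has_derivative (*) (deriv f x)) (at x)"
      using holomorphic_derivI[OF R assms] by (simp add: has_field_derivative_def)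
    then show "\<exists>D. (f has_derivative D) (at x) \<and> (\<forall>c v. D (scaleC c v) = scaleC c (D v))"
      by (intro exI[of _ "(*) (deriv f x)"]) (simp add: scaleC_complex_def)
  qed
qed


section \<open>Complex manifolds\<close>

type_synonym ('a, 'v) chart = "'a set \<times> ('a \<Rightarrow> 'v)"

record ('a, 'v) cmfd =
  mtop :: "'a topology"
  charts :: "('a, 'v) chart set"

abbreviation points :: "('a, 'v) cmfd \<Rightarrow> 'a set" where
  "points M \<equiv> topspace (mtop M)"

definition complex_manifold :: "('a, 'v::complex_euclidean) cmfd \<Rightarrow> bool" where
  "complex_manifold M \<longleftrightarrow>
     Hausdorff_space (mtop M) \<and> second_countable (mtop M) \<and>
     (\<Union>(fst ` charts M)) = points M \<and>
     (\<forall>(U, \<phi>)\<in>charts M. openin (mtop M) U \<and> open (\<phi> ` U) \<and>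
        homeomorphic_map (subtopology (mtop M) U) (top_of_set (\<phi> ` U)) \<phi>) \<and>
     (\<forall>(U, \<phi>)\<in>charts M. \<forall>(V, \<psi>)\<in>charts M. holo_on (\<psi> \<circ> inv_into U \<phi>) (\<phi> ` (U \<inter> V)))"

definition holomorphic_map ::
    "('a, 'v::complex_euclidean) cmfd \<Rightarrow> ('b, 'w::complex_euclidean) cmfd \<Rightarrow> ('a \<Rightarrow> 'b) \<Rightarrow> bool" where
  "holomorphic_map M N f \<longleftrightarrow>
     continuous_map (mtop M) (mtop N) f \<and>
     (\<forall>(U, \<phi>)\<in>charts M. \<forall>(V, \<psi>)\<in>charts N.
        holo_on (\<psi> \<circ> f \<circ> inv_into U \<phi>) (\<phi> ` {x \<in> U. f x \<in> V}))"

definition biholomorphic ::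
    "('a, 'v::complex_euclidean) cmfd \<Rightarrow> ('b, 'w::complex_euclidean) cmfd \<Rightarrow> bool" where
  "biholomorphic M N \<longleftrightarrow>
     (\<exists>f g. holomorphic_map M N f \<and> holomorphic_map N M g \<and>
        (\<forall>x\<in>points M. g (f x) = x) \<and> (\<forall>y\<in>points N. f (g y) = y))"

definition product_cmfd :: "('n::finite \<Rightarrow> ('a, complex) cmfd) \<Rightarrow> ('n \<Rightarrow> 'a, complex ^ 'n) cmfd" where
  "product_cmfd E =
     \<lparr>mtop = product_topology (\<lambda>i. mtop (E i)) UNIV,
      charts = {(\<Pi>\<^sub>E i\<in>UNIV. U i, \<lambda>x. \<chi> i. \<phi> i (x i)) | U \<phi>. \<forall>i. (U i, \<phi> i) \<in> charts (E i)}\<rparr>"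


section \<open>Group actions\<close>

definition holomorphic_action ::
    "('g, 'm) monoid_scheme \<Rightarrow> ('a, 'v::complex_euclidean) cmfd \<Rightarrow> ('g \<Rightarrow> 'a \<Rightarrow> 'a) \<Rightarrow> bool" where
  "holomorphic_action G M \<rho> \<longleftrightarrow>
     group_action G (points M) \<rho> \<and> (\<forall>g\<in>carrier G. holomorphic_map M M (\<rho> g))"

definition free_action ::
    "('g, 'm) monoid_scheme \<Rightarrow> ('a, 'v) cmfd \<Rightarrow> ('g \<Rightarrow> 'a \<Rightarrow> 'a) \<Rightarrow> bool" where
  "free_action G M \<rho> \<longleftrightarrow>
     (\<forall>g\<in>carrier G. \<forall>x\<in>points M. \<rho> g x = x \<longrightarrow> g = \<one>\<^bsub>G\<^esub>)"

text \<open>Elements of \<open>BijGroup\<close>, and hence the maps in a \<open>group_action\<close>, are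
  extensional; this is the reason for \<open>restrict\<close>.\<close>

definition diagonal_action ::
    "('n::finite \<Rightarrow> ('a, complex) cmfd) \<Rightarrow> ('n \<Rightarrow> 'g \<Rightarrow> 'a \<Rightarrow> 'a) \<Rightarrow> 'g \<Rightarrow> ('n \<Rightarrow> 'a) \<Rightarrow> ('n \<Rightarrow> 'a)" where
  "diagonal_action E \<rho> g = restrict (\<lambda>x i. \<rho> i g (x i)) (points (product_cmfd E))"


section \<open>The tangent sheaf and its first cohomology\<close>

text \<open>A vector field is the family of its coordinate expressions:
  \<open>v (U, \<phi>) x\<close> is the coordinate vector at \<open>x\<close> in the chart \<open>(U, \<phi>)\<close>.
  The value is irrelevant unless \<open>x \<in> U\<close> and \<open>x\<close> lies in the set on which the field is considered.\<close>

type_synonym ('a, 'v) vfield = "('a, 'v) chart \<Rightarrow> 'a \<Rightarrow> 'v"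

definition vector_field :: "('a, 'v::complex_euclidean) cmfd \<Rightarrow> 'a set \<Rightarrow> ('a, 'v) vfield \<Rightarrow> bool" where
  "vector_field M W v \<longleftrightarrow>
     (\<forall>(U, \<phi>)\<in>charts M. holo_on (v (U, \<phi>) \<circ> inv_into U \<phi>) (\<phi> ` (U \<inter> W))) \<and>
     (\<forall>(U, \<phi>)\<in>charts M. \<forall>(V, \<psi>)\<in>charts M. \<forall>x\<in>U \<inter> V \<inter> W.
        v (V, \<psi>) x = frechet_derivative (\<psi> \<circ> inv_into U \<phi>) (at (\<phi> x)) (v (U, \<phi>) x))"

definition vf_eq_on :: "('a, 'v) cmfd \<Rightarrow> 'a set \<Rightarrow> ('a, 'v) vfield \<Rightarrow> ('a, 'v) vfield \<Rightarrow> bool" where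
  "vf_eq_on M W v w \<longleftrightarrow> (\<forall>(U, \<phi>)\<in>charts M. \<forall>x\<in>U \<inter> W. v (U, \<phi>) x = w (U, \<phi>) x)"

definition vf_add :: "('a, 'v::plus) vfield \<Rightarrow> ('a, 'v) vfield \<Rightarrow> ('a, 'v) vfield" where
  "vf_add v w = (\<lambda>\<kappa> x. v \<kappa> x + w \<kappa> x)"

definition vf_diff :: "('a, 'v::minus) vfield \<Rightarrow> ('a, 'v) vfield \<Rightarrow> ('a, 'v) vfield" where
  "vf_diff v w = (\<lambda>\<kappa> x. v \<kappa> x - w \<kappa> x)"

text \<open>Push-forward \<open>y \<mapsto> df (v (f\<inverse> y))\<close> along an automorphism \<open>f\<close>; the result
  does not depend on the chart chosen around \<open>f\<inverse> y\<close>.\<close>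

definition vf_push ::
    "('a, 'v::complex_euclidean) cmfd \<Rightarrow> ('a \<Rightarrow> 'a) \<Rightarrow> ('a, 'v) vfield \<Rightarrow> ('a, 'v) vfield" where
  "vf_push M f v = (\<lambda>(V, \<psi>) y.
     let x = inv_into (points M) f y;
         (U, \<phi>) = (SOME \<kappa>. \<kappa> \<in> charts M \<and> x \<in> fst \<kappa>)
     in frechet_derivative (\<psi> \<circ> f \<circ> inv_into U \<phi>) (at (\<phi> x)) (v (U, \<phi>) x))"

text \<open>Following Godement, \<open>H\<^sup>1\<close> is the colimit of Cech cohomology over the open covers
  \<open>(U\<^sub>x)\<close> indexed by the points of the manifold, with \<open>x \<in> U\<^sub>x\<close>. They are cofinal
  among all open covers, and the refinement maps are the identity on indices. (For every sheaf on
  every space, Cech \<open>H\<^sup>1\<close> agrees with derived functor cohomology.)\<close>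

type_synonym ('a, 'v) cochain = "('a \<Rightarrow> 'a set) \<times> ('a \<Rightarrow> 'a \<Rightarrow> ('a, 'v) vfield)"

definition pointed_cover :: "('a, 'v) cmfd \<Rightarrow> ('a \<Rightarrow> 'a set) \<Rightarrow> bool" where
  "pointed_cover M U \<longleftrightarrow> (\<forall>x\<in>points M. openin (mtop M) (U x) \<and> x \<in> U x)"

definition cech_cocycles :: "('a, 'v::complex_euclidean) cmfd \<Rightarrow> ('a, 'v) cochain set" where
  "cech_cocycles M =
     {(U, c). pointed_cover M U \<and>
        (\<forall>x\<in>points M. \<forall>y\<in>points M. vector_field M (U x \<inter> U y) (c x y)) \<and>
        (\<forall>x\<in>points M. \<forall>y\<in>points M. \<forall>z\<in>points M.
           vf_eq_on M (U x \<inter> U y \<inter> U z) (c x z) (vf_add (c x y) (c y z)))}"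

definition cech_cohomologous ::
    "('a, 'v::complex_euclidean) cmfd \<Rightarrow> (('a, 'v) cochain \<times> ('a, 'v) cochain) set" where
  "cech_cohomologous M =
     {((U, c), (U', c')). (U, c) \<in> cech_cocycles M \<and> (U', c') \<in> cech_cocycles M \<and>
        (\<exists>W b. pointed_cover M W \<and>
           (\<forall>x\<in>points M. W x \<subseteq> U x \<inter> U' x \<and> vector_field M (W x) (b x)) \<and>
           (\<forall>x\<in>points M. \<forall>y\<in>points M.
              vf_eq_on M (W x \<inter> W y) (vf_diff (c x y) (c' x y)) (vf_diff (b y) (b x))))}"

definition H1_tangent :: "('a, 'v::complex_euclidean) cmfd \<Rightarrow> ('a, 'v) cochain set set" where
  "H1_tangent M = cech_cocycles M // cech_cohomologous M"

definition H1_zero :: "('a, 'v::complex_euclidean) cmfd \<Rightarrow> ('a, 'v) cochain set" where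
  "H1_zero M = cech_cohomologous M `` {(\<lambda>x. points M, \<lambda>x y \<kappa> p. 0)}"

definition cocycle_push ::
    "('a, 'v::complex_euclidean) cmfd \<Rightarrow> ('a \<Rightarrow> 'a) \<Rightarrow> ('a, 'v) cochain \<Rightarrow> ('a, 'v) cochain" where
  "cocycle_push M f = (\<lambda>(U, c).
     let h = inv_into (points M) f
     in (\<lambda>x. f ` U (h x), \<lambda>x y. vf_push M f (c (h x) (h y))))"

definition H1_push ::
    "('a, 'v::complex_euclidean) cmfd \<Rightarrow> ('a \<Rightarrow> 'a) \<Rightarrow> ('a, 'v) cochain set \<Rightarrow> ('a, 'v) cochain set" where
  "H1_push M f \<xi> = cech_cohomologous M `` (cocycle_push M f ` \<xi>)"

definition H1_invariants ::
    "('g, 'm) monoid_scheme \<Rightarrow> ('a, 'v::complex_euclidean) cmfd \<Rightarrow> ('g \<Rightarrow> 'a \<Rightarrow> 'a)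
       \<Rightarrow> ('a, 'v) cochain set set" where
  "H1_invariants G M \<rho> = {\<xi> \<in> H1_tangent M. \<forall>g\<in>carrier G. H1_push M (\<rho> g) \<xi> = \<xi>}"

definition rigid_action ::
    "('g, 'm) monoid_scheme \<Rightarrow> ('a, 'v::complex_euclidean) cmfd \<Rightarrow> ('g \<Rightarrow> 'a \<Rightarrow> 'a) \<Rightarrow> bool" where
  "rigid_action G M \<rho> \<longleftrightarrow> H1_invariants G M \<rho> = {H1_zero M}"


section \<open>Elliptic curves\<close>

definition is_lattice :: "complex set \<Rightarrow> bool" where
  "is_lattice \<Lambda> \<longleftrightarrow>
     (\<exists>\<omega>\<^sub>1 \<omega>\<^sub>2. \<omega>\<^sub>1 \<noteq> \<omega>\<^sub>2 \<and> independent {\<omega>\<^sub>1, \<omega>\<^sub>2} \<and>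
        \<Lambda> = {of_int m * \<omega>\<^sub>1 + of_int n * \<omega>\<^sub>2 | m n. True})"

definition torus_proj :: "complex set \<Rightarrow> complex \<Rightarrow> complex set" where
  "torus_proj \<Lambda> z = (\<lambda>l. z + l) ` \<Lambda>"

definition quotient_top :: "('a::topological_space \<Rightarrow> 'b) \<Rightarrow> 'b topology" where
  "quotient_top p = topology (\<lambda>S. S \<subseteq> range p \<and> open (p -` S))"

lemma openin_quotient_top: "openin (quotient_top p) S \<longleftrightarrow> S \<subseteq> range p \<and> open (p -` S)"
proof -
  have "istopology (\<lambda>S. S \<subseteq> range p \<and> open (p -` S))"
    unfolding istopology_def
  proof (intro conjI allI impI)
    fix \<K> assume K: "\<forall>K\<in>\<K>. K \<subseteq> range p \<and> open (p -` K)"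
    then show "\<Union>\<K> \<subseteq> range p" by blast
    have "p -` \<Union>\<K> = (\<Union>K\<in>\<K>. p -` K)" by blast
    with K show "open (p -` \<Union>\<K>)" by (simp add: open_UN)
  next
    fix S T assume S: "S \<subseteq> range p \<and> open (p -` S)" and T: "T \<subseteq> range p \<and> open (p -` T)"
    then show "S \<inter> T \<subseteq> range p" by blast
    show "open (p -` (S \<inter> T))" using S T by (simp add: open_Int)
  qed
  then show ?thesis
    unfolding quotient_top_def by (simp only: topology_inverse')
qed

definition complex_torus :: "complex set \<Rightarrow> (complex set, complex) cmfd" where
  "complex_torus \<Lambda> =
     \<lparr>mtop = quotient_top (torus_proj \<Lambda>),
      charts = {(torus_proj \<Lambda> ` D, inv_into D (torus_proj \<Lambda>)) | D.
                  open D \<and> inj_on (torus_proj \<Lambda>) D}\<rparr>"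

definition zeta3 :: complex where
  "zeta3 = exp (2 * of_real pi * \<i> / 3)"

definition eisenstein_integers :: "complex set" where
  "eisenstein_integers = {of_int a + of_int b * zeta3 | a b. True}"

definition fermat_curve :: "(complex set, complex) cmfd" where
  "fermat_curve = complex_torus eisenstein_integers"


section \<open>The Heisenberg group\<close>

text \<open>The numeral type \<open>3\<close> is used twice: as the ring of integers modulo 3, i.e. the field
  with three elements, for the entries, and as the index type, with indices 1, 2, 3.\<close>

definition Heis3 :: "(3 ^ 3 ^ 3) monoid" where
  "Heis3 =
     \<lparr>carrier = {A. det A = 1 \<and>
                    A $ 1 $ 1 = 1 \<and> A $ 2 $ 2 = 1 \<and> A $ 3 $ 3 = 1 \<and>
                    A $ 2 $ 1 = 0 \<and> A $ 3 $ 1 = 0 \<and> A $ 3 $ 2 = 0},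
      monoid.mult = (**), one = mat 1\<rparr>"


section \<open>Complex tori and products are complex manifolds\<close>

lemma lattice_facts:
  assumes "is_lattice L"
  shows lattice_zero: "0 \<in> L"
    and lattice_diff: "a \<in> L \<Longrightarrow> b \<in> L \<Longrightarrow> a - b \<in> L"
    and lattice_discrete: "\<exists>e>0. \<forall>l\<in>L. norm l < e \<longrightarrow> l = 0"
proof -
  obtain u v where uv: "u \<noteq> v" "independent {u, v}"
    and L: "L = {of_int m * u + of_int n * v | m n. True}"
    using assms unfolding is_lattice_def by blast
  show "0 \<in> L"
    unfolding L by (rule CollectI, rule exI[of _ 0], rule exI[of _ 0]) simp
  show "a - b \<in> L" if "a \<in> L" "b \<in> L"
  proof -
    from that obtain m n m' n' where
      "a = of_int m * u + of_int n * v" "b = of_int m' * u + of_int n' * v"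
      unfolding L by blast
    then have "a - b = of_int (m - m') * u + of_int (n - n') * v"
      by (simp add: algebra_simps)
    then show ?thesis unfolding L by blast
  qed
  have u0: "u \<noteq> 0" "v \<noteq> 0" using uv(2) dependent_zero by auto
  define d where "d = Im (cnj u * v)"
  have d0: "d \<noteq> 0"
  proof
    assume "d = 0"
    define r where "r = Re (cnj u * v) / (norm u)\<^sup>2"
    have "cnj u * v = complex_of_real (Re (cnj u * v))"
      using \<open>d = 0\<close> unfolding d_def by (metis complex_is_Real_iff of_real_Re)
    then have "u * (cnj u * v) = u * complex_of_real (Re (cnj u * v))" by simp
    moreover have "complex_of_real ((norm u)\<^sup>2) * v = u * (cnj u * v)"
      by (simp only: complex_norm_square mult.assoc)
    ultimately have "complex_of_real ((norm u)\<^sup>2) * v = u * complex_of_real (Re (cnj u * v))"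
      by (simp only:)
    then have "v = r *\<^sub>R u"
      using u0 by (simp add: r_def scaleR_conv_of_real field_simps)
    then have "v \<in> span {u}" by (simp add: span_base span_scale)
    moreover have "v \<notin> span {u}"
      using uv independent_insert[of v "{u}"] by (auto simp: insert_commute)
    ultimately show False by blast
  qed
  define e where "e = \<bar>d\<bar> / (norm u + norm v)"
  have M: "norm u + norm v > 0" using u0 by (simp add: add_pos_pos)
  have e: "e > 0" using d0 M by (simp add: e_def)
  have "l = 0" if l: "l \<in> L" "norm l < e" for l
  proof -
    obtain m n where mn: "l = of_int m * u + of_int n * v" using l(1) unfolding L by blast
    have small: "norm l * (norm u + norm v) < \<bar>d\<bar>"
      using l(2) M by (simp add: e_def field_simps)
    have "Im (cnj u * l) = of_int n * d"
      by (simp add: mn d_def algebra_simps)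
    moreover have "\<bar>Im (cnj u * l)\<bar> \<le> norm u * norm l"
      using abs_Im_le_cmod[of "cnj u * l"] by (simp add: norm_mult)
    moreover have "norm u * norm l \<le> norm l * (norm u + norm v)" by (simp add: algebra_simps)
    ultimately have "\<bar>of_int n * d\<bar> < \<bar>d\<bar>" using small by linarith
    then have n: "n = 0" using d0 by (cases "n = 0") (auto simp: abs_mult)
    have "Im (cnj v * l) = - of_int m * d"
      by (simp add: mn d_def algebra_simps)
    moreover have "\<bar>Im (cnj v * l)\<bar> \<le> norm v * norm l"
      using abs_Im_le_cmod[of "cnj v * l"] by (simp add: norm_mult)
    moreover have "norm v * norm l \<le> norm l * (norm u + norm v)" by (simp add: algebra_simps)
    ultimately have "\<bar>of_int m * d\<bar> < \<bar>d\<bar>" using small by simp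
    then have "m = 0" using d0 by (cases "m = 0") (auto simp: abs_mult)
    with n mn show ?thesis by simp
  qed
  with e show "\<exists>e>0. \<forall>l\<in>L. norm l < e \<longrightarrow> l = 0" by blast
qed

lemma lattice_uminus: "is_lattice L \<Longrightarrow> a \<in> L \<Longrightarrow> - a \<in> L"
  using lattice_diff[of L 0 a] lattice_zero by simp

lemma lattice_add: "is_lattice L \<Longrightarrow> a \<in> L \<Longrightarrow> b \<in> L \<Longrightarrow> a + b \<in> L"
  using lattice_diff[of L a "- b"] lattice_uminus by simp

lemma torus_proj_eq_iff:
  assumes "is_lattice L"
  shows "torus_proj L z = torus_proj L w \<longleftrightarrow> z - w \<in> L"
proof
  assume "torus_proj L z = torus_proj L w"
  moreover have "z \<in> torus_proj L z"
    unfolding torus_proj_def using lattice_zero[OF assms] by force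
  ultimately obtain l where "l \<in> L" "z = w + l" unfolding torus_proj_def by blast
  then show "z - w \<in> L" by simp
next
  have sub: "torus_proj L z \<subseteq> torus_proj L w" if "z - w \<in> L" for z w
  proof
    fix x assume "x \<in> torus_proj L z"
    then obtain l where "l \<in> L" "x = z + l" unfolding torus_proj_def by blast
    then have "x = w + ((z - w) + l)" "(z - w) + l \<in> L"
      using lattice_add[OF assms that] by auto
    then show "x \<in> torus_proj L w" unfolding torus_proj_def by blast
  qed
  assume "z - w \<in> L"
  moreover from this have "w - z \<in> L" using lattice_uminus[OF assms] by fastforce
  ultimately show "torus_proj L z = torus_proj L w" using sub by blast
qed

lemma topspace_quotient_top [simp]: "topspace (quotient_top p) = range p"
proof
  show "topspace (quotient_top p) \<subseteq> range p"
    unfolding topspace_def openin_quotient_top by blast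
  have "openin (quotient_top p) (range p)"
    by (simp add: openin_quotient_top vimage_def)
  then show "range p \<subseteq> topspace (quotient_top p)" by (rule openin_subset)
qed

lemma open_map_torus_proj:
  assumes "is_lattice L" "open D"
  shows "openin (quotient_top (torus_proj L)) (torus_proj L ` D)"
proof -
  have "torus_proj L -` torus_proj L ` D = (\<Union>l\<in>L. (+) l ` D)"
  proof (intro equalityI subsetI)
    fix z assume "z \<in> torus_proj L -` torus_proj L ` D"
    then obtain w where "w \<in> D" "torus_proj L z = torus_proj L w" by auto
    then have "z - w \<in> L" "z = (z - w) + w" using torus_proj_eq_iff[OF assms(1)] by auto
    then show "z \<in> (\<Union>l\<in>L. (+) l ` D)" using \<open>w \<in> D\<close> by blast
  next
    fix z assume "z \<in> (\<Union>l\<in>L. (+) l ` D)"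
    then obtain l w where "l \<in> L" "w \<in> D" "z = l + w" by blast
    then have "torus_proj L z = torus_proj L w" using torus_proj_eq_iff[OF assms(1)] by simp
    then show "z \<in> torus_proj L -` torus_proj L ` D" using \<open>w \<in> D\<close> by simp
  qed
  then show ?thesis
    unfolding openin_quotient_top using assms(2) by (auto intro!: open_UN open_translation)
qed

lemma continuous_map_quotient_top: "continuous_map euclidean (quotient_top p) p"
  unfolding continuous_map_def by (auto simp: openin_quotient_top vimage_def)

lemma torus_chart_inv:
  assumes "inj_on p D"
  shows "inv_into D p ` p ` D = D" "inv_into (p ` D) (inv_into D p) x = p x \<or> x \<notin> D"
proof -
  show 1: "inv_into D p ` p ` D = D" using assms by (force simp: image_image)
  show "inv_into (p ` D) (inv_into D p) x = p x \<or> x \<notin> D"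
  proof (cases "x \<in> D")
    case True
    then have "inv_into D p (p x) = x" using assms by simp
    moreover have "inj_on (inv_into D p) (p ` D)" by (rule inj_on_inv_into) simp
    ultimately show ?thesis by (metis True imageI inv_into_f_f)
  qed simp
qed

lemma complex_manifold_complex_torus:
  assumes L: "is_lattice L"
  shows "complex_manifold (complex_torus L)"
proof -
  let ?p = "torus_proj L" and ?X = "quotient_top (torus_proj L)"
  have cont: "continuous_map euclidean ?X ?p" by (rule continuous_map_quotient_top)
  have om: "open_map euclidean ?X ?p"
    unfolding open_map_def using open_map_torus_proj[OF L] by simp
  obtain e where e: "e > 0" "\<And>l. l \<in> L \<Longrightarrow> norm l < e \<Longrightarrow> l = 0"
    using lattice_discrete[OF L] by blast
  have "closed L"
  proof (rule discrete_imp_closed[OF e(1)], intro ballI impI)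
    fix x y assume "x \<in> L" "y \<in> L" "dist y x < e"
    then have "y - x = 0" using e(2)[of "y - x"] lattice_diff[OF L] by (simp add: dist_norm)
    then show "y = x" by simp
  qed
  have haus: "Hausdorff_space ?X"
    unfolding Hausdorff_space_def
  proof (intro allI impI)
    fix x y assume "x \<in> topspace ?X \<and> y \<in> topspace ?X \<and> x \<noteq> y"
    then obtain z w where "x = ?p z" "y = ?p w" "x \<noteq> y"
      unfolding topspace_quotient_top by blast
    then have zw: "x = ?p z" "y = ?p w" "z - w \<notin> L"
      using torus_proj_eq_iff[OF L, of z w] by simp_all
    then obtain r where r: "r > 0" "ball (z - w) r \<inter> L = {}"
      using \<open>closed L\<close> by (metis Compl_iff closed_def disjoint_eq_subset_Compl openE)
    have "disjnt (?p ` ball z (r/2)) (?p ` ball w (r/2))"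
      unfolding disjnt_iff
    proof (intro allI notI)
      fix q assume "q \<in> ?p ` ball z (r/2) \<and> q \<in> ?p ` ball w (r/2)"
      then obtain a b where ab: "a \<in> ball z (r/2)" "b \<in> ball w (r/2)" "?p a = ?p b" by auto
      then have "a - b \<in> L" using torus_proj_eq_iff[OF L] by blast
      moreover have "norm ((z - w) - (a - b)) \<le> norm (z - a) + norm (w - b)"
        using norm_triangle_ineq4[of "z - a" "w - b"] by (simp add: algebra_simps)
      then have "a - b \<in> ball (z - w) r" using ab(1,2) by (simp add: dist_norm)
      ultimately show False using r(2) by blast
    qed
    moreover have "x \<in> ?p ` ball z (r/2)" "y \<in> ?p ` ball w (r/2)" using zw r by auto
    ultimately show "\<exists>U V. openin ?X U \<and> openin ?X V \<and> x \<in> U \<and> y \<in> V \<and> disjnt U V"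
      using open_map_torus_proj[OF L] by (meson open_ball)
  qed
  have sc0: "second_countable (euclidean :: complex topology)"
  proof -
    obtain B :: "complex set set" where "countable B" "\<And>C. C \<in> B \<Longrightarrow> open C"
      "\<And>S. open S \<Longrightarrow> \<exists>U. U \<subseteq> B \<and> S = \<Union>U"
      using univ_second_countable by blast
    then show ?thesis unfolding second_countable_def
      by (intro exI[of _ B]) (simp, blast)
  qed
  have sc: "second_countable ?X"
    by (rule second_countable_open_map_image[OF cont om _ sc0]) simp
  have cover: "\<Union>(fst ` charts (complex_torus L)) = points (complex_torus L)"
  proof -
    have "?p z \<in> \<Union>(fst ` charts (complex_torus L))" for z
    proof -
      have "inj_on ?p (ball z (e/2))"
      proof (rule inj_onI)
        fix a b assume ab: "a \<in> ball z (e/2)" "b \<in> ball z (e/2)" "?p a = ?p b"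
        have "norm (a - b) \<le> norm (z - b) + norm (z - a)"
          using norm_triangle_ineq4[of "z - b" "z - a"] by simp
        then have "norm (a - b) < e" using ab by (simp add: dist_norm)
        then show "a = b" using ab(3) e(2) torus_proj_eq_iff[OF L] by fastforce
      qed
      then have "(?p ` ball z (e/2), inv_into (ball z (e/2)) ?p) \<in> charts (complex_torus L)"
        unfolding complex_torus_def by auto
      moreover have "?p z \<in> ?p ` ball z (e/2)" using e(1) by simp
      ultimately show ?thesis by force
    qed
    then show ?thesis by (auto simp: complex_torus_def)
  qed
  have hom: "homeomorphic_map (subtopology ?X (?p ` D)) (top_of_set D) (inv_into D ?p)"
    if D: "open D" "inj_on ?p D" for D
  proof -
    have "homeomorphic_map (top_of_set D) (subtopology ?X (?p ` D)) ?p"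
    proof (rule bijective_open_imp_homeomorphic_map)
      show "continuous_map (top_of_set D) (subtopology ?X (?p ` D)) ?p"
        using cont by (simp add: continuous_map_in_subtopology continuous_map_from_subtopology image_subset_iff_funcset)
      show "open_map (top_of_set D) (subtopology ?X (?p ` D)) ?p"
        unfolding open_map_def
      proof (intro allI impI)
        fix U assume "openin (top_of_set D) U"
        then have "open U" "U \<subseteq> D" using D(1) by (auto simp: openin_open_eq)
        then show "openin (subtopology ?X (?p ` D)) (?p ` U)"
          using open_map_torus_proj[OF L, of U] unfolding openin_subtopology
          by (intro exI[of _ "?p ` U"]) auto
      qed
    qed (use D in auto)
    then obtain g where g: "homeomorphic_maps (top_of_set D) (subtopology ?X (?p ` D)) ?p g"
      by (auto simp: homeomorphic_map_maps)
    then have g1: "homeomorphic_map (subtopology ?X (?p ` D)) (top_of_set D) g"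
      and g2: "\<And>x. x \<in> D \<Longrightarrow> g (?p x) = x"
      by (auto simp: homeomorphic_maps_map)
    have "g y = inv_into D ?p y" if "y \<in> topspace (subtopology ?X (?p ` D))" for y
      using that g2 D(2) by auto
    with g1 show ?thesis using homeomorphic_map_eq by blast
  qed
  have trans: "holo_on (inv_into D' ?p \<circ> inv_into (?p ` D) (inv_into D ?p)) (inv_into D ?p ` (?p ` D \<inter> ?p ` D'))"
    if D: "open D" "inj_on ?p D" and D': "open D'" "inj_on ?p D'" for D D'
    unfolding holo_on_def
  proof
    let ?f = "inv_into D' ?p \<circ> inv_into (?p ` D) (inv_into D ?p)"
    fix x assume "x \<in> inv_into D ?p ` (?p ` D \<inter> ?p ` D')"
    then obtain q where "q \<in> ?p ` D" "q \<in> ?p ` D'" "x = inv_into D ?p q" by blast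
    then have x: "x \<in> D" "?p x \<in> ?p ` D'" by (simp_all add: inv_into_into f_inv_into_f)
    then obtain x' where x': "x' \<in> D'" "?p x = ?p x'" by auto
    define N where "N = D \<inter> (\<lambda>z. z + (x' - x)) -` D'"
    have "open N" unfolding N_def
      using D(1) D'(1) by (intro open_Int open_vimage) (auto intro!: continuous_intros)
    have "x \<in> N" using x x' by (simp add: N_def)
    have f: "?f z = z + (x' - x)" if "z \<in> N" for z
    proof -
      have z: "z \<in> D" "z + (x' - x) \<in> D'" using that by (auto simp: N_def)
      have "?p z = ?p (z + (x' - x))"
        using x' torus_proj_eq_iff[OF L] by (simp add: torus_proj_eq_iff[OF L])
      then show ?thesis using torus_chart_inv(2)[OF D(2), of z] z D'(2) by simp
    qed
    have "((\<lambda>z. z + (x' - x)) has_derivative (\<lambda>v. v)) (at x)"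
      by (auto intro!: derivative_eq_intros)
    then have "(?f has_derivative (\<lambda>v. v)) (at x)"
      by (rule has_derivative_transform_within_open[OF _ \<open>open N\<close> \<open>x \<in> N\<close>]) (use f in auto)
    then show "\<exists>D. (?f has_derivative D) (at x) \<and> (\<forall>c v. D (scaleC c v) = scaleC c (D v))"
      by blast
  qed
  show ?thesis
    unfolding complex_manifold_def
  proof (intro conjI cover)
    show "Hausdorff_space (mtop (complex_torus L))" "second_countable (mtop (complex_torus L))"
      using haus sc by (simp_all add: complex_torus_def)
    show "\<forall>(U, \<phi>)\<in>charts (complex_torus L). openin (mtop (complex_torus L)) U \<and> open (\<phi> ` U) \<and>
        homeomorphic_map (subtopology (mtop (complex_torus L)) U) (top_of_set (\<phi> ` U)) \<phi>"
      using hom open_map_torus_proj[OF L] by (auto simp: complex_torus_def torus_chart_inv)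
    show "\<forall>(U, \<phi>)\<in>charts (complex_torus L). \<forall>(V, \<psi>)\<in>charts (complex_torus L).
        holo_on (\<psi> \<circ> inv_into U \<phi>) (\<phi> ` (U \<inter> V))"
      using trans by (auto simp: complex_torus_def)
  qed
qed


lemma has_derivative_vecI:
  fixes f :: "'a::real_normed_vector \<Rightarrow> 'b::euclidean_space ^ 'n::finite"
  assumes "\<And>i. ((\<lambda>x. f x $ i) has_derivative (\<lambda>v. D v $ i)) (at x)"
  shows "(f has_derivative D) (at x)"
proof (rule iffD2[OF has_derivative_componentwise_within], rule ballI)
  fix b :: "'b ^ 'n" assume "b \<in> Basis"
  then obtain i u where b: "b = axis i u" "u \<in> Basis" by (auto simp: Basis_vec_def)
  have "((\<lambda>x. (f x $ i) \<bullet> u) has_derivative (\<lambda>v. (D v $ i) \<bullet> u)) (at x)"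
    by (rule bounded_linear.has_derivative[OF bounded_linear_inner_left assms])
  then show "((\<lambda>x. f x \<bullet> b) has_derivative (\<lambda>v. D v \<bullet> b)) (at x)"
    by (simp add: b inner_axis)
qed

lemma complex_manifold_product_cmfd:
  fixes E :: "'n::finite \<Rightarrow> ('a, complex) cmfd"
  assumes "\<And>i. complex_manifold (E i)"
  shows "complex_manifold (product_cmfd E)"
proof -
  let ?X = "product_topology (\<lambda>i. mtop (E i)) UNIV"
  note cm = assms[unfolded complex_manifold_def]
  note haus = cm[THEN conjunct1] and sc = cm[THEN conjunct2, THEN conjunct1]
    and cov = cm[THEN conjunct2, THEN conjunct2, THEN conjunct1]
    and 1 = cm[THEN conjunct2, THEN conjunct2, THEN conjunct2, THEN conjunct1]
    and 2 = cm[THEN conjunct2, THEN conjunct2, THEN conjunct2, THEN conjunct2]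
  have op: "openin (mtop (E i)) U" and opi: "open (\<phi> ` U)"
    and hom: "homeomorphic_map (subtopology (mtop (E i)) U) (top_of_set (\<phi> ` U)) \<phi>"
    if "(U, \<phi>) \<in> charts (E i)" for i U \<phi>
    using bspec[OF 1 that] by simp_all
  have trans: "holo_on (\<psi> \<circ> inv_into U \<phi>) (\<phi> ` (U \<inter> V))"
    if "(U, \<phi>) \<in> charts (E i)" "(V, \<psi>) \<in> charts (E i)" for i U \<phi> V \<psi>
    using bspec[OF 2 that(1)] that(2) by auto
  have inj: "inj_on \<phi> U" if "(U, \<phi>) \<in> charts (E i)" for i U \<phi>
    using homeomorphic_imp_injective_map[OF hom[OF that]] openin_subset[OF op[OF that]]
    by (simp add: inf.absorb2)
  have h1: "Hausdorff_space ?X"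
    using haus by (simp add: Hausdorff_space_product_topology)
  have h2: "second_countable ?X"
  proof -
    define P where "P i B \<longleftrightarrow> countable B \<and> (\<forall>V\<in>B. openin (mtop (E i)) V) \<and>
        (\<forall>U x. openin (mtop (E i)) U \<and> x \<in> U \<longrightarrow> (\<exists>V\<in>B. x \<in> V \<and> V \<subseteq> U))" for i B
    have "\<exists>B. P i B" for i
      using sc[of i] unfolding second_countable_def P_def .
    then obtain B where "\<And>i. P i (B i)" by metis
    then have B: "\<And>i. countable (B i)"
      "\<And>i V. V \<in> B i \<Longrightarrow> openin (mtop (E i)) V"
      "\<And>i U x. openin (mtop (E i)) U \<Longrightarrow> x \<in> U \<Longrightarrow> \<exists>V\<in>B i. x \<in> V \<and> V \<subseteq> U"
      unfolding P_def by simp_all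
    show ?thesis
      unfolding second_countable_def
    proof (intro exI conjI allI impI)
      show "countable (PiE UNIV ` PiE UNIV B)"
        by (intro countable_image countable_PiE B) simp
      show "\<forall>V\<in>PiE UNIV ` PiE UNIV B. openin ?X V"
      proof
        fix V assume "V \<in> PiE UNIV ` PiE UNIV B"
        then obtain S where "V = PiE UNIV S" "\<And>i. S i \<in> B i" by (auto simp: PiE_iff)
        then show "openin ?X V" using B(2) by (simp add: openin_PiE)
      qed
      fix U x assume "openin ?X U \<and> x \<in> U"
      then have U: "openin ?X U" and x: "x \<in> U" by simp_all
      from bspec[OF iffD1[OF openin_product_topology_alt U] x]
      obtain S where S0: "\<forall>i\<in>UNIV. openin (mtop (E i)) (S i)"
        and S': "x \<in> PiE UNIV S" "PiE UNIV S \<subseteq> U" by (elim exE conjE)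
      have S: "\<And>i. openin (mtop (E i)) (S i)" "x \<in> PiE UNIV S" "PiE UNIV S \<subseteq> U"
        using S0 S' by simp_all
      have "x i \<in> S i" for i using S(2) by (simp add: PiE_iff)
      then have "\<exists>V. V \<in> B i \<and> x i \<in> V \<and> V \<subseteq> S i" for i
        using B(3)[OF S(1)] by blast
      then obtain V where V: "\<And>i. V i \<in> B i" "\<And>i. x i \<in> V i" "\<And>i. V i \<subseteq> S i" by metis
      have "PiE UNIV V \<subseteq> PiE UNIV S" using V(3) by (rule PiE_mono)
      then have "x \<in> PiE UNIV V \<and> PiE UNIV V \<subseteq> U" using S(3) V(2) by (auto simp: PiE_iff)
      moreover have "PiE UNIV V \<in> PiE UNIV ` PiE UNIV B"
        using V(1) by (intro imageI) (simp add: PiE_iff)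
      ultimately show "\<exists>V\<in>PiE UNIV ` PiE UNIV B. x \<in> V \<and> V \<subseteq> U" by blast
    qed
  qed
  have h3: "\<Union>(fst ` charts (product_cmfd E)) = topspace ?X"
  proof (intro equalityI subsetI)
    fix x assume "x \<in> \<Union>(fst ` charts (product_cmfd E))"
    then obtain U \<phi> where U: "\<forall>i. (U i, \<phi> i) \<in> charts (E i)" "x \<in> PiE UNIV U"
      unfolding product_cmfd_def by auto
    have "x i \<in> points (E i)" for i
      using U openin_subset[OF op[of "U i" "\<phi> i" i]] by (auto simp: PiE_iff)
    then show "x \<in> topspace ?X" by (simp add: PiE_iff)
  next
    fix x assume "x \<in> topspace ?X"
    then have xi: "x i \<in> \<Union>(fst ` charts (E i))" for i
      unfolding cov by (simp add: PiE_iff)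
    have "\<exists>\<kappa>. \<kappa> \<in> charts (E i) \<and> x i \<in> fst \<kappa>" for i
      using xi[of i] by blast
    then obtain K where K: "\<And>i. K i \<in> charts (E i)" "\<And>i. x i \<in> fst (K i)" by metis
    define U \<phi> where "U = (\<lambda>i. fst (K i))" and "\<phi> = (\<lambda>i. snd (K i))"
    have "(PiE UNIV U, \<lambda>x. \<chi> i. \<phi> i (x i)) \<in> charts (product_cmfd E)"
      using K(1) unfolding product_cmfd_def U_def \<phi>_def
      by simp (rule exI[of _ "\<lambda>i. fst (K i)"], rule conjI[OF refl], rule exI[of _ "\<lambda>i. snd (K i)"], simp)
    moreover have "x \<in> PiE UNIV U" using K(2) by (simp add: PiE_iff U_def)
    ultimately show "x \<in> \<Union>(fst ` charts (product_cmfd E))"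
      by (metis UN_I fst_conv)
  qed
  have h4: "openin ?X (PiE UNIV U) \<and> open ((\<lambda>x. \<chi> i. \<phi> i (x i)) ` PiE UNIV U) \<and>
     homeomorphic_map (subtopology ?X (PiE UNIV U))
       (top_of_set ((\<lambda>x. \<chi> i. \<phi> i (x i)) ` PiE UNIV U)) (\<lambda>x. \<chi> i. \<phi> i (x i))"
    if U: "\<And>i. (U i, \<phi> i) \<in> charts (E i)" for U :: "'n \<Rightarrow> 'a set" and \<phi>
  proof -
    let ?\<Phi> = "\<lambda>x. \<chi> i. \<phi> i (x i)"
    define g where "g = (\<lambda>i. inv_into (U i) (\<phi> i))"
    have im: "?\<Phi> ` PiE UNIV U = {v. \<forall>i. v $ i \<in> \<phi> i ` U i}"
    proof (intro equalityI subsetI)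
      fix v assume "v \<in> {v. \<forall>i. v $ i \<in> \<phi> i ` U i}"
      then have 1: "(\<lambda>i. g i (v $ i)) \<in> PiE UNIV U" and 2: "v = ?\<Phi> (\<lambda>i. g i (v $ i))"
        by (auto simp: g_def inv_into_into f_inv_into_f vec_eq_iff)
      show "v \<in> ?\<Phi> ` PiE UNIV U" by (rule image_eqI[of _ ?\<Phi>, OF 2 1])
    qed (auto simp: PiE_iff)
    have "open ({v. \<forall>i. v $ i \<in> \<phi> i ` U i} :: (complex ^ 'n) set)"
    proof -
      have "{v. \<forall>i. v $ i \<in> \<phi> i ` U i} = (\<Inter>i. (\<lambda>v::complex ^ 'n. v $ i) -` (\<phi> i ` U i))" by auto
      moreover have "open ((\<lambda>v::complex ^ 'n. v $ i) -` (\<phi> i ` U i))" for i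
        by (intro open_vimage opi[OF U] continuous_intros)
      ultimately show ?thesis by (auto intro!: open_INT)
    qed
    then have o: "open (?\<Phi> ` PiE UNIV U)" by (simp only: im)
    have X: "subtopology ?X (PiE UNIV U) = product_topology (\<lambda>i. subtopology (mtop (E i)) (U i)) UNIV"
      by (rule subtopology_product_topology)
    have sub: "U i \<subseteq> points (E i)" for i using op[OF U] openin_subset by blast
    have tg: "topspace (subtopology ?X (PiE UNIV U)) = PiE UNIV U"
      using sub by (auto simp: X inf.absorb2)
    have gc: "homeomorphic_maps (subtopology (mtop (E i)) (U i)) (top_of_set (\<phi> i ` U i)) (\<phi> i) (g i)" for i
    proof -
      obtain h where h: "homeomorphic_maps (subtopology (mtop (E i)) (U i)) (top_of_set (\<phi> i ` U i)) (\<phi> i) h"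
        using hom[OF U] by (auto simp: homeomorphic_map_maps)
      moreover have "h y = g i y" if "y \<in> \<phi> i ` U i" for y
        using h that sub[of i] inj[OF U] by (auto simp: homeomorphic_maps_def g_def)
      ultimately show ?thesis
        using homeomorphic_maps_eq[OF h] by simp
    qed
    have "homeomorphic_maps (subtopology ?X (PiE UNIV U)) (top_of_set (?\<Phi> ` PiE UNIV U)) ?\<Phi>
            (\<lambda>v i. g i (v $ i))"
      unfolding homeomorphic_maps_def
    proof (intro conjI ballI)
      have c: "continuous_map (subtopology ?X (PiE UNIV U)) euclidean (\<lambda>x. \<phi> i (x i))" for i
      proof -
        have 1: "continuous_map (subtopology (mtop (E i)) (U i)) euclidean (\<phi> i)"
          using gc[of i] by (simp add: homeomorphic_maps_def continuous_map_in_subtopology)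
        have 2: "continuous_map (subtopology ?X (PiE UNIV U)) (subtopology (mtop (E i)) (U i)) (\<lambda>x. x i)"
          unfolding X by (rule continuous_map_product_projection) simp
        show ?thesis using continuous_map_compose[OF 2 1] by (simp only: o_def)
      qed
      have "continuous_map (subtopology ?X (PiE UNIV U)) euclidean ?\<Phi>"
        unfolding continuous_map_atin limitin_canonical_iff
        using c[unfolded continuous_map_atin limitin_canonical_iff]
        by (simp add: vec_tendstoI)
      then show "continuous_map (subtopology ?X (PiE UNIV U)) (top_of_set (?\<Phi> ` PiE UNIV U)) ?\<Phi>"
        by (simp add: continuous_map_in_subtopology tg)
      show "continuous_map (top_of_set (?\<Phi> ` PiE UNIV U)) (subtopology ?X (PiE UNIV U)) (\<lambda>v i. g i (v $ i))"
        unfolding X continuous_map_componentwise_UNIV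
      proof
        fix k
        have 1: "continuous_map (top_of_set (?\<Phi> ` PiE UNIV U)) (top_of_set (\<phi> k ` U k)) (\<lambda>v. v $ k)"
          unfolding im by (auto intro!: continuous_intros)
        have 2: "continuous_map (top_of_set (\<phi> k ` U k)) (subtopology (mtop (E k)) (U k)) (g k)"
          using gc[of k] by (simp add: homeomorphic_maps_def)
        show "continuous_map (top_of_set (?\<Phi> ` PiE UNIV U)) (subtopology (mtop (E k)) (U k)) (\<lambda>v. g k (v $ k))"
          using continuous_map_compose[OF 1 2] by (simp only: o_def)
      qed
      show "(\<lambda>i. g i (?\<Phi> x $ i)) = x" if "x \<in> topspace (subtopology ?X (PiE UNIV U))" for x
        using that inj[OF U] unfolding tg by (auto simp: g_def fun_eq_iff PiE_iff)
      show "?\<Phi> (\<lambda>i. g i (v $ i)) = v" if "v \<in> topspace (top_of_set (?\<Phi> ` PiE UNIV U))" for v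
        using that unfolding im by (simp add: g_def f_inv_into_f vec_eq_iff)
    qed
    then show ?thesis
      using o op[OF U] homeomorphic_maps_imp_map by (simp add: openin_PiE)
  qed
  have h5: "holo_on ((\<lambda>x. \<chi> i. \<psi> i (x i)) \<circ> inv_into (PiE UNIV U) (\<lambda>x. \<chi> i. \<phi> i (x i)))
      ((\<lambda>x. \<chi> i. \<phi> i (x i)) ` (PiE UNIV U \<inter> PiE UNIV V))"
    if U: "\<And>i. (U i, \<phi> i) \<in> charts (E i)" and V: "\<And>i. (V i, \<psi> i) \<in> charts (E i)"
    for U V :: "'n \<Rightarrow> 'a set" and \<phi> \<psi>
    unfolding holo_on_def
  proof
    let ?\<Phi> = "\<lambda>x. \<chi> i. \<phi> i (x i)"
    let ?f = "(\<lambda>x. \<chi> i. \<psi> i (x i)) \<circ> inv_into (PiE UNIV U) ?\<Phi>"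
    fix v assume "v \<in> ?\<Phi> ` (PiE UNIV U \<inter> PiE UNIV V)"
    then obtain x where x: "v = ?\<Phi> x" "\<And>i. x i \<in> U i" "\<And>i. x i \<in> V i"
      by (auto simp: PiE_iff)
    have "v $ i \<in> \<phi> i ` (U i \<inter> V i)" for i using x by auto
    then have "\<exists>D. (\<psi> i \<circ> inv_into (U i) (\<phi> i) has_derivative D) (at (v $ i)) \<and>
                 (\<forall>c w. D (scaleC c w) = scaleC c (D w))" for i
      using trans[OF U V] unfolding holo_on_def by blast
    then obtain D where D: "\<And>i. (\<psi> i \<circ> inv_into (U i) (\<phi> i) has_derivative D i) (at (v $ i))"
      "\<And>i c w. D i (scaleC c w) = scaleC c (D i w)" by metis
    define N where "N = (\<Inter>i. (\<lambda>w::complex ^ 'n. w $ i) -` (\<phi> i ` U i))"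
    have oN: "open N" unfolding N_def
      by (intro open_INT ballI open_vimage opi[OF U] continuous_intros) simp
    have vN: "v \<in> N" using x by (auto simp: N_def)
    have injP: "inj_on ?\<Phi> (PiE UNIV U)"
    proof (rule inj_onI)
      fix a b assume "a \<in> PiE UNIV U" "b \<in> PiE UNIV U" "?\<Phi> a = ?\<Phi> b"
      then have "a i \<in> U i" "b i \<in> U i" "\<phi> i (a i) = \<phi> i (b i)" for i
        by (auto simp: PiE_iff vec_eq_iff)
      then have "a i = b i" for i using inj_onD[OF inj[OF U]] by blast
      then show "a = b" by blast
    qed
    have f: "(\<chi> i. (\<psi> i \<circ> inv_into (U i) (\<phi> i)) (w $ i)) = ?f w" if "w \<in> N" for w
    proof -
      have w: "w $ i \<in> \<phi> i ` U i" for i using that by (auto simp: N_def)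
      let ?y = "\<lambda>i. inv_into (U i) (\<phi> i) (w $ i)"
      have 1: "?y \<in> PiE UNIV U"
        using w by (simp add: PiE_iff inv_into_into)
      have 2: "?\<Phi> ?y = w"
        using w by (simp add: f_inv_into_f vec_eq_iff)
      have "inv_into (PiE UNIV U) ?\<Phi> w = ?y" using inv_into_f_f[OF injP 1] unfolding 2 .
      then show ?thesis by simp
    qed
    have "((\<lambda>w. \<chi> i. (\<psi> i \<circ> inv_into (U i) (\<phi> i)) (w $ i)) has_derivative (\<lambda>h. \<chi> i. D i (h $ i))) (at v)"
    proof (rule has_derivative_vecI)
      fix i
      have "((\<lambda>w::complex ^ 'n. w $ i) has_derivative (\<lambda>h. h $ i)) (at v)"
        by (rule bounded_linear_imp_has_derivative[OF bounded_linear_vec_nth])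
      from has_derivative_compose[OF this D(1)]
      show "((\<lambda>w. (\<chi> i. (\<psi> i \<circ> inv_into (U i) (\<phi> i)) (w $ i)) $ i) has_derivative
             (\<lambda>h. (\<chi> i. D i (h $ i)) $ i)) (at v)" by simp
    qed
    then have "(?f has_derivative (\<lambda>h. \<chi> i. D i (h $ i))) (at v)"
      by (rule has_derivative_transform_within_open[OF _ oN vN]) (rule f)
    moreover have "(\<chi> i. D i (scaleC c h $ i)) = scaleC c (\<chi> i. D i (h $ i))" for c h
      using D(2) by (simp add: scaleC_vec_def vec_eq_iff)
    ultimately show "\<exists>D. (?f has_derivative D) (at v) \<and> (\<forall>c w. D (scaleC c w) = scaleC c (D w))"
      by blast
  qed
  have top: "mtop (product_cmfd E) = ?X" by (simp add: product_cmfd_def)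
  have ch: "\<exists>U \<phi>. \<kappa> = (PiE UNIV U, \<lambda>x. \<chi> i. \<phi> i (x i)) \<and> (\<forall>i. (U i, \<phi> i) \<in> charts (E i))"
    if "\<kappa> \<in> charts (product_cmfd E)" for \<kappa>
    using that by (simp add: product_cmfd_def)
  show ?thesis
    unfolding complex_manifold_def top case_prod_beta
  proof (intro conjI h1 h2 h3 ballI)
    fix \<kappa> assume "\<kappa> \<in> charts (product_cmfd E)"
    from ch[OF this] obtain U \<phi> where \<kappa>: "\<kappa> = (PiE UNIV U, \<lambda>x. \<chi> i. \<phi> i (x i))"
      and U: "\<And>i. (U i, \<phi> i) \<in> charts (E i)" by blast
    show "openin ?X (fst \<kappa>)" "open (snd \<kappa> ` fst \<kappa>)"
      "homeomorphic_map (subtopology ?X (fst \<kappa>)) (top_of_set (snd \<kappa> ` fst \<kappa>)) (snd \<kappa>)"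
      using h4[OF U] unfolding \<kappa> fst_conv snd_conv by blast+
  next
    fix \<kappa> \<kappa>' assume \<kappa>: "\<kappa> \<in> charts (product_cmfd E)" and \<kappa>': "\<kappa>' \<in> charts (product_cmfd E)"
    from ch[OF \<kappa>] obtain U \<phi> where 1: "\<kappa> = (PiE UNIV U, \<lambda>x. \<chi> i. \<phi> i (x i))"
      and U: "\<And>i. (U i, \<phi> i) \<in> charts (E i)" by blast
    from ch[OF \<kappa>'] obtain V \<psi> where 2: "\<kappa>' = (PiE UNIV V, \<lambda>x. \<chi> i. \<psi> i (x i))"
      and V: "\<And>i. (V i, \<psi> i) \<in> charts (E i)" by blast
    show "holo_on (snd \<kappa>' \<circ> inv_into (fst \<kappa>) (snd \<kappa>)) (snd \<kappa> ` (fst \<kappa> \<inter> fst \<kappa>'))"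
      unfolding 1 2 fst_conv snd_conv by (rule h5[OF U V])
  qed
qed

end

theory Submission
  imports Defs
begin

text \<open>An element \<open>g\<close> acts on \<open>\<complex>/\<Lambda>\<^sub>i\<close> by \<open>z \<mapsto> \<alpha>\<^sub>i(g) z + t\<^sub>i(g)\<close> with a root of unity
  \<open>\<alpha>\<^sub>i(g)\<close> of order 1, 2, 3, 4 or 6. On the class of the form \<open>d cnj z\<^sub>i \<otimes> \<partial>/\<partial>z\<^sub>i\<close> in \<open>H\<^sup>1(\<Theta>)\<close> it acts
  by \<open>\<alpha>\<^sub>i(g)\<^sup>2\<close>, so rigidity forces every character \<open>\<alpha>\<^sub>i\<^sup>2\<close> to be nontrivial. A map with
  \<open>\<alpha>\<^sub>i(g) \<noteq> 1\<close> has a fixed point, so freeness says that \<open>G\<close> is the union of the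
  translation subgroups \<open>ker \<alpha>\<^sub>i\<close>.

  A rotation has the same order as its linear part. Comparing the orders of \<open>x\<close> and \<open>x t\<close> for
  \<open>t \<in> ker \<alpha>\<^sub>j\<close> and \<open>\<alpha>\<^sub>j(x) \<noteq> 1\<close> shows that \<open>\<alpha>\<^sub>i(t)\<^sup>3 = 1\<close> or \<open>\<alpha>\<^sub>i(t)\<^sup>2 = 1\<close> for all \<open>i\<close>. This
  excludes the orders 4 and 6, hence also 2. So every lattice is stable under a primitive cube root of unity,
  \<open>G\<close> has exponent 3, and the kernels have index 3 and at most 9 elements. Counting the union gives
  \<open>n \<ge> 4\<close>. If some translation in \<open>ker \<alpha>\<^sub>i\<close> does not commute with a rotation, \<open>G\<close> is the Heisenberg group,
  and otherwise it is \<open>\<int>\<^sub>3\<^sup>2\<close>.\<close>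

section \<open>Finite groups acting on tori, abstractly\<close>

text \<open>Rigidity enters in contrapositive form: if some \<open>\<alpha> i\<close> takes only the
  values 1 and -1, a single explicit class that is invariant and nonzero contradicts it. The
  obstacle is that H^1 is given by Cech cocycles over pointed covers, while the class is that of a
  differential form. Charts of a torus are sections of the projection, so transition maps are
  translations. The conjugates of the chart coordinates are therefore local primitives of d cnj z
  whose differences are locally constant, and these differences form a holomorphic cocycle. A
  bounding cochain would produce an entire function that grows by cnj l along each lattice vector l.
  Such a function is affine by Liouville's theorem, and a lattice has too many real directions for
  its conjugation to be complex linear. The group theory is separated from the geometry:
  \<open>torus_characters\<close> keeps only the linear parts. Its bounds 9 and 3 are the numbers of
  points of a torus killed by 3 and by \<omega> - 1. They limit the order of the group to 27 in
  general and to 9 when all translations commute with a rotation.\<close>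

lemma isomI_bij_hom:
  assumes bij: "bij_betw f (carrier H) (carrier G)"
    and mult: "\<And>x y. x \<in> carrier H \<Longrightarrow> y \<in> carrier H \<Longrightarrow>
      x \<otimes>\<^bsub>H\<^esub> y \<in> carrier H \<and> f (x \<otimes>\<^bsub>H\<^esub> y) = f x \<otimes>\<^bsub>G\<^esub> f y"
  shows "G \<cong> H"
proof -
  let ?g = "inv_into (carrier H) f"
  have inj: "inj_on f (carrier H)" and im: "f ` carrier H = carrier G"
    using bij by (auto simp: bij_betw_def)
  have bij': "bij_betw ?g (carrier G) (carrier H)" by (rule bij_betw_inv_into[OF bij])
  have "?g (a \<otimes>\<^bsub>G\<^esub> b) = ?g a \<otimes>\<^bsub>H\<^esub> ?g b" if "a \<in> carrier G" "b \<in> carrier G" for a b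
  proof -
    have 1: "?g a \<in> carrier H" "?g b \<in> carrier H" "f (?g a) = a" "f (?g b) = b"
      using that unfolding im[symmetric] by (auto simp: inv_into_into f_inv_into_f)
    have "f (?g a \<otimes>\<^bsub>H\<^esub> ?g b) = a \<otimes>\<^bsub>G\<^esub> b" using mult[OF 1(1,2)] 1 by simp
    \<comment> \<open>Closure of \<open>H\<close> under its product, part of \<open>mult\<close>,
      allows \<open>f\<close> to be cancelled. It is a hypothesis because \<open>H\<close> is an
      arbitrary structure that need not be known to be a group.\<close>
    then show ?thesis using mult[OF 1(1,2)] inj by (metis inv_into_f_f)
  qed
  then have "?g \<in> iso G H"
    using bij' by (auto simp: iso_def hom_def bij_betw_def)
  then show ?thesis by (auto simp: is_iso_def)
qed

section \<open>Heisenberg matrices in coordinates modulo 3\<close>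

text \<open>Field elements have to serve as exponents of group powers, so each gets its
  representative among the naturals 0, 1, 2. The last case is the zero of the field, which
  \<open>exhaust_3\<close> writes as 3.\<close>

definition residue3 :: "3 \<Rightarrow> nat" where
  "residue3 x = (if x = 1 then 1 else if x = 2 then 2 else 0)"

lemma residue3_add: "residue3 (x + y) mod 3 = (residue3 x + residue3 y) mod 3"
  using exhaust_3[of x] exhaust_3[of y] by (auto simp: residue3_def)

lemma residue3_mult: "residue3 (x * y) mod 3 = (residue3 x * residue3 y) mod 3"
  using exhaust_3[of x] exhaust_3[of y] by (auto simp: residue3_def)

lemma residue3_add_mult:
  "residue3 (x + y + z * w) mod 3 = (residue3 x + residue3 y + residue3 z * residue3 w) mod 3"
proof -
  have "residue3 (x + y + z * w) mod 3 = (residue3 (x + y) mod 3 + residue3 (z * w) mod 3) mod 3"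
    by (simp only: residue3_add[of "x + y" "z * w"] mod_add_eq)
  also have "\<dots> = (residue3 x + residue3 y + residue3 z * residue3 w) mod 3"
    by (simp only: residue3_add residue3_mult mod_add_eq)
  finally show ?thesis .
qed

lemma bij_residue3: "bij_betw residue3 UNIV {..<3}"
proof -
  have "inj residue3"
  proof (rule injI)
    fix x y assume "residue3 x = residue3 y"
    then show "x = y" using exhaust_3[of x] exhaust_3[of y] by (auto simp: residue3_def)
  qed
  moreover have "residue3 ` UNIV = {..<3}"
  proof -
    have "residue3 1 = 1" "residue3 2 = 2" "residue3 3 = 0" by (simp_all add: residue3_def)
    then have "residue3 ` UNIV = {1, 2, 0}" by (simp add: UNIV_3)
    also have "\<dots> = {..<3}" by auto
    finally show ?thesis .
  qed
  ultimately show ?thesis by (simp add: bij_betw_def)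
qed

text \<open>The middle coordinate is the corner entry, which parametrizes the centre. In this order
  the product becomes (a + a', b + b' + a * e', e + e').\<close>

definition heis_coords :: "3 ^ 3 ^ 3 \<Rightarrow> nat \<times> nat \<times> nat" where
  "heis_coords A = (residue3 (A $ 1 $ 2), residue3 (A $ 1 $ 3), residue3 (A $ 2 $ 3))"

lemma carrier_Heis3:
  "A \<in> carrier Heis3 \<longleftrightarrow> A $ 1 $ 1 = 1 \<and> A $ 2 $ 2 = 1 \<and> A $ 3 $ 3 = 1 \<and>
     A $ 2 $ 1 = 0 \<and> A $ 3 $ 1 = 0 \<and> A $ 3 $ 2 = 0"
  by (auto simp: Heis3_def det_3)

lemma heis_mult_entries:
  assumes "A \<in> carrier Heis3" "B \<in> carrier Heis3"
  shows "(A \<otimes>\<^bsub>Heis3\<^esub> B) $ 1 $ 2 = A $ 1 $ 2 + B $ 1 $ 2"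
    and "(A \<otimes>\<^bsub>Heis3\<^esub> B) $ 1 $ 3 = A $ 1 $ 3 + B $ 1 $ 3 + A $ 1 $ 2 * B $ 2 $ 3"
    and "(A \<otimes>\<^bsub>Heis3\<^esub> B) $ 2 $ 3 = A $ 2 $ 3 + B $ 2 $ 3"
  using assms unfolding carrier_Heis3
  by (auto simp: Heis3_def matrix_matrix_mult_def sum_3)

lemma heis_mult_closed:
  assumes "A \<in> carrier Heis3" "B \<in> carrier Heis3"
  shows "A \<otimes>\<^bsub>Heis3\<^esub> B \<in> carrier Heis3"
  using assms unfolding carrier_Heis3
  by (auto simp: Heis3_def matrix_matrix_mult_def sum_3)

lemma bij_heis_coords: "bij_betw heis_coords (carrier Heis3) ({..<3} \<times> {..<3} \<times> {..<3})"
proof -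
  have inj3: "residue3 x = residue3 y \<longleftrightarrow> x = y" for x y
    using bij_residue3 by (auto simp: bij_betw_def inj_def)
  have lt: "residue3 x < 3" for x by (simp add: residue3_def)
  have "inj_on heis_coords (carrier Heis3)"
    by (rule inj_onI) (auto simp: carrier_Heis3 heis_coords_def inj3 vec_eq_iff forall_3)
  moreover have "heis_coords ` carrier Heis3 = {..<3} \<times> {..<3} \<times> {..<3}"
  proof (intro equalityI subsetI)
    fix p assume "p \<in> {..<3::nat} \<times> {..<3::nat} \<times> {..<3::nat}"
    then obtain x y z where p: "p = (residue3 x, residue3 y, residue3 z)"
      using bij_residue3 unfolding bij_betw_def by (metis (no_types, lifting) imageE mem_Sigma_iff surj_pair)
    define A :: "3 ^ 3 ^ 3" where "A = vector [vector [1, x, y], vector [0, 1, z], vector [0, 0, 1]]"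
    have "A \<in> carrier Heis3" "heis_coords A = p"
      by (simp_all add: A_def carrier_Heis3 heis_coords_def p)
    then show "p \<in> heis_coords ` carrier Heis3" by blast
  qed (auto simp: heis_coords_def lt)
  ultimately show ?thesis by (simp add: bij_betw_def)
qed

section \<open>Powers and commutation in a group\<close>

context group begin

lemma pow_mod_order:
  assumes "x \<in> carrier G" "x [^] (k::nat) = \<one>" "m mod k = n mod k"
  shows "x [^] m = x [^] n"
proof -
  have "x [^] m = x [^] (m mod k)" for m :: nat
  proof -
    have "x [^] m = x [^] (k * (m div k) + m mod k)" by simp
    also have "\<dots> = (x [^] k) [^] (m div k) \<otimes> x [^] (m mod k)"
      by (simp only: nat_pow_mult[OF assms(1), symmetric] nat_pow_pow[OF assms(1)])
    finally show ?thesis using assms by simp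
  qed
  then show ?thesis using assms(3) by metis
qed

text \<open>Every exchange of one factor \<open>g\<close> with one factor \<open>t\<close> releases
  one factor \<open>c\<close>, which commutes with both. Moving \<open>g [^] a\<close> past
  \<open>t [^] e\<close> takes a * e exchanges.\<close>

lemma heisenberg_pow_commute:
  fixes a e :: nat
  assumes c: "g \<in> carrier G" "t \<in> carrier G" "c \<in> carrier G"
    and gt: "g \<otimes> t = c \<otimes> t \<otimes> g" and gc: "g \<otimes> c = c \<otimes> g" and tc: "t \<otimes> c = c \<otimes> t"
  shows "g [^] a \<otimes> t [^] e = c [^] (a * e) \<otimes> t [^] e \<otimes> g [^] a"
proof -
  have tce: "g \<otimes> c [^] k = c [^] k \<otimes> g" for k :: nat
    using group_commutes_pow[of c g k] gc c by simp
  have 1: "g \<otimes> t [^] e = c [^] e \<otimes> t [^] e \<otimes> g" for e :: nat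
  proof (induction e)
    case (Suc e)
    have "g \<otimes> t [^] Suc e = (g \<otimes> t [^] e) \<otimes> t" using c by (simp add: m_assoc)
    also have "\<dots> = c [^] e \<otimes> t [^] e \<otimes> (g \<otimes> t)" using c Suc by (simp add: m_assoc)
    also have "\<dots> = c [^] e \<otimes> (t [^] e \<otimes> c) \<otimes> t \<otimes> g" using c gt by (simp add: m_assoc)
    also have "t [^] e \<otimes> c = c \<otimes> t [^] e" using group_commutes_pow[of t c e] tc c by simp
    finally show ?case using c by (simp add: m_assoc)
  qed (use c in simp)
  show ?thesis
  proof (induction a)
    case (Suc a)
    have "g [^] Suc a \<otimes> t [^] e = g [^] a \<otimes> (g \<otimes> t [^] e)" using c by (simp add: m_assoc)
    also have "\<dots> = (g [^] a \<otimes> c [^] e) \<otimes> t [^] e \<otimes> g" using c by (simp add: 1 m_assoc)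
    also have "g [^] a \<otimes> c [^] e = c [^] e \<otimes> g [^] a"
      using group_commutes_pow[of g "c [^] e" a] tce[of e] c by simp
    also have "c [^] e \<otimes> g [^] a \<otimes> t [^] e \<otimes> g = c [^] e \<otimes> (g [^] a \<otimes> t [^] e) \<otimes> g"
      using c by (simp add: m_assoc)
    also have "\<dots> = c [^] (e + a * e) \<otimes> t [^] e \<otimes> g [^] Suc a"
      using c Suc by (simp add: m_assoc nat_pow_mult[symmetric])
    finally show ?case by (simp add: add.commute)
  qed (use c in simp)
qed

end

section \<open>Primitive cube and sixth roots of unity as zeros of z^2 + z + 1 and z^2 - z +
  1\<close>

lemma cube_root:
  fixes z :: complex
  assumes "z\<^sup>2 + z + 1 = 0"
  shows "z ^ 3 = 1" "z \<noteq> 1"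
proof -
  have "z ^ 3 - 1 = (z - 1) * (z\<^sup>2 + z + 1)"
    by (simp add: algebra_simps power2_eq_square power3_eq_cube)
  then show "z ^ 3 = 1" using assms by simp
  show "z \<noteq> 1" using assms by auto
qed

lemma sixth_root:
  fixes z :: complex
  assumes "z\<^sup>2 - z + 1 = 0"
  shows "z ^ 3 = -1" "(z\<^sup>2)\<^sup>2 + z\<^sup>2 + 1 = 0"
proof -
  have "z ^ 3 + 1 = (z + 1) * (z\<^sup>2 - z + 1)"
    by (simp add: algebra_simps power2_eq_square power3_eq_cube)
  then show "z ^ 3 = -1" using assms by (simp add: eq_neg_iff_add_eq_0)
  have "(z\<^sup>2)\<^sup>2 + z\<^sup>2 + 1 = (z\<^sup>2 + z + 1) * (z\<^sup>2 - z + 1)"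
    by (simp add: algebra_simps power2_eq_square)
  then show "(z\<^sup>2)\<^sup>2 + z\<^sup>2 + 1 = 0" using assms by simp
qed

lemma omega_roots:
  fixes x w :: complex
  assumes "x\<^sup>2 + x + 1 = 0" "w\<^sup>2 + w + 1 = 0"
  shows "x = w \<or> x = w\<^sup>2"
proof -
  have "(x - w) * (x - w\<^sup>2) = (x\<^sup>2 + x + 1) - (w\<^sup>2 + w + 1) * x + (w ^ 3 - 1)"
    by (simp add: algebra_simps power2_eq_square power3_eq_cube)
  then show ?thesis using assms cube_root[OF assms(2)] by simp
qed

lemma omega_pow_inj:
  fixes w :: complex
  assumes w: "w\<^sup>2 + w + 1 = 0" and "a < 3" "b < 3" "w ^ a = w ^ b"
  shows "a = b"
proof -
  have 0: "w \<noteq> 0" "w \<noteq> 1" "w\<^sup>2 \<noteq> 1" "w\<^sup>2 \<noteq> w"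
  proof -
    show "w \<noteq> 0" "w \<noteq> 1" using w by auto
    show "w\<^sup>2 \<noteq> 1"
    proof
      assume "w\<^sup>2 = 1"
      then have "w = -2" using w by (simp add: eq_neg_iff_add_eq_0 add.commute)
      with w show False by simp
    qed
    show "w\<^sup>2 \<noteq> w" using \<open>w \<noteq> 0\<close> \<open>w \<noteq> 1\<close> by (auto simp: power2_eq_square)
  qed
  have "a = 0 \<or> a = 1 \<or> a = 2" "b = 0 \<or> b = 1 \<or> b = 2" using assms by auto
  then show ?thesis using assms(4) 0 by auto
qed

text \<open>All that the group theory keeps of the geometry. \<open>cover\<close> is what remains of
  freeness and \<open>square_nontrivial\<close> what remains of rigidity.
  \<open>card_3_torsion\<close> holds because the points of a torus killed by 3 form a group of
  order 9. In \<open>card_centralizer\<close> a translation commutes with \<open>g\<close> exactly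
  when its vector is killed by the linear part of \<open>g\<close> minus 1, an endomorphism of
  degree 3.\<close>

locale torus_characters = group G for G (structure) +
  fixes \<alpha> :: "'n::finite \<Rightarrow> 'a \<Rightarrow> complex"
  assumes fin: "finite (carrier G)"
    and alpha_mult: "\<And>i g h. g \<in> carrier G \<Longrightarrow> h \<in> carrier G \<Longrightarrow> \<alpha> i (g \<otimes> h) = \<alpha> i g * \<alpha> i h"
    and ker_comm: "\<And>i g h. g \<in> carrier G \<Longrightarrow> h \<in> carrier G \<Longrightarrow> \<alpha> i g = 1 \<Longrightarrow> \<alpha> i h = 1 \<Longrightarrow>
      g \<otimes> h = h \<otimes> g"
    and pow_eq_one: "\<And>i g k. g \<in> carrier G \<Longrightarrow> \<alpha> i g \<noteq> 1 \<Longrightarrow> \<alpha> i g ^ k = 1 \<Longrightarrow> g [^] k = \<one>"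
    and alpha_values: "\<And>i g. g \<in> carrier G \<Longrightarrow> \<alpha> i g = 1 \<or> \<alpha> i g = -1 \<or> (\<alpha> i g)\<^sup>2 = -1 \<or>
      (\<alpha> i g)\<^sup>2 + \<alpha> i g + 1 = 0 \<or> (\<alpha> i g)\<^sup>2 - \<alpha> i g + 1 = 0"
    and cover: "\<And>g. g \<in> carrier G \<Longrightarrow> \<exists>i. \<alpha> i g = 1"
    and square_nontrivial: "\<And>i. \<exists>g\<in>carrier G. (\<alpha> i g)\<^sup>2 \<noteq> 1"
    and card_3_torsion: "\<And>i. card {t \<in> carrier G. \<alpha> i t = 1 \<and> t [^] (3::nat) = \<one>} \<le> 9"
    and card_centralizer: "\<And>i g. g \<in> carrier G \<Longrightarrow> (\<alpha> i g)\<^sup>2 + \<alpha> i g + 1 = 0 \<Longrightarrow>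
      card {t \<in> carrier G. \<alpha> i t = 1 \<and> g \<otimes> t = t \<otimes> g} \<le> 3"
begin

lemma alpha_one [simp]: "\<alpha> i \<one> = 1"
proof -
  have "\<alpha> i \<one> * \<alpha> i \<one> = \<alpha> i \<one>" using alpha_mult[of \<one> \<one> i] by simp
  moreover have "\<alpha> i \<one> \<noteq> 0" using alpha_values[of \<one> i] by auto
  ultimately show ?thesis by simp
qed

lemma alpha_pow: "g \<in> carrier G \<Longrightarrow> \<alpha> i (g [^] (k::nat)) = \<alpha> i g ^ k"
  by (induction k) (auto simp: alpha_mult)

lemma alpha_inv: "g \<in> carrier G \<Longrightarrow> \<alpha> i (inv g) = inverse (\<alpha> i g)"
  using alpha_mult[of g "inv g" i] inverse_unique by fastforce

lemma coset_pow:
  assumes "x \<in> carrier G" "t \<in> carrier G" "\<alpha> j t = 1" "\<alpha> j x \<noteq> 1" "\<alpha> j x ^ k = 1"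
  shows "(x \<otimes> t) [^] k = \<one>" "x [^] k = \<one>"
  using assms pow_eq_one[of "x \<otimes> t" j k] pow_eq_one[of x j k] by (simp_all add: alpha_mult)

text \<open>Both \<open>x\<close> and \<open>x \<otimes> t\<close> have trivial k-th power, as their
  common linear part on factor \<open>j\<close> is not 1. Applying the character of any other factor
  \<open>i\<close> to both equations and dividing isolates \<open>t\<close>.\<close>

lemma ker_alpha_pow:
  assumes "x \<in> carrier G" "t \<in> carrier G" "\<alpha> j t = 1" "\<alpha> j x \<noteq> 1" "\<alpha> j x ^ k = 1"
  shows "\<alpha> i t ^ k = 1"
proof -
  have "\<alpha> i x ^ k * \<alpha> i t ^ k = 1" "\<alpha> i x ^ k = 1"
    using coset_pow[OF assms] assms alpha_pow[of "x \<otimes> t" i k] alpha_pow[of x i k]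
    by (simp_all add: alpha_mult power_mult_distrib)
  then show ?thesis by simp
qed

lemma ker_commuting_pow:
  assumes "x \<in> carrier G" "t \<in> carrier G" "\<alpha> j t = 1" "\<alpha> j x \<noteq> 1" "\<alpha> j x ^ k = 1"
    and "x \<otimes> t = t \<otimes> x"
  shows "t [^] k = \<one>"
  using coset_pow[OF assms(1-5)] assms pow_mult_distrib[of x t k] by simp

text \<open>By \<open>cover\<close> the element lies in some kernel \<open>k\<close>, and rigidity
  provides \<open>h\<close> whose linear part there has order 3, 4 or 6. One of \<open>h\<close> and
  its square has order 2 or 3 on that factor, and this exponent then kills \<open>t\<close> under
  every character at once.\<close>

lemma alpha_power_3_or_2:
  assumes "t \<in> carrier G"
  shows "(\<forall>i. \<alpha> i t ^ 3 = 1) \<or> (\<forall>i. \<alpha> i t ^ 2 = 1)"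
proof -
  obtain k where k: "\<alpha> k t = 1" using cover[OF assms] by blast
  obtain h where h: "h \<in> carrier G" "(\<alpha> k h)\<^sup>2 \<noteq> 1" using square_nontrivial by blast
  let ?w = "\<alpha> k h" and ?h2 = "h [^] (2::nat)"
  have h2: "?h2 \<in> carrier G" "\<alpha> k ?h2 = ?w\<^sup>2" using h alpha_pow by auto
  consider "?w\<^sup>2 = -1" | "?w\<^sup>2 + ?w + 1 = 0" | "?w\<^sup>2 - ?w + 1 = 0"
    using alpha_values[OF h(1), of k] h(2) by auto
  then show ?thesis
  proof cases
    case 1
    then have "\<alpha> i t ^ 2 = 1" for i
      using ker_alpha_pow[OF h2(1) assms k, of 2] h2 h(2) by simp
    then show ?thesis by blast
  next
    case 2
    then have "\<alpha> i t ^ 3 = 1" for i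
      using ker_alpha_pow[OF h(1) assms k, of 3] cube_root[OF 2] by simp
    then show ?thesis by blast
  next
    case 3
    then have "\<alpha> i t ^ 3 = 1" for i
      using ker_alpha_pow[OF h2(1) assms k, of 3 i] cube_root[OF sixth_root(2)[OF 3]]
      unfolding h2(2) by blast
    then show ?thesis by blast
  qed
qed

lemma alpha_not_order_4: "(\<alpha> i g)\<^sup>2 \<noteq> -1" if "g \<in> carrier G"
proof
  assume a: "(\<alpha> i g)\<^sup>2 = -1"
  have "\<alpha> i g ^ 3 = 1 \<or> (\<alpha> i g)\<^sup>2 = 1" using alpha_power_3_or_2[OF that] by blast
  then show False
  proof
    assume "\<alpha> i g ^ 3 = 1"
    then have "- \<alpha> i g = 1" using a by (simp add: power3_eq_cube power2_eq_square)
    then have "\<alpha> i g = -1" by (metis minus_minus)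
    with a show False by simp
  qed (use a in simp)
qed

lemma alpha_not_order_6: "(\<alpha> i g)\<^sup>2 - \<alpha> i g + 1 \<noteq> 0" if "g \<in> carrier G"
proof
  let ?z = "\<alpha> i g"
  assume a: "?z\<^sup>2 - ?z + 1 = 0"
  have "?z ^ 3 = -1" using a by (rule sixth_root)
  moreover have "?z ^ 3 = 1 \<or> ?z\<^sup>2 = 1" using alpha_power_3_or_2[OF that] by blast
  ultimately have "?z\<^sup>2 = 1" by auto
  then have "?z = 2" using a by (simp add: algebra_simps)
  with a show False by simp
qed

lemma ex_alpha_omega: "\<exists>g\<in>carrier G. (\<alpha> i g)\<^sup>2 + \<alpha> i g + 1 = 0"
proof -
  obtain h where "h \<in> carrier G" "(\<alpha> i h)\<^sup>2 \<noteq> 1" using square_nontrivial by blast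
  then show ?thesis
    using alpha_values[of h i] alpha_not_order_4[of h i] alpha_not_order_6[of h i] by auto
qed

lemma alpha_cases:
  assumes "g \<in> carrier G"
  shows "\<alpha> i g = 1 \<or> (\<alpha> i g)\<^sup>2 + \<alpha> i g + 1 = 0"
proof -
  have "\<alpha> i g \<noteq> -1"
  proof
    assume a: "\<alpha> i g = -1"
    obtain h where h: "h \<in> carrier G" "(\<alpha> i h)\<^sup>2 + \<alpha> i h + 1 = 0" using ex_alpha_omega by blast
    \<comment> \<open>The negative of a primitive cube root of unity is a primitive sixth root,
      which is already excluded.\<close>
    then show False using a assms alpha_not_order_6[of "g \<otimes> h" i] by (simp add: alpha_mult)
  qed
  then show ?thesis
    using alpha_values[OF assms, of i] alpha_not_order_4[OF assms, of i]
      alpha_not_order_6[OF assms, of i] by auto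
qed

lemma pow_3_eq_one:
  assumes "g \<in> carrier G"
  shows "g [^] (3::nat) = \<one>"
proof (cases "\<exists>i. \<alpha> i g \<noteq> 1")
  case True
  then obtain i where i: "\<alpha> i g \<noteq> 1" by blast
  then show ?thesis using pow_eq_one[OF assms i] alpha_cases[OF assms, of i] cube_root by blast
next
  case False
  \<comment> \<open>Now \<open>g\<close> is a translation on every factor. Any \<open>h\<close> lies
    in some kernel, where \<open>g\<close> lies too, so \<open>g\<close> commutes with
    \<open>h\<close>. Choosing \<open>h\<close> as a rotation of order 3 on factor \<open>j\<close>
    transfers its exponent to \<open>g\<close>.\<close>
  fix j :: 'n
  obtain h where h: "h \<in> carrier G" "(\<alpha> j h)\<^sup>2 + \<alpha> j h + 1 = 0"
    using ex_alpha_omega by blast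
  obtain k where "\<alpha> k h = 1" using cover h by blast
  then have "h \<otimes> g = g \<otimes> h" using False ker_comm[OF h(1) assms] by blast
  then show ?thesis
    using ker_commuting_pow[of h g j 3] h assms False cube_root[OF h(2)] by blast
qed

lemma pow_mod_3: "x \<in> carrier G \<Longrightarrow> m mod 3 = n mod 3 \<Longrightarrow> x [^] (m::nat) = x [^] n"
  using pow_mod_order[OF _ pow_3_eq_one] by blast

lemma pow_inj_3:
  assumes x: "x \<in> carrier G" "x \<noteq> \<one>" and "e < 3" "e' < 3" "x [^] (e::nat) = x [^] e'"
  shows "e = e'"
proof -
  have "\<not> (e < e')" if a: "e < 3" "e' < 3" "x [^] e = x [^] e'" for e e' :: nat
  proof
    assume less: "e < e'"
    have "x [^] e \<otimes> x [^] (e' - e) = x [^] e'"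
      using x less nat_pow_mult[of x e "e' - e"] by simp
    also have "\<dots> = x [^] e \<otimes> \<one>" using a x by simp
    finally have 1: "x [^] (e' - e) = \<one>" using x by simp
    have "x [^] (3::nat) = x [^] (2::nat) \<otimes> x"
      by (simp only: numeral_3_eq_3 numeral_2_eq_2 nat_pow_Suc)
    then have 2: "x [^] (2::nat) \<noteq> \<one>"
      using pow_3_eq_one[OF x(1)] x l_one[OF x(1)] by metis
    have "e' - e = 1 \<or> e' - e = 2" using a less by auto
    with 1 2 show False using x nat_pow_eone[OF x(1)] by metis
  qed
  from this[of e e'] this[of e' e] show ?thesis using assms by (metis linorder_neqE_nat)
qed

definition ker :: "'n \<Rightarrow> 'a set" where
  "ker i = {t \<in> carrier G. \<alpha> i t = 1}"

text \<open>The image of \<open>\<alpha> i\<close> consists of the three cube roots of unity, so the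
  powers of \<open>g\<close> represent the cosets of the kernel.\<close>

lemma bij_ker_times_powers:
  assumes g: "g \<in> carrier G" "(\<alpha> i g)\<^sup>2 + \<alpha> i g + 1 = 0"
  shows "bij_betw (\<lambda>(t, a). t \<otimes> g [^] a) (ker i \<times> {..<3::nat}) (carrier G)"
  unfolding bij_betw_def
proof (intro conjI equalityI subsetI)
  let ?f = "\<lambda>(t, a). t \<otimes> g [^] (a::nat)" and ?w = "\<alpha> i g"
  have al: "\<alpha> i (t \<otimes> g [^] a) = ?w ^ a" if "t \<in> ker i" for t and a :: nat
    using that g by (simp add: ker_def alpha_mult alpha_pow)
  show "inj_on ?f (ker i \<times> {..<3})"
  proof (rule inj_onI)
    fix x y assume "x \<in> ker i \<times> {..<3::nat}" "y \<in> ker i \<times> {..<3::nat}" and eq: "?f x = ?f y"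
    then obtain t a s b where xy: "x = (t, a)" "y = (s, b)" "t \<in> ker i" "s \<in> ker i" "a < 3" "b < 3"
      by auto
    have "?w ^ a = ?w ^ b" using eq al[OF xy(3), of a] al[OF xy(4), of b] xy by simp
    then have "a = b" using omega_pow_inj[OF g(2)] xy by blast
    then show "x = y" using eq xy g by (simp add: ker_def)
  qed
  fix x assume "x \<in> ?f ` (ker i \<times> {..<3})"
  then show "x \<in> carrier G" using g by (auto simp: ker_def)
next
  let ?f = "\<lambda>(t, a). t \<otimes> g [^] (a::nat)" and ?w = "\<alpha> i g"
  fix x assume x: "x \<in> carrier G"
  have "\<alpha> i x = 1 \<or> \<alpha> i x = ?w \<or> \<alpha> i x = ?w\<^sup>2"
  proof (cases "\<alpha> i x = 1")
    case False
    then have "(\<alpha> i x)\<^sup>2 + \<alpha> i x + 1 = 0" using alpha_cases[OF x] by blast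
    then show ?thesis using omega_roots g(2) by blast
  qed simp
  then have "\<exists>a<3. \<alpha> i x = ?w ^ a"
    by (elim disjE) (auto intro: exI[of _ "0::nat"] exI[of _ "1::nat"] exI[of _ "2::nat"])
  then obtain a :: nat where a: "a < 3" "\<alpha> i x = ?w ^ a" by blast
  have "?w \<noteq> 0" using g(2) by auto
  then have "x \<otimes> inv (g [^] a) \<in> ker i"
    using x g a by (simp add: ker_def alpha_mult alpha_inv alpha_pow)
  moreover have "x = ?f (x \<otimes> inv (g [^] a), a)" using x g by (simp add: m_assoc)
  ultimately show "x \<in> ?f ` (ker i \<times> {..<3})" using a(1) by blast
qed

lemma card_carrier: "card (carrier G) = 3 * card (ker i)"
proof -
  obtain g where "g \<in> carrier G" "(\<alpha> i g)\<^sup>2 + \<alpha> i g + 1 = 0" using ex_alpha_omega by blast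
  from bij_betw_same_card[OF bij_ker_times_powers[OF this]]
  show ?thesis by (simp add: card_cartesian_product)
qed

lemma finite_ker [simp]: "finite (ker i)"
  using fin by (simp add: ker_def)

lemma one_in_ker [simp]: "\<one> \<in> ker i"
  by (simp add: ker_def)

theorem four_le_card: "4 \<le> CARD('n)"
proof (rule ccontr)
  assume "\<not> 4 \<le> CARD('n)"
  then have n: "CARD('n) \<le> 3" by simp
  fix j :: 'n
  define m where "m = card (ker j)"
  have ck: "card (ker i) = m" for i using card_carrier[of i] card_carrier[of j] by (simp add: m_def)
  have m: "m \<ge> 1" unfolding m_def by (metis One_nat_def Suc_leI card_gt_0_iff emptyE finite_ker one_in_ker)
  \<comment> \<open>The identity lies in all kernels and is counted once: three kernels of order
    \<open>m\<close> give at most 1 + 3 (m - 1) elements, fewer than the 3 m elements of the group.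
    As the subtraction is on naturals, \<open>m \<ge> 1\<close> matters.\<close>
  have "carrier G \<subseteq> insert \<one> (\<Union>i. ker i - {\<one>})"
    using cover by (auto simp: ker_def)
  then have "card (carrier G) \<le> card (insert \<one> (\<Union>i. ker i - {\<one>}))"
    by (intro card_mono) auto
  also have "\<dots> \<le> Suc (card (\<Union>i. ker i - {\<one>}))" by (simp add: card_insert_if)
  also have "card (\<Union>i. ker i - {\<one>}) \<le> (\<Sum>i\<in>UNIV. card (ker i - {\<one>}))"
    by (rule card_UN_le) simp
  also have "\<dots> = CARD('n) * (m - 1)" using ck by simp
  also have "\<dots> \<le> 3 * (m - 1)" using n by simp
  finally have "3 * m \<le> Suc (3 * (m - 1))" using card_carrier[of j] by (simp add: m_def)
  with m show False by simp
qed

text \<open>The centralizer bound applies to the whole kernel, which leaves at most 9 elements; the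
  products of powers of \<open>g\<close> and of one nontrivial translation \<open>t\<close> already
  fill them.\<close>

lemma iso_abelian_case:
  assumes g: "g \<in> carrier G" "(\<alpha> i g)\<^sup>2 + \<alpha> i g + 1 = 0"
    and comm: "\<And>t. t \<in> ker i \<Longrightarrow> g \<otimes> t = t \<otimes> g"
  shows "G \<cong> integer_mod_group 3 \<times>\<times> integer_mod_group 3"
proof -
  have "\<exists>t\<in>ker i. t \<noteq> \<one>"
  proof (rule ccontr)
    assume "\<not> ?thesis"
    then have ki: "ker i = {\<one>}" by (auto simp: ker_def)
    \<comment> \<open>With a trivial kernel the group would be generated by \<open>g\<close>. Since
      \<open>g\<close> lies in some kernel \<open>k\<close>, the character \<open>\<alpha> k\<close>
      would be trivial on the whole group, against \<open>square_nontrivial\<close>.\<close>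
    obtain k where k: "\<alpha> k g = 1" using cover g by blast
    obtain x where x: "x \<in> carrier G" "(\<alpha> k x)\<^sup>2 \<noteq> 1" using square_nontrivial by blast
    then have "x \<in> (\<lambda>(t, a). t \<otimes> g [^] a) ` (ker i \<times> {..<3::nat})"
      using bij_ker_times_powers[OF g] by (simp add: bij_betw_def)
    then obtain a :: nat where "x = \<one> \<otimes> g [^] a" unfolding ki by auto
    then show False using x g k by (simp add: alpha_pow)
  qed
  then obtain t where t: "t \<in> carrier G" "\<alpha> i t = 1" "t \<noteq> \<one>" by (auto simp: ker_def)
  have "ker i = {t \<in> carrier G. \<alpha> i t = 1 \<and> g \<otimes> t = t \<otimes> g}"
    using comm by (auto simp: ker_def)
  then have "card (ker i) \<le> 3" using card_centralizer[OF g] by simp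
  then have le9: "card (carrier G) \<le> 9" using card_carrier[of i] by simp
  define f where "f = (\<lambda>(e::int, a::int). t [^] nat e \<otimes> g [^] nat a)"
  have gt: "g \<otimes> t = t \<otimes> g" using comm t by (simp add: ker_def)
  have gta: "g [^] a \<otimes> t [^] e = t [^] e \<otimes> g [^] a" for a e :: nat
  proof -
    have "g \<otimes> t [^] e = t [^] e \<otimes> g" using group_commutes_pow[of t g e] gt g t by simp
    then show ?thesis using group_commutes_pow[of g "t [^] e" a] g t by simp
  qed
  have inj: "inj_on f ({0..<3} \<times> {0..<3})"
  proof (rule inj_onI)
    fix x y assume "x \<in> {0..<3::int} \<times> {0..<3::int}" "y \<in> {0..<3::int} \<times> {0..<3::int}" "f x = f y"
    then obtain e a e' a' where xy: "x = (e, a)" "y = (e', a')" "e \<in> {0..<3}" "e' \<in> {0..<3}"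
        "a \<in> {0..<3}" "a' \<in> {0..<3}"
      and eq: "t [^] nat e \<otimes> g [^] nat a = t [^] nat e' \<otimes> g [^] nat a'"
      unfolding f_def by auto
    have "\<alpha> i (t [^] nat e \<otimes> g [^] nat a) = \<alpha> i (t [^] nat e' \<otimes> g [^] nat a')" using eq by simp
    then have "\<alpha> i g ^ nat a = \<alpha> i g ^ nat a'" using g t by (simp add: alpha_mult alpha_pow)
    moreover have lt: "nat a < 3" "nat a' < 3" "nat e < 3" "nat e' < 3" using xy by auto
    ultimately have "nat a = nat a'" using omega_pow_inj[OF g(2)] by blast
    moreover from this have "t [^] nat e = t [^] nat e'" using eq g t by simp
    then have "nat e = nat e'" using pow_inj_3 t lt by blast
    ultimately show "x = y" using xy by (auto simp: eq_nat_nat_iff)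
  qed
  have sub: "f ` ({0..<3} \<times> {0..<3}) \<subseteq> carrier G" using g t by (auto simp: f_def)
  have "card (f ` ({0..<3} \<times> {0..<3})) = 9"
    using card_image[OF inj] by (simp add: card_cartesian_product)
  then have im: "f ` ({0..<3} \<times> {0..<3}) = carrier G"
    using card_seteq[OF fin sub] le9 by simp
  have car: "carrier (integer_mod_group 3 \<times>\<times> integer_mod_group 3) = {0..<3} \<times> {0..<3}"
    by (simp add: DirProd_def integer_mod_group_def)
  show ?thesis
  proof (rule isomI_bij_hom)
    show "bij_betw f (carrier (integer_mod_group 3 \<times>\<times> integer_mod_group 3)) (carrier G)"
      unfolding car using inj im by (simp add: bij_betw_def)
    fix x y assume "x \<in> carrier (integer_mod_group 3 \<times>\<times> integer_mod_group 3)"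
      "y \<in> carrier (integer_mod_group 3 \<times>\<times> integer_mod_group 3)"
    then obtain e a e' a' where xy: "x = (e, a)" "y = (e', a')" "e \<in> {0..<3}" "e' \<in> {0..<3}"
        "a \<in> {0..<3}" "a' \<in> {0..<3}" unfolding car by auto
    have mult: "x \<otimes>\<^bsub>integer_mod_group 3 \<times>\<times> integer_mod_group 3\<^esub> y = ((e + e') mod 3, (a + a') mod 3)"
      by (simp add: xy DirProd_def integer_mod_group_def)
    have nm: "nat ((k + l) mod 3) mod 3 = (nat k + nat l) mod 3" if "k \<in> {0..<3}" "l \<in> {0..<3}" for k l :: int
      using that by (simp add: nat_mod_distrib nat_add_distrib)
    have "f x \<otimes> f y = t [^] nat e \<otimes> (g [^] nat a \<otimes> t [^] nat e') \<otimes> g [^] nat a'"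
      using g t by (simp add: f_def xy m_assoc)
    also have "\<dots> = t [^] (nat e + nat e') \<otimes> g [^] (nat a + nat a')"
      unfolding gta using g t by (simp add: m_assoc nat_pow_mult[symmetric])
    also have "\<dots> = t [^] nat ((e + e') mod 3) \<otimes> g [^] nat ((a + a') mod 3)"
      using pow_mod_3[OF t(1) nm[OF xy(3,4)]] pow_mod_3[OF g(1) nm[OF xy(5,6)]] by simp
    finally have "f x \<otimes> f y = f (x \<otimes>\<^bsub>integer_mod_group 3 \<times>\<times> integer_mod_group 3\<^esub> y)"
      unfolding mult by (simp add: f_def)
    then show "x \<otimes>\<^bsub>integer_mod_group 3 \<times>\<times> integer_mod_group 3\<^esub> y \<in> carrier (integer_mod_group 3 \<times>\<times> integer_mod_group 3) \<and>
        f (x \<otimes>\<^bsub>integer_mod_group 3 \<times>\<times> integer_mod_group 3\<^esub> y) = f x \<otimes> f y"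
      unfolding mult car by simp
  qed
qed


text \<open>The commutator \<open>c\<close> of \<open>g\<close> and \<open>t\<close> is a
  translation, and exponent 3 forces it to commute with \<open>g\<close>. Then \<open>g\<close>,
  \<open>t\<close> and \<open>c\<close> satisfy the Heisenberg relations and give 27 different
  products, the largest possible order.\<close>

lemma iso_heisenberg_case:
  assumes g: "g \<in> carrier G" "(\<alpha> i g)\<^sup>2 + \<alpha> i g + 1 = 0"
    and t: "t \<in> carrier G" "\<alpha> i t = 1" "g \<otimes> t \<noteq> t \<otimes> g"
  shows "G \<cong> Heis3"
proof -
  have g0: "\<alpha> i g \<noteq> 0" using g by auto
  define c c' where "c = g \<otimes> t \<otimes> inv g \<otimes> inv t" and "c' = g \<otimes> c \<otimes> inv g"
  have c: "c \<in> carrier G" "\<alpha> i c = 1" and c': "c' \<in> carrier G" "\<alpha> i c' = 1"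
    using g t g0 by (simp_all add: c_def c'_def alpha_mult alpha_inv)
  have gt: "g \<otimes> t = c \<otimes> t \<otimes> g" using g t by (simp add: c_def m_assoc)
  have gc': "g \<otimes> c = c' \<otimes> g" using g c by (simp add: c'_def m_assoc)
  have tc: "t \<otimes> c = c \<otimes> t" and tc': "t \<otimes> c' = c' \<otimes> t" and cc': "c \<otimes> c' = c' \<otimes> c"
    using ker_comm t c c' by blast+
  have cube: "x \<otimes> x \<otimes> x = \<one>" if "x \<in> carrier G" for x
    using pow_3_eq_one[OF that] that by (simp add: numeral_3_eq_3)
  have ggt: "g \<otimes> (c \<otimes> t \<otimes> g) = c' \<otimes> c \<otimes> t \<otimes> g \<otimes> g"
  proof -
    have "g \<otimes> (c \<otimes> t \<otimes> g) = (g \<otimes> c) \<otimes> t \<otimes> g" using g t c by (simp add: m_assoc)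
    also have "\<dots> = c' \<otimes> (g \<otimes> t) \<otimes> g" using g t c' by (simp add: gc' m_assoc)
    also have "\<dots> = c' \<otimes> c \<otimes> t \<otimes> g \<otimes> g" using g t c c' by (simp add: gt m_assoc)
    finally show ?thesis .
  qed
  \<comment> \<open>Expanding the cube of \<open>g \<otimes> t\<close> gives
    \<open>c \<otimes> c \<otimes> c' = \<one>\<close>, where \<open>c'\<close> is the conjugate of
    \<open>c\<close> by \<open>g\<close>. Comparison with the cube of \<open>c\<close> yields
    \<open>c' = c\<close>.\<close>
  have "\<one> = (g \<otimes> t) \<otimes> (g \<otimes> t) \<otimes> (g \<otimes> t)" using cube[of "g \<otimes> t"] g t by simp
  also have "\<dots> = (c \<otimes> t) \<otimes> (g \<otimes> (c \<otimes> t \<otimes> g)) \<otimes> (g \<otimes> t)"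
    unfolding gt using g t c by (simp add: m_assoc)
  also have "\<dots> = (c \<otimes> t) \<otimes> (c' \<otimes> c \<otimes> t) \<otimes> (g \<otimes> g \<otimes> g) \<otimes> t"
    unfolding ggt using g t c c' by (simp add: m_assoc)
  also have "\<dots> = (c \<otimes> c' \<otimes> c) \<otimes> (t \<otimes> t \<otimes> t)"
  proof -
    have "(c \<otimes> t) \<otimes> (c' \<otimes> c \<otimes> t) = c \<otimes> (t \<otimes> (c' \<otimes> c)) \<otimes> t" using t c c' by (simp add: m_assoc)
    also have "t \<otimes> (c' \<otimes> c) = (c' \<otimes> c) \<otimes> t"
      using ker_comm[of t "c' \<otimes> c" i] t c c' by (simp add: alpha_mult)
    finally show ?thesis using cube[OF g(1)] t c c' by (simp add: m_assoc)
  qed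
  also have "\<dots> = c \<otimes> c \<otimes> c'" using cube[OF t(1)] c c' by (simp add: m_assoc cc'[symmetric])
  finally have "c \<otimes> c \<otimes> c' = c \<otimes> c \<otimes> c" using cube[OF c(1)] by simp
  then have "c' = c" using c c' by (simp add: m_assoc)
  then have gc: "g \<otimes> c = c \<otimes> g" using gc' by simp
  have c1: "c \<noteq> \<one>" using gt t g by auto
  \<comment> \<open>The exponents (a, b, e) match the entries of \<open>heis_coords\<close>. Moving
    \<open>g [^] a\<close> to the right past \<open>t [^] e'\<close> releases
    \<open>c [^] (a * e')\<close>, which is the term a * e' in the corner entry of a matrix
    product.\<close>
  define f where "f = (\<lambda>(a::nat, b::nat, e::nat). t [^] e \<otimes> c [^] b \<otimes> g [^] a)"
  have tce: "t [^] e \<otimes> c [^] b = c [^] b \<otimes> t [^] e" for b e :: nat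
  proof -
    have "c \<otimes> t [^] e = t [^] e \<otimes> c" using group_commutes_pow[of t c e] tc t c by simp
    then show ?thesis using group_commutes_pow[of c "t [^] e" b] t c by simp
  qed
  have gcb: "g [^] a \<otimes> c [^] b = c [^] b \<otimes> g [^] a" for a b :: nat
  proof -
    have "g \<otimes> c [^] b = c [^] b \<otimes> g" using group_commutes_pow[of c g b] gc g c by simp
    then show ?thesis using group_commutes_pow[of g "c [^] b" a] g c by simp
  qed
  note comm = heisenberg_pow_commute[OF g(1) t(1) c(1) gt gc tc]
  have fc: "f x \<in> carrier G" for x using g t c by (simp add: f_def split: prod.split)
  have f_mult: "f (a, b, e) \<otimes> f (a', b', e') = f (a + a', b + b' + a * e', e + e')" for a b e a' b' e'
  proof -
    have "f (a, b, e) \<otimes> f (a', b', e') = t [^] e \<otimes> c [^] b \<otimes> (g [^] a \<otimes> t [^] e') \<otimes> c [^] b' \<otimes> g [^] a'"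
      using g t c by (simp add: f_def m_assoc)
    also have "\<dots> = t [^] e \<otimes> (c [^] b \<otimes> c [^] (a * e') \<otimes> t [^] e') \<otimes> (g [^] a \<otimes> c [^] b') \<otimes> g [^] a'"
      unfolding comm using g t c by (simp add: m_assoc)
    also have "c [^] b \<otimes> c [^] (a * e') \<otimes> t [^] e' = t [^] e' \<otimes> (c [^] b \<otimes> c [^] (a * e'))"
      using tce[of e' "b + a * e'"] c by (simp add: nat_pow_mult[symmetric])
    also have "t [^] e \<otimes> (t [^] e' \<otimes> (c [^] b \<otimes> c [^] (a * e'))) \<otimes> (g [^] a \<otimes> c [^] b') \<otimes> g [^] a'
        = (t [^] e \<otimes> t [^] e') \<otimes> (c [^] b \<otimes> c [^] (a * e') \<otimes> c [^] b') \<otimes> (g [^] a \<otimes> g [^] a')"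
      unfolding gcb using g t c by (simp add: m_assoc)
    also have "\<dots> = f (a + a', b + b' + a * e', e + e')"
      using g t c by (simp add: f_def nat_pow_mult ac_simps)
    finally show ?thesis .
  qed
  have f_mod: "f (a, b, e) = f (a', b', e')"
    if "a mod 3 = a' mod 3" "b mod 3 = b' mod 3" "e mod 3 = e' mod 3" for a b e a' b' e'
    using that pow_mod_3[OF g(1), of a a'] pow_mod_3[OF c(1), of b b'] pow_mod_3[OF t(1), of e e']
    by (simp add: f_def)
  let ?I = "{..<3::nat}"
  have inj: "inj_on f (?I \<times> ?I \<times> ?I)"
  proof (rule inj_onI)
    fix x y assume "x \<in> ?I \<times> ?I \<times> ?I" "y \<in> ?I \<times> ?I \<times> ?I" and eq: "f x = f y"
    then obtain a b e a' b' e' where xy: "x = (a, b, e)" "y = (a', b', e')"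
      and lt: "a < 3" "b < 3" "e < 3" "a' < 3" "b' < 3" "e' < 3" by auto
    have "\<alpha> i (f x) = \<alpha> i g ^ a" "\<alpha> i (f y) = \<alpha> i g ^ a'"
      using g t c by (simp_all add: f_def xy alpha_mult alpha_pow)
    then have a: "a = a'" using omega_pow_inj[OF g(2)] lt eq by simp
    then have tc_eq: "t [^] e \<otimes> c [^] b = t [^] e' \<otimes> c [^] b'"
      using eq g t c by (simp add: f_def xy)
    \<comment> \<open>Conjugation by \<open>g\<close> multiplies
      \<open>t [^] e \<otimes> c [^] b\<close> by \<open>c [^] e\<close>, so it reads off the
      exponent \<open>e\<close>, which cannot be seen by \<open>\<alpha> i\<close>.\<close>
    have conj: "g \<otimes> (t [^] e \<otimes> c [^] b) = c [^] e \<otimes> (t [^] e \<otimes> c [^] b) \<otimes> g" for e b :: nat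
    proof -
      have "g \<otimes> (t [^] e \<otimes> c [^] b) = (g \<otimes> t [^] e) \<otimes> c [^] b" using g t c by (simp add: m_assoc)
      also have "\<dots> = c [^] e \<otimes> t [^] e \<otimes> (g \<otimes> c [^] b)"
        using comm[of 1 e] g t c by (simp add: m_assoc)
      also have "\<dots> = c [^] e \<otimes> (t [^] e \<otimes> c [^] b) \<otimes> g"
        using gcb[of 1 b] g t c by (simp add: m_assoc)
      finally show ?thesis .
    qed
    have "c [^] e \<otimes> (t [^] e \<otimes> c [^] b) \<otimes> g = c [^] e' \<otimes> (t [^] e \<otimes> c [^] b) \<otimes> g"
      using conj[of e b] conj[of e' b'] tc_eq by simp
    then have "c [^] e = c [^] e'" using g t c by simp
    then have e: "e = e'" using pow_inj_3[OF c(1) c1] lt by blast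
    then have "c [^] b = c [^] b'" using tc_eq t c by simp
    then have "b = b'" using pow_inj_3[OF c(1) c1] lt by blast
    then show "x = y" using a e xy by simp
  qed
  \<comment> \<open>Exponent 3 makes the whole kernel 3-torsion, so it has at most 9 elements and
    the group at most 27.\<close>
  have kt: "{t \<in> carrier G. \<alpha> i t = 1 \<and> t [^] (3::nat) = \<one>} = ker i"
    using pow_3_eq_one by (auto simp: ker_def)
  have "card (carrier G) \<le> 27"
    using card_3_torsion[of i] unfolding kt by (simp add: card_carrier[of i])
  moreover have "card (f ` (?I \<times> ?I \<times> ?I)) = 27"
    using card_image[OF inj] by (simp add: card_cartesian_product)
  ultimately have im: "f ` (?I \<times> ?I \<times> ?I) = carrier G"
    using card_seteq[OF fin, of "f ` (?I \<times> ?I \<times> ?I)"] fc by auto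
  have bij: "bij_betw (f \<circ> heis_coords) (carrier Heis3) (carrier G)"
    using bij_betw_trans[OF bij_heis_coords, of f "carrier G"] inj im by (simp add: bij_betw_def)
  show ?thesis
  proof (rule isomI_bij_hom[OF bij], rule conjI)
    fix A B assume AB: "A \<in> carrier Heis3" "B \<in> carrier Heis3"
    show "A \<otimes>\<^bsub>Heis3\<^esub> B \<in> carrier Heis3" by (rule heis_mult_closed[OF AB])
    show "(f \<circ> heis_coords) (A \<otimes>\<^bsub>Heis3\<^esub> B) = (f \<circ> heis_coords) A \<otimes> (f \<circ> heis_coords) B"
      unfolding comp_def heis_coords_def f_mult heis_mult_entries[OF AB]
      by (rule f_mod[OF residue3_add residue3_add_mult residue3_add])
  qed
qed

theorem iso_elementary_or_heisenberg:
  "G \<cong> integer_mod_group 3 \<times>\<times> integer_mod_group 3 \<or> G \<cong> Heis3"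
proof -
  fix i :: 'n
  obtain g where g: "g \<in> carrier G" "(\<alpha> i g)\<^sup>2 + \<alpha> i g + 1 = 0" using ex_alpha_omega by blast
  show ?thesis
    using iso_abelian_case[OF g] iso_heisenberg_case[OF g] by (auto simp: ker_def)
qed

end

section \<open>Lattices\<close>

lemma lattice_basis:
  assumes "is_lattice L"
  obtains u v where "L = {of_int m * u + of_int n * v | m n. True}"
    and "\<forall>z. \<exists>x y. z = of_real x * u + of_real y * v"
    and "\<forall>x y. of_real x * u + of_real y * v = 0 \<longrightarrow> x = 0 \<and> y = 0"
proof -
  obtain u v where uv: "u \<noteq> v" "independent {u, v}"
    and L: "L = {of_int m * u + of_int n * v | m n. True}"
    using assms unfolding is_lattice_def by blast
  have "span {u, v} = UNIV"
    using card_ge_dim_independent[of "{u, v}" UNIV] uv by (auto simp: card_insert_if)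
  then have 1: "\<exists>x y. z = of_real x * u + of_real y * v" for z
  proof -
    have "z \<in> span {u, v}" using \<open>span {u, v} = UNIV\<close> by simp
    then obtain x where "z - x *\<^sub>R u \<in> span {v}" by (auto simp: span_insert)
    then obtain y where "z - x *\<^sub>R u = y *\<^sub>R v" by (auto simp: span_singleton)
    then have "z = of_real x * u + of_real y * v" by (simp add: scaleR_conv_of_real algebra_simps)
    then show ?thesis by blast
  qed
  have 2: "x = 0 \<and> y = 0" if "of_real x * u + of_real y * v = 0" for x y
  proof -
    have "(\<Sum>w\<in>{u, v}. (if w = u then x else y) *\<^sub>R w) = 0"
      using that uv(1) by (simp add: scaleR_conv_of_real)
    then have "\<forall>w\<in>{u, v}. (if w = u then x else y) = 0"
      using uv(2)[unfolded independent_explicit, THEN conjunct2, THEN spec,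
          of "\<lambda>w. if w = u then x else y"] by blast
    then show ?thesis using uv(1) by auto
  qed
  show thesis using that[of u v] L 1 2 by blast
qed

text \<open>Subtracting the integer parts of the two real coordinates moves a point into the
  fundamental parallelogram. This is the compactness of the torus, used to bound periodic
  functions.\<close>

lemma lattice_translate_bounded:
  assumes "is_lattice L"
  shows "\<exists>C. \<forall>z. \<exists>l\<in>L. norm (z - l) \<le> C"
proof -
  obtain u v where L: "L = {of_int m * u + of_int n * v | m n. True}"
    and sp: "\<forall>z. \<exists>x y. z = of_real x * u + of_real y * v"
    and indep: "\<forall>x y. of_real x * u + of_real y * v = 0 \<longrightarrow> x = 0 \<and> y = 0"
    by (rule lattice_basis[OF assms])
  have "\<exists>l\<in>L. norm (z - l) \<le> norm u + norm v" for z
  proof -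
    obtain x y where z: "z = of_real x * u + of_real y * v" using sp by blast
    let ?l = "of_int \<lfloor>x\<rfloor> * u + of_int \<lfloor>y\<rfloor> * v"
    have "z - ?l = of_real (frac x) * u + of_real (frac y) * v"
      by (simp add: z frac_def algebra_simps)
    moreover have "norm \<dots> \<le> frac x * norm u + frac y * norm v"
      using norm_triangle_ineq[of "of_real (frac x) * u" "of_real (frac y) * v"]
      by (simp add: norm_mult abs_of_nonneg[OF frac_ge_0])
    moreover have "frac x * norm u \<le> 1 * norm u" "frac y * norm v \<le> 1 * norm v"
      using frac_lt_1[of x] frac_lt_1[of y] by (intro mult_right_mono; simp)+
    ultimately have "norm (z - ?l) \<le> norm u + norm v" by simp
    moreover have "?l \<in> L" unfolding L by blast
    ultimately show ?thesis by blast
  qed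
  then show ?thesis by blast
qed

lemma lattice_nonzero: "is_lattice L \<Longrightarrow> \<exists>l\<in>L. l \<noteq> 0"
proof -
  assume L: "is_lattice L"
  obtain C where C: "\<And>z. \<exists>l\<in>L. norm (z - l) \<le> C"
    using lattice_translate_bounded[OF L] by blast
  show ?thesis
  proof (rule ccontr)
    assume "\<not> ?thesis"
    then have "norm z \<le> C" for z :: complex using C[of z] by auto
    from this[of "of_real (\<bar>C\<bar> + 1)"] show False by simp
  qed
qed

text \<open>If \<open>a\<close> were nonzero, a suitable \<open>z\<close> would make
  \<open>a * z\<close> shorter than every nonzero lattice vector. Applied to the difference of two
  affine lifts, this determines the linear part, and the translation modulo the lattice.\<close>

lemma lattice_shift_eq:
  assumes "is_lattice L" "\<And>z. a * z + b \<in> L"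
  shows "a = 0" "b \<in> L"
proof -
  obtain e where e: "e > 0" "\<And>l. l \<in> L \<Longrightarrow> norm l < e \<Longrightarrow> l = 0"
    using lattice_discrete[OF assms(1)] by blast
  show b: "b \<in> L" using assms(2)[of 0] by simp
  show "a = 0"
  proof (rule ccontr)
    assume a: "a \<noteq> 0"
    have "a * (of_real (e/2) / a) + b - b \<in> L" using lattice_diff[OF assms(1,2) b] .
    then have "complex_of_real (e/2) \<in> L" using a by simp
    from e(2)[OF this] e(1) show False by simp
  qed
qed

lemma lattice_minimal_vector:
  assumes "is_lattice L"
  shows "\<exists>w\<in>L. w \<noteq> 0 \<and> (\<forall>l\<in>L. norm l < norm w \<longrightarrow> l = 0)"
proof -
  obtain e where e: "e > 0" "\<And>l. l \<in> L \<Longrightarrow> norm l < e \<Longrightarrow> l = 0"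
    using lattice_discrete[OF assms] by blast
  have "closed (L - {0})"
  proof (rule discrete_imp_closed[OF e(1)], intro ballI impI)
    fix x y assume "x \<in> L - {0}" "y \<in> L - {0}" "dist y x < e"
    then have "y - x = 0" using e(2)[of "y - x"] lattice_diff[OF assms] by (simp add: dist_norm)
    then show "y = x" by simp
  qed
  moreover have "L - {0} \<noteq> {}" using lattice_nonzero[OF assms] by blast
  ultimately obtain w where "w \<in> L - {0}" "\<And>y. y \<in> L - {0} \<Longrightarrow> dist 0 w \<le> dist 0 y"
    using distance_attains_inf[of "L - {0}" 0] by metis
  then show ?thesis by fastforce
qed

lemma lattice_of_int_mult:
  assumes "is_lattice L" "l \<in> L"
  shows "of_int m * l \<in> L"
proof -
  have "of_nat n * l \<in> L" for n
    by (induction n) (use assms lattice_zero lattice_add in \<open>auto simp: algebra_simps\<close>)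
  then show ?thesis
    using lattice_uminus[OF assms(1)] by (cases m rule: int_cases2) auto
qed

text \<open>This is the crystallographic restriction: multiplication by \<open>a\<close> has an
  integer matrix in a lattice basis, so \<open>a\<close> is a root of a monic integer quadratic. For
  nonreal \<open>a\<close> on the unit circle the trace is 2 Re a, an integer strictly between -2
  and 2.\<close>

lemma root_of_unity_lattice:
  assumes L: "is_lattice L" and a: "\<And>l. l \<in> L \<Longrightarrow> a * l \<in> L" and N: "a ^ N = 1" "N > 0"
  shows "a = 1 \<or> a = -1 \<or> a\<^sup>2 = -1 \<or> a\<^sup>2 + a + 1 = 0 \<or> a\<^sup>2 - a + 1 = 0"
proof -
  have n1: "norm a = 1"
  proof -
    have "norm a ^ N = 1" using N(1) norm_power[of a N] by simp
    then show ?thesis using power_eq_1_iff[of "norm a" N] N(2) by simp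
  qed
  obtain u v where Lu: "L = {of_int m * u + of_int n * v | m n. True}"
    and sp: "\<forall>z. \<exists>x y. z = of_real x * u + of_real y * v"
    and indep: "\<forall>x y. of_real x * u + of_real y * v = 0 \<longrightarrow> x = 0 \<and> y = 0"
    by (rule lattice_basis[OF L])
  have uv: "u \<noteq> 0" "v \<noteq> 0" using indep[rule_format, of 1 0] indep[rule_format, of 0 1] by auto
  have "u \<in> L" unfolding Lu by (rule CollectI, rule exI[of _ 1], rule exI[of _ 0]) simp
  moreover have "v \<in> L" unfolding Lu by (rule CollectI, rule exI[of _ 0], rule exI[of _ 1]) simp
  ultimately have "a * u \<in> L" "a * v \<in> L" using a by blast+
  then obtain m n m' n' :: int where au: "a * u = of_int m * u + of_int n * v"
    and av: "a * v = of_int m' * u + of_int n' * v" unfolding Lu by blast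
  have 1: "(a - of_int m) * u = of_int n * v" "(a - of_int n') * v = of_int m' * u"
    using au av by (simp_all add: algebra_simps)
  \<comment> \<open>Multiplying the two rows of the eigenvalue equation and cancelling
    \<open>u * v\<close> gives the characteristic polynomial of the matrix.\<close>
  have "((a - of_int m) * u) * ((a - of_int n') * v) = (of_int n * v) * (of_int m' * u)"
    unfolding 1 ..
  then have "((a - of_int m) * (a - of_int n') - of_int (n * m')) * (u * v) = 0"
    by (simp add: algebra_simps)
  then have "(a - of_int m) * (a - of_int n') - of_int (n * m') = 0" using uv by simp
  then have "a\<^sup>2 - of_int (m + n') * a + of_int (m * n' - n * m') = 0"
    by (simp add: algebra_simps power2_eq_square)
  then obtain T D :: int where TD: "a\<^sup>2 - of_int T * a + of_int D = 0" by blast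
  define x y where "x = Re a" and "y = Im a"
  have xy: "x\<^sup>2 + y\<^sup>2 = 1" using n1 by (simp add: x_def y_def cmod_def)
  have im: "2 * x * y - T * y = 0"
    using arg_cong[OF TD, of Im] by (simp add: x_def y_def power2_eq_square algebra_simps)
  show ?thesis
  proof (cases "y = 0")
    case True
    then have "x = 1 \<or> x = -1" using xy by (simp add: power2_eq_1_iff)
    then show ?thesis using True by (auto simp: x_def y_def complex_eq_iff)
  next
    case False
    then have T: "of_int T = 2 * x" using im by (simp add: algebra_simps)
    have "x\<^sup>2 < 1" using xy False by (smt (verit) zero_less_power2)
    then have "\<bar>x\<bar> < 1" by (simp add: abs_square_less_1)
    then have "\<bar>T\<bar> < 2" using T by linarith
    then have "T = 0 \<or> T = 1 \<or> T = -1" by linarith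
    then have x: "x = 0 \<or> x = 1/2 \<or> x = -1/2" using T by auto
    \<comment> \<open>The conjugate of \<open>a\<close> is its inverse, so the quadratic with roots
      \<open>a\<close> and its conjugate has constant term 1. This replaces the unknown determinant
      \<open>D\<close>.\<close>
    have "a\<^sup>2 - 2 * of_real x * a + 1 = 0"
    proof (rule complex_eqI)
      have "y * y = 1 - x * x" using xy by (simp add: power2_eq_square)
      then show "Re (a\<^sup>2 - 2 * of_real x * a + 1) = Re 0"
        by (simp add: x_def y_def power2_eq_square)
      show "Im (a\<^sup>2 - 2 * of_real x * a + 1) = Im 0"
        by (simp add: x_def y_def power2_eq_square)
    qed
    note q = this
    from x show ?thesis
    proof (elim disjE)
      assume "x = 0" then show ?thesis using q by (simp add: eq_neg_iff_add_eq_0)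
    next
      assume h: "x = 1/2" show ?thesis using q[unfolded h] by simp
    next
      assume h: "x = -1/2" show ?thesis using q[unfolded h] by simp
    qed
  qed
qed

text \<open>Rounding both coordinates with respect to 1 and \<omega> leaves p + q \<omega> with |p|
  and |q| at most 1/2. Its squared norm p^2 - p q + q^2 is at most 3/4.\<close>

lemma eisenstein_approx:
  assumes "\<omega>\<^sup>2 + \<omega> + 1 = (0::complex)"
  shows "\<exists>m n. norm (z - (of_int m + of_int n * \<omega>)) < 1"
proof -
  define x y where "x = Re \<omega>" and "y = Im \<omega>"
  have im: "y * (2 * x + 1) = 0" and re: "x\<^sup>2 - y\<^sup>2 + x + 1 = 0"
    using arg_cong[OF assms, of Im] arg_cong[OF assms, of Re]
    by (simp_all add: x_def y_def power2_eq_square algebra_simps)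
  have "x\<^sup>2 + x + 1 > 0"
  proof -
    have "x\<^sup>2 + x + 1 = (x + 1/2)\<^sup>2 + 3/4" by (simp add: power2_eq_square field_simps)
    then show ?thesis using zero_le_power2[of "x + 1/2"] by linarith
  qed
  then have y0: "y \<noteq> 0" using re by auto
  then have x: "x = -1/2" using im by simp
  then have y: "y\<^sup>2 = 3/4" using re by (simp add: power2_eq_square)
  \<comment> \<open>These solve z = r + s \<omega>; the summand s / 2 compensates the real part -1/2
    of \<omega>.\<close>
  define s where "s = Im z / y"
  define r where "r = Re z + s / 2"
  have z: "z = of_real r + of_real s * \<omega>"
    using y0 x by (simp add: complex_eq_iff r_def s_def x_def[symmetric] y_def[symmetric])
  let ?m = "round r" and ?n = "round s"
  define p q where "p = r - ?m" and "q = s - ?n"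
  have pq: "\<bar>p\<bar> \<le> 1/2" "\<bar>q\<bar> \<le> 1/2"
    using of_int_round_abs_le[of r] of_int_round_abs_le[of s] by (simp_all add: p_def q_def abs_minus_commute)
  have "z - (of_int ?m + of_int ?n * \<omega>) = of_real p + of_real q * \<omega>"
    by (simp add: z p_def q_def algebra_simps)
  moreover have "(norm (of_real p + of_real q * \<omega>))\<^sup>2 = (p - q/2)\<^sup>2 + (q * y)\<^sup>2"
    using x by (simp add: cmod_power2 x_def[symmetric] y_def[symmetric])
  moreover have "\<dots> = p\<^sup>2 - p * q + q\<^sup>2"
    unfolding power_mult_distrib y by (simp add: power2_eq_square field_simps)
  moreover have "p\<^sup>2 \<le> 1/4" "q\<^sup>2 \<le> 1/4" "\<bar>p * q\<bar> \<le> 1/4"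
    using abs_le_square_iff[of p "1/2"] abs_le_square_iff[of q "1/2"] pq
      mult_mono[OF pq] by (auto simp: power2_eq_square abs_mult)
  ultimately have "(norm (z - (of_int ?m + of_int ?n * \<omega>)))\<^sup>2 < 1\<^sup>2" by simp
  then have "norm (z - (of_int ?m + of_int ?n * \<omega>)) < 1"
    by (rule power_less_imp_less_base) simp
  then show ?thesis by blast
qed

text \<open>A shortest lattice vector generates: the lattice is a module over the Euclidean ring
  generated by \<open>\<omega>\<close>.\<close>

lemma lattice_eisenstein:
  assumes L: "is_lattice L" and w: "\<omega>\<^sup>2 + \<omega> + 1 = 0" and cl: "\<And>l. l \<in> L \<Longrightarrow> \<omega> * l \<in> L"
  obtains w where "w \<noteq> 0" "L = {(of_int m + of_int n * \<omega>) * w | m n. True}"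
proof -
  obtain v where v: "v \<in> L" "v \<noteq> 0" "\<And>l. l \<in> L \<Longrightarrow> norm l < norm v \<Longrightarrow> l = 0"
    using lattice_minimal_vector[OF L] by blast
  have mem: "(of_int m + of_int n * \<omega>) * v \<in> L" for m n
    using lattice_add[OF L lattice_of_int_mult[OF L v(1), of m] lattice_of_int_mult[OF L cl[OF v(1)], of n]]
    by (simp add: algebra_simps)
  have "\<exists>m n. l = (of_int m + of_int n * \<omega>) * v" if l: "l \<in> L" for l
  proof -
    obtain m n where mn: "norm (l / v - (of_int m + of_int n * \<omega>)) < 1"
      using eisenstein_approx[OF w] by blast
    let ?q = "of_int m + of_int n * \<omega>"
    have "l - ?q * v = (l / v - ?q) * v" using v by (simp add: field_simps)
    then have "norm (l - ?q * v) < norm v" using mn v(2) by (simp add: norm_mult)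
    then have "l - ?q * v = 0" using v(3) lattice_diff[OF L l mem] by blast
    then show ?thesis by auto
  qed
  then have "L = {(of_int m + of_int n * \<omega>) * v | m n. True}" using mem by blast
  then show thesis using that v(2) by blast
qed

text \<open>\<open>S\<close> stands for a set of translations with vectors \<open>f x\<close>, which
  \<open>inj\<close> makes distinct modulo \<open>L\<close>. The integer coordinates of
  \<open>3 * f x\<close>, taken modulo 3, then distinguish them.\<close>

lemma card_torsion_le_9:
  assumes L: "is_lattice L"
    and tor: "\<And>x. x \<in> S \<Longrightarrow> 3 * f x \<in> L"
    and inj: "\<And>x y. x \<in> S \<Longrightarrow> y \<in> S \<Longrightarrow> f x - f y \<in> L \<Longrightarrow> x = y"
  shows "card S \<le> 9"
proof -
  obtain u v where Lu: "L = {of_int m * u + of_int n * v | m n. True}"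
    and sp: "\<forall>z. \<exists>x y. z = of_real x * u + of_real y * v"
    and indep: "\<forall>x y. of_real x * u + of_real y * v = 0 \<longrightarrow> x = 0 \<and> y = 0"
    by (rule lattice_basis[OF L])
  have "\<exists>m n. 3 * f x = of_int m * u + of_int n * v" if "x \<in> S" for x
    using tor[OF that] unfolding Lu by blast
  then obtain m n where mn: "\<And>x. x \<in> S \<Longrightarrow> 3 * f x = of_int (m x) * u + of_int (n x) * v"
    by metis
  let ?h = "\<lambda>x. (m x mod 3, n x mod 3)"
  have "inj_on ?h S"
  proof (rule inj_onI)
    fix x y assume xy: "x \<in> S" "y \<in> S" "?h x = ?h y"
    then have "3 dvd m x - m y" "3 dvd n x - n y" by (simp_all add: mod_eq_dvd_iff)
    then obtain k l where kl: "m x - m y = 3 * k" "n x - n y = 3 * l"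
      by (elim dvdE)
    have "3 * (f x - f y) = of_int (m x - m y) * u + of_int (n x - n y) * v"
      using mn[OF xy(1)] mn[OF xy(2)] by (simp add: algebra_simps)
    also have "\<dots> = 3 * (of_int k * u + of_int l * v)" unfolding kl by (simp add: algebra_simps)
    finally have "f x - f y = of_int k * u + of_int l * v" by (simp only: mult_cancel_left) simp
    then show "x = y" using inj[OF xy(1,2)] unfolding Lu by blast
  qed
  moreover have "?h ` S \<subseteq> {0..<3} \<times> {0..<3}" by auto
  ultimately have "card S \<le> card ({0..<3::int} \<times> {0..<3::int})"
    by (intro card_inj_on_le) auto
  then show ?thesis by (simp add: card_cartesian_product)
qed

text \<open>Multiplication by \<omega> - 1 embeds the vectors modulo \<open>L\<close> into the
  quotient of \<open>L\<close> by (\<omega> - 1) L, which has order 3, the norm of \<omega> - 1.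
  Since \<omega> is 1 in this quotient, the class of m + n \<omega> is m + n modulo 3.\<close>

lemma card_fixed_le_3:
  assumes L: "is_lattice L" and w: "\<omega>\<^sup>2 + \<omega> + 1 = 0" and cl: "\<And>l. l \<in> L \<Longrightarrow> \<omega> * l \<in> L"
    and fixed: "\<And>x. x \<in> S \<Longrightarrow> (\<omega> - 1) * f x \<in> L"
    and inj: "\<And>x y. x \<in> S \<Longrightarrow> y \<in> S \<Longrightarrow> f x - f y \<in> L \<Longrightarrow> x = y"
  shows "card S \<le> 3"
proof -
  obtain v where "v \<noteq> 0" and Lv: "L = {(of_int m + of_int n * \<omega>) * v | m n. True}"
    by (rule lattice_eisenstein[OF L w cl])
  have w1: "\<omega> - 1 \<noteq> 0" using w by auto
  have "\<exists>m n. (\<omega> - 1) * f x = (of_int m + of_int n * \<omega>) * v" if "x \<in> S" for x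
    using fixed[OF that] unfolding Lv by blast
  then obtain m n where mn: "\<And>x. x \<in> S \<Longrightarrow> (\<omega> - 1) * f x = (of_int (m x) + of_int (n x) * \<omega>) * v"
    by metis
  let ?h = "\<lambda>x. (m x + n x) mod 3"
  have "inj_on ?h S"
  proof (rule inj_onI)
    fix x y assume xy: "x \<in> S" "y \<in> S" "?h x = ?h y"
    then have "3 dvd (m x + n x) - (m y + n y)" by (simp add: mod_eq_dvd_iff)
    then obtain k where k: "(m x + n x) - (m y + n y) = 3 * k" by (elim dvdE)
    define d where "d = n x - n y"
    have m: "m x - m y = 3 * k - d" using k by (simp add: d_def)
    \<comment> \<open>The prime 3 ramifies. As \<omega> - 1 divides 3, it divides both terms of 3 k
      + (\<omega> - 1) d below.\<close>
    have three: "3 = (\<omega> - 1) * (- \<omega> - 2)" using w by (simp add: algebra_simps power2_eq_square add_eq_0_iff2)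
    have "(\<omega> - 1) * (f x - f y) = (of_int (m x - m y) + of_int (n x - n y) * \<omega>) * v"
      using mn[OF xy(1)] mn[OF xy(2)] by (simp add: algebra_simps)
    also have "\<dots> = (3 * of_int k + (\<omega> - 1) * of_int d) * v"
      unfolding m d_def[symmetric] by (simp add: algebra_simps)
    also have "\<dots> = (\<omega> - 1) * ((of_int (d - 2 * k) + of_int (- k) * \<omega>) * v)"
      unfolding three by (simp add: algebra_simps)
    finally have "f x - f y = (of_int (d - 2 * k) + of_int (- k) * \<omega>) * v" using w1 by simp
    then show "x = y" using inj[OF xy(1,2)] unfolding Lv by blast
  qed
  moreover have "?h ` S \<subseteq> {0..<3}" by auto
  ultimately have "card S \<le> card {0..<3::int}" by (intro card_inj_on_le) auto
  then show ?thesis by simp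
qed

text \<open>By periodicity all values are attained on one compact disc, so Liouville's theorem
  applies.\<close>

lemma periodic_holomorphic_constant:
  assumes L: "is_lattice L" and f: "f holomorphic_on UNIV"
    and per: "\<And>z l. l \<in> L \<Longrightarrow> f (z + l) = f z"
  obtains c where "\<And>z. f z = c"
proof -
  obtain C where C: "\<And>z. \<exists>l\<in>L. norm (z - l) \<le> C" using lattice_translate_bounded[OF L] by blast
  have "f z \<in> f ` cball 0 C" for z
  proof -
    obtain l where "l \<in> L" "norm (z - l) \<le> C" using C by blast
    moreover have "f z = f (z - l)" using per[OF \<open>l \<in> L\<close>, of "z - l"] by simp
    ultimately show ?thesis by simp
  qed
  moreover have "compact (f ` cball 0 C)"
    using f by (intro compact_continuous_image holomorphic_on_imp_continuous_on)
      (auto intro: holomorphic_on_subset)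
  ultimately have "bounded (range f)"
    by (meson bounded_subset compact_imp_bounded image_subsetI)
  then have "f constant_on UNIV" by (rule Liouville_theorem[OF f])
  then obtain c where "\<forall>z. f z = c" unfolding constant_on_def by auto
  then show thesis using that by blast
qed

text \<open>The class of the differential form \<open>d cnj z\<close> is nonzero: \<open>cnj\<close> is not the period
  homomorphism of a holomorphic function.\<close>

lemma no_holomorphic_cnj_periods:
  assumes L: "is_lattice L" and H: "H holomorphic_on UNIV"
    and per: "\<And>z l. l \<in> L \<Longrightarrow> H (z + l) = H z + cnj l"
  shows False
proof -
  have H': "(H has_field_derivative deriv H z) (at z)" for z
    by (rule holomorphic_derivI[OF H]) auto
  \<comment> \<open>The period cnj l is a constant, so it disappears from the derivative, which is
    thus periodic and constant. Hence \<open>H\<close> is affine with some slope \<beta>, and its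
    periods satisfy cnj l = \<beta> l.\<close>
  have "deriv H (z + l) = deriv H z" if "l \<in> L" for z l
  proof -
    have "((\<lambda>z. H (z + l)) has_field_derivative deriv H (z + l)) (at z)"
      using H'[of "z + l"] by (simp add: DERIV_shift)
    moreover have "((\<lambda>z. H z + cnj l) has_field_derivative deriv H z) (at z)"
      by (rule derivative_eq_intros H' refl | simp)+
    ultimately show ?thesis unfolding per[OF that] by (rule DERIV_unique)
  qed
  then obtain \<beta> where \<beta>: "\<And>z. deriv H z = \<beta>"
    using periodic_holomorphic_constant[OF L holomorphic_deriv[OF H open_UNIV]] by metis
  have "((\<lambda>z. H z - \<beta> * z) has_field_derivative 0) (at z)" for z
    by (rule derivative_eq_intros H' refl | simp add: \<beta>)+
  then obtain \<alpha> where "\<And>z. H z - \<beta> * z = \<alpha>"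
    using has_field_derivative_zero_constant[of UNIV "\<lambda>z. H z - \<beta> * z"] by auto
  then have Hz: "H z = \<alpha> + \<beta> * z" for z by (metis add.commute diff_add_cancel)
  have \<beta>l: "cnj l = \<beta> * l" if "l \<in> L" for l
    using per[OF that, of 0] by (simp add: Hz)
  obtain u v where Lu: "L = {of_int m * u + of_int n * v | m n. True}"
    and sp: "\<forall>z. \<exists>x y. z = of_real x * u + of_real y * v"
    and indep: "\<forall>x y. of_real x * u + of_real y * v = 0 \<longrightarrow> x = 0 \<and> y = 0"
    by (rule lattice_basis[OF L])
  have "u \<in> L" unfolding Lu by (rule CollectI, rule exI[of _ 1], rule exI[of _ 0]) simp
  moreover have "v \<in> L" unfolding Lu by (rule CollectI, rule exI[of _ 0], rule exI[of _ 1]) simp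
  \<comment> \<open>Eliminating \<beta> from the equations for \<open>u\<close> and \<open>v\<close>
    makes \<open>cnj u * v\<close> real, so the two basis vectors would be dependent over the
    reals.\<close>
  ultimately have uv: "cnj u * v = cnj v * u" using \<beta>l by simp
  then have "cnj (cnj u * v) = cnj u * v" by (simp add: mult.commute)
  then obtain r where r: "cnj u * v = of_real r" by (metis Reals_cnj_iff Reals_cases)
  have "of_real ((norm u)\<^sup>2) * v = u * (cnj u * v)"
    by (simp only: complex_norm_square mult.assoc)
  then have "of_real (- r) * u + of_real ((norm u)\<^sup>2) * v = 0" unfolding r by (simp add: mult.commute)
  then have "u = 0" using indep by fastforce
  then show False using indep[rule_format, of 1 0] by simp
qed

section \<open>Quotients of vector spaces by discrete groups\<close>

definition complex_linear :: "('v::complex_euclidean \<Rightarrow> 'w::complex_euclidean) \<Rightarrow> bool" where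
  "complex_linear A \<longleftrightarrow> bounded_linear A \<and> (\<forall>c v. A (scaleC c v) = scaleC c (A v))"

lemma complex_linear_id: "complex_linear (\<lambda>v. v)"
  by (simp add: complex_linear_def)

lemma holo_on_transform:
  assumes "open S" "holo_on f S" "\<And>z. z \<in> S \<Longrightarrow> f z = g z"
  shows "holo_on g S"
  unfolding holo_on_def
proof
  fix x assume x: "x \<in> S"
  then obtain D where D: "(f has_derivative D) (at x)" "\<forall>c v. D (scaleC c v) = scaleC c (D v)"
    using assms(2) unfolding holo_on_def by blast
  have "(g has_derivative D) (at x)"
    using has_derivative_transform_within_open[OF D(1) assms(1) x] assms(3) by blast
  then show "\<exists>D. (g has_derivative D) (at x) \<and> (\<forall>c v. D (scaleC c v) = scaleC c (D v))"
    using D(2) by blast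
qed

lemma holo_on_subset: "holo_on f S \<Longrightarrow> T \<subseteq> S \<Longrightarrow> holo_on f T"
  unfolding holo_on_def by blast

lemma holo_on_locally:
  assumes "\<And>x. x \<in> S \<Longrightarrow> \<exists>N. x \<in> N \<and> holo_on f N"
  shows "holo_on f S"
  unfolding holo_on_def
proof
  fix x assume "x \<in> S"
  then obtain N where "x \<in> N" "holo_on f N" using assms by blast
  then show "\<exists>D. (f has_derivative D) (at x) \<and> (\<forall>c v. D (scaleC c v) = scaleC c (D v))"
    by (simp add: holo_on_def)
qed

lemma holo_on_compose:
  assumes "holo_on f S" "holo_on g T" "f ` S \<subseteq> T"
  shows "holo_on (\<lambda>z. g (f z)) S"
  unfolding holo_on_def
proof
  fix x assume x: "x \<in> S"
  obtain D where D: "(f has_derivative D) (at x)" "\<forall>c v. D (scaleC c v) = scaleC c (D v)"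
    using assms(1) x unfolding holo_on_def by blast
  obtain D' where D': "(g has_derivative D') (at (f x))" "\<forall>c v. D' (scaleC c v) = scaleC c (D' v)"
    using assms x unfolding holo_on_def by blast
  have "((\<lambda>z. g (f z)) has_derivative (\<lambda>v. D' (D v))) (at x)"
    by (rule has_derivative_compose[OF D(1) D'(1)])
  then show "\<exists>D. ((\<lambda>z. g (f z)) has_derivative D) (at x) \<and> (\<forall>c v. D (scaleC c v) = scaleC c (D v))"
    using D(2) D'(2) by (intro exI[of _ "\<lambda>v. D' (D v)"]) simp
qed

lemma holo_on_affine:
  assumes "complex_linear A"
  shows "holo_on (\<lambda>z. A z + b) S"
  unfolding holo_on_def
proof
  fix x
  have "(A has_derivative A) (at x)"
    using assms by (simp add: complex_linear_def bounded_linear_imp_has_derivative)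
  then have "((\<lambda>z. A z + b) has_derivative A) (at x)" by (rule has_derivative_add_const)
  then show "\<exists>D. ((\<lambda>z. A z + b) has_derivative D) (at x) \<and> (\<forall>c v. D (scaleC c v) = scaleC c (D v))"
    using assms by (auto simp: complex_linear_def)
qed

lemma scaleC_minus_right: "scaleC c (- x) = - scaleC c (x :: 'v::complex_euclidean)"
proof -
  have "scaleC c 0 = (0::'v)" using scaleC_add_right[of c "0::'v" 0] by simp
  then have "scaleC c (- x) + scaleC c x = 0" by (simp add: scaleC_add_right[symmetric])
  then show ?thesis by (simp add: eq_neg_iff_add_eq_0)
qed

lemma scaleC_zero_right: "scaleC c (0 :: 'v::complex_euclidean) = 0"
  using scaleC_add_right[of c "0::'v" 0] by simp

lemma holo_on_add:
  assumes "holo_on f S" "holo_on g S"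
  shows "holo_on (\<lambda>z. f z + g z) S"
  unfolding holo_on_def
proof
  fix x assume x: "x \<in> S"
  obtain D D' where "(f has_derivative D) (at x)" "\<forall>c v. D (scaleC c v) = scaleC c (D v)"
    "(g has_derivative D') (at x)" "\<forall>c v. D' (scaleC c v) = scaleC c (D' v)"
    using assms x unfolding holo_on_def by metis
  then show "\<exists>D. ((\<lambda>z. f z + g z) has_derivative D) (at x) \<and> (\<forall>c v. D (scaleC c v) = scaleC c (D v))"
    by (intro exI[of _ "\<lambda>v. D v + D' v"]) (auto intro: has_derivative_add simp: scaleC_add_right)
qed

lemma holo_on_uminus: "holo_on f S \<Longrightarrow> holo_on (\<lambda>z. - f z) S"
  unfolding holo_on_def
proof
  fix x assume a: "\<forall>x\<in>S. \<exists>D. (f has_derivative D) (at x) \<and> (\<forall>c v. D (scaleC c v) = scaleC c (D v))" "x \<in> S"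
  then obtain D where "(f has_derivative D) (at x)" "\<forall>c v. D (scaleC c v) = scaleC c (D v)" by blast
  then show "\<exists>D. ((\<lambda>z. - f z) has_derivative D) (at x) \<and> (\<forall>c v. D (scaleC c v) = scaleC c (D v))"
    by (intro exI[of _ "\<lambda>v. - D v"]) (auto intro: has_derivative_minus simp: scaleC_minus_right)
qed

lemma holo_on_const: "holo_on (\<lambda>z. b) S"
  unfolding holo_on_def by (auto intro!: exI[of _ "\<lambda>v. 0"] simp: scaleC_zero_right)

text \<open>Tori and products of tori are quotients \<open>P\<close> of a vector space by a discrete group \<open>K\<close> whose
  charts are local sections of \<open>P\<close>. Hence all transition maps are locally translations, and vector
  fields can be treated as functions.\<close>

locale flat_manifold =
  fixes M :: "('a, 'v::complex_euclidean) cmfd" and P :: "'v \<Rightarrow> 'a" and K :: "'v set"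
  assumes points_eq: "points M = range P"
    and P_eq_iff: "\<And>z w. P z = P w \<longleftrightarrow> z - w \<in> K"
    and open_iff: "\<And>W. openin (mtop M) W \<longleftrightarrow> W \<subseteq> range P \<and> open (P -` W)"
    and chart_openin: "\<And>U \<phi>. (U, \<phi>) \<in> charts M \<Longrightarrow> openin (mtop M) U"
    and chart_image_open: "\<And>U \<phi>. (U, \<phi>) \<in> charts M \<Longrightarrow> open (\<phi> ` U)"
    and chart_section: "\<And>U \<phi> x. (U, \<phi>) \<in> charts M \<Longrightarrow> x \<in> U \<Longrightarrow> P (\<phi> x) = x"
    and chart_exists: "\<And>x. x \<in> range P \<Longrightarrow> \<exists>\<kappa>\<in>charts M. x \<in> fst \<kappa>"
begin

lemma P_in_points [simp]: "P z \<in> points M"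
  by (simp add: points_eq)

lemma P_add: "k \<in> K \<Longrightarrow> P (z + k) = P z"
  by (simp add: P_eq_iff)

lemma chart_subset: "(U, \<phi>) \<in> charts M \<Longrightarrow> U \<subseteq> points M"
  using chart_openin openin_subset by blast

lemma chart_inj: "(U, \<phi>) \<in> charts M \<Longrightarrow> inj_on \<phi> U"
  by (rule inj_onI) (metis chart_section)

lemma chart_at_P:
  assumes "(U, \<phi>) \<in> charts M" "w \<in> \<phi> ` U"
  shows "P w \<in> U" "\<phi> (P w) = w" "inv_into U \<phi> w = P w"
proof -
  obtain y where y: "y \<in> U" "w = \<phi> y" using assms(2) by blast
  then show "P w \<in> U" "\<phi> (P w) = w" using chart_section[OF assms(1)] by auto
  show "inv_into U \<phi> w = P w" using y chart_section[OF assms(1)] chart_inj[OF assms(1)] by simp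
qed

lemma chart_image_Int:
  assumes "(U, \<phi>) \<in> charts M"
  shows "\<phi> ` (U \<inter> W) = \<phi> ` U \<inter> P -` W"
proof (intro equalityI subsetI)
  fix w assume "w \<in> \<phi> ` (U \<inter> W)"
  then show "w \<in> \<phi> ` U \<inter> P -` W" using chart_section[OF assms] by auto
next
  fix w assume w: "w \<in> \<phi> ` U \<inter> P -` W"
  then have "P w \<in> U \<inter> W" "w = \<phi> (P w)" using chart_at_P(1,2)[OF assms, of w] by auto
  then show "w \<in> \<phi> ` (U \<inter> W)" by blast
qed

lemma open_vimage_P: "openin (mtop M) W \<Longrightarrow> open (P -` W)"
  by (simp add: open_iff)

lemma ex_chart_at:
  assumes "x \<in> points M"
  obtains U \<phi> where "(U, \<phi>) \<in> charts M" "x \<in> U"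
proof -
  have "x \<in> range P" using assms points_eq by simp
  then obtain \<kappa> where "\<kappa> \<in> charts M" "x \<in> fst \<kappa>" using chart_exists by blast
  then show thesis using that[of "fst \<kappa>" "snd \<kappa>"] by simp
qed

lemma openin_image_P:
  assumes D: "open D"
  shows "openin (mtop M) (P ` D)"
proof -
  have "P -` P ` D = (\<Union>k\<in>K. (+) k ` D)"
  proof (intro equalityI subsetI)
    fix z assume "z \<in> P -` P ` D"
    then obtain w where "w \<in> D" "P z = P w" by auto
    then have "z - w \<in> K" "z = (z - w) + w" using P_eq_iff by auto
    then show "z \<in> (\<Union>k\<in>K. (+) k ` D)" using \<open>w \<in> D\<close> by blast
  next
    fix z assume "z \<in> (\<Union>k\<in>K. (+) k ` D)"
    then obtain k w where "k \<in> K" "w \<in> D" "z = k + w" by blast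
    then have "P z = P w" by (simp add: P_eq_iff)
    then show "z \<in> P -` P ` D" using \<open>w \<in> D\<close> by simp
  qed
  then show ?thesis unfolding open_iff using D by (auto intro!: open_UN open_translation)
qed

text \<open>A chart and the local inverse of \<open>P\<close> through \<open>z\<close> differ by an
  element \<open>k\<close> of the group, and the same \<open>k\<close> works nearby because the
  chart image is open. All chart computations are reduced to this.\<close>

lemma local_section_shift:
  assumes c: "(U, \<phi>) \<in> charts M" and z: "P z \<in> U"
  obtains N k where "open N" "z \<in> N" "k \<in> K" "\<And>w. w \<in> N \<Longrightarrow> P w \<in> U \<and> \<phi> (P w) = w + k \<and> w + k \<in> \<phi> ` U"
proof -
  define k where "k = \<phi> (P z) - z"
  have k: "k \<in> K" using chart_section[OF c z] P_eq_iff[of "\<phi> (P z)" z] by (simp add: k_def)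
  let ?N = "(\<lambda>w. w + k) -` (\<phi> ` U)"
  have "open ?N" by (intro open_vimage chart_image_open[OF c] continuous_intros)
  moreover have "z \<in> ?N" using z by (simp add: k_def)
  moreover have "P w \<in> U \<and> \<phi> (P w) = w + k \<and> w + k \<in> \<phi> ` U" if "w \<in> ?N" for w
    using chart_at_P(1,2)[OF c, of "w + k"] that P_add[OF k] by simp
  ultimately show thesis using that k by blast
qed

text \<open>Charts differ from local inverses of \<open>P\<close> by translations, which change an
  affine map in its constant term alone. Its derivative is therefore the linear part of the lift in
  every pair of charts.\<close>

lemma affine_map_in_charts:
  assumes N: "flat_manifold M' P' K'"
    and A: "complex_linear A" and f: "\<And>z. f (P z) = P' (A z + t)"
    and c: "(U, \<phi>) \<in> charts M" "x \<in> U" and d: "(V, \<psi>) \<in> charts M'" "f x \<in> V"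
  shows "(\<psi> \<circ> f \<circ> inv_into U \<phi> has_derivative A) (at (\<phi> x))"
proof -
  interpret N: flat_manifold M' P' K' by (rule N)
  have "P' (A (\<phi> x) + t) \<in> V" using f[of "\<phi> x"] chart_section[OF c] d by simp
  then obtain N k where N: "open N" "A (\<phi> x) + t \<in> N"
    and k: "\<And>w. w \<in> N \<Longrightarrow> P' w \<in> V \<and> \<psi> (P' w) = w + k \<and> w + k \<in> \<psi> ` V"
    using N.local_section_shift[OF d(1)] by metis
  have lin: "bounded_linear A" using A by (simp add: complex_linear_def)
  have cont: "continuous_on UNIV (\<lambda>z. A z + t)"
    by (intro continuous_intros linear_continuous_on lin)
  have o: "open (\<phi> ` U \<inter> (\<lambda>z. A z + t) -` N)"
    using N cont by (intro open_Int chart_image_open[OF c(1)] open_vimage) auto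
  have "((\<lambda>z. A z + t + k) has_derivative A) (at (\<phi> x))"
    by (intro has_derivative_add_const bounded_linear_imp_has_derivative lin)
  then show ?thesis
    by (rule has_derivative_transform_within_open[OF _ o])
      (use c N in \<open>auto simp: chart_at_P(3)[OF c(1)] f k chart_section[OF c(1)]\<close>)
qed

lemma transition_derivative:
  assumes "(U, \<phi>) \<in> charts M" "x \<in> U" "(V, \<psi>) \<in> charts M" "x \<in> V"
  shows "frechet_derivative (\<psi> \<circ> inv_into U \<phi>) (at (\<phi> x)) = (\<lambda>v. v)"
proof -
  have "(\<psi> \<circ> id \<circ> inv_into U \<phi> has_derivative (\<lambda>v. v)) (at (\<phi> x))"
    using affine_map_in_charts[where f = id and t = 0, OF flat_manifold_axioms complex_linear_id _ assms(1,2,3)] assms(4)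
    by simp
  then show ?thesis using frechet_derivative_at by fastforce
qed

section \<open>Vector fields as vector-valued functions\<close>

text \<open>All transition derivatives are the identity, so the coordinate vector of a field is the
  same in every chart. The choice of chart is written exactly as in \<open>vf_push\<close>, which
  lets that definition be expressed by \<open>fval\<close>.\<close>

definition fval :: "('a, 'v) vfield \<Rightarrow> 'a \<Rightarrow> 'v" where
  "fval v x = v (SOME \<kappa>. \<kappa> \<in> charts M \<and> x \<in> fst \<kappa>) x"

lemma some_chart:
  assumes "x \<in> points M"
  obtains U \<phi> where "(SOME \<kappa>. \<kappa> \<in> charts M \<and> x \<in> fst \<kappa>) = (U, \<phi>)" "(U, \<phi>) \<in> charts M" "x \<in> U"
proof -
  let ?\<kappa> = "SOME \<kappa>. \<kappa> \<in> charts M \<and> x \<in> fst \<kappa>"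
  have "?\<kappa> \<in> charts M \<and> x \<in> fst ?\<kappa>"
    by (rule someI_ex) (use chart_exists assms points_eq in blast)
  then show thesis using that[of "fst ?\<kappa>" "snd ?\<kappa>"] by simp
qed

text \<open>Compatibility with the transition maps amounts to agreement of all charts, and
  holomorphy can be tested upstairs on the preimage of \<open>W\<close> under
  \<open>P\<close>.\<close>

lemma vector_field_iff:
  assumes W: "openin (mtop M) W"
  shows "vector_field M W v \<longleftrightarrow>
    (\<forall>(U, \<phi>)\<in>charts M. \<forall>x\<in>U \<inter> W. v (U, \<phi>) x = fval v x) \<and> holo_on (fval v \<circ> P) (P -` W)"
    (is "_ \<longleftrightarrow> ?A \<and> ?B")
proof
  assume v: "vector_field M W v"
  have trans: "v (V, \<psi>) x = v (U, \<phi>) x"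
    if "(U, \<phi>) \<in> charts M" "(V, \<psi>) \<in> charts M" "x \<in> U \<inter> V \<inter> W" for U \<phi> V \<psi> x
    using v that transition_derivative[OF that(1) _ that(2)] unfolding vector_field_def by fastforce
  have A: "v (U, \<phi>) x = fval v x" if "(U, \<phi>) \<in> charts M" "x \<in> U" "x \<in> W" for U \<phi> x
  proof -
    have "x \<in> points M" using that openin_subset[OF W] by blast
    then obtain V \<psi> where "(SOME \<kappa>. \<kappa> \<in> charts M \<and> x \<in> fst \<kappa>) = (V, \<psi>)" "(V, \<psi>) \<in> charts M" "x \<in> V"
      by (rule some_chart)
    then show ?thesis using trans[of V \<psi> U \<phi> x] that by (simp add: fval_def)
  qed
  have "holo_on (fval v \<circ> P) (P -` W)"
  proof (rule holo_on_locally)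
    fix z assume z: "z \<in> P -` W"
    obtain U \<phi> where U: "(U, \<phi>) \<in> charts M" "P z \<in> U" using ex_chart_at[OF P_in_points] .
    obtain N k where N: "open N" "z \<in> N" "k \<in> K"
      "\<And>w. w \<in> N \<Longrightarrow> P w \<in> U \<and> \<phi> (P w) = w + k \<and> w + k \<in> \<phi> ` U"
      using local_section_shift[OF U] by metis
    let ?N = "N \<inter> P -` W"
    have o: "open ?N" using N open_vimage_P[OF W] by blast
    have "holo_on (v (U, \<phi>) \<circ> inv_into U \<phi>) (\<phi> ` (U \<inter> W))"
      using v U(1) unfolding vector_field_def by blast
    moreover have "holo_on (\<lambda>w. w + k) ?N" by (rule holo_on_affine[OF complex_linear_id])
    moreover have "(\<lambda>w. w + k) ` ?N \<subseteq> \<phi> ` (U \<inter> W)"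
      unfolding chart_image_Int[OF U(1)] using N by (auto simp: P_add)
    ultimately have 1: "holo_on (\<lambda>w. (v (U, \<phi>) \<circ> inv_into U \<phi>) (w + k)) ?N"
      using holo_on_compose by blast
    have "(v (U, \<phi>) \<circ> inv_into U \<phi>) (w + k) = (fval v \<circ> P) w" if "w \<in> ?N" for w
      using that N(3) N(4)[of w] chart_at_P(3)[OF U(1)] A[OF U(1)] by (simp add: P_add)
    then have "holo_on (fval v \<circ> P) ?N" by (rule holo_on_transform[OF o 1])
    moreover have "z \<in> ?N" using z N(2) by simp
    ultimately show "\<exists>N. z \<in> N \<and> holo_on (fval v \<circ> P) N" by (intro exI[of _ ?N] conjI)
  qed
  then show "?A \<and> ?B" using A by auto
next
  assume AB: "?A \<and> ?B"
  then have A: "v (U, \<phi>) x = fval v x" if "(U, \<phi>) \<in> charts M" "x \<in> U" "x \<in> W" for U \<phi> x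
    using that by auto
  show "vector_field M W v"
    unfolding vector_field_def
  proof (intro conjI ballI, safe)
    fix U \<phi> assume U: "(U, \<phi>) \<in> charts M"
    have o: "open (\<phi> ` (U \<inter> W))"
      unfolding chart_image_Int[OF U] using chart_image_open[OF U] open_vimage_P[OF W] by blast
    have 1: "holo_on (fval v \<circ> P) (\<phi> ` (U \<inter> W))"
      using AB holo_on_subset unfolding chart_image_Int[OF U] by blast
    have "(fval v \<circ> P) w = (v (U, \<phi>) \<circ> inv_into U \<phi>) w" if "w \<in> \<phi> ` (U \<inter> W)" for w
      using that chart_at_P[OF U] A[OF U] unfolding chart_image_Int[OF U] by simp
    then show "holo_on (v (U, \<phi>) \<circ> inv_into U \<phi>) (\<phi> ` (U \<inter> W))"
      by (rule holo_on_transform[OF o 1])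
  next
    fix U \<phi> V \<psi> x assume "(U, \<phi>) \<in> charts M" "(V, \<psi>) \<in> charts M" "x \<in> U" "x \<in> V" "x \<in> W"
    then show "v (V, \<psi>) x = frechet_derivative (\<psi> \<circ> inv_into U \<phi>) (at (\<phi> x)) (v (U, \<phi>) x)"
      using transition_derivative A by simp
  qed
qed

lemma vector_fieldD:
  assumes "vector_field M W v" "openin (mtop M) W"
  shows "(U, \<phi>) \<in> charts M \<Longrightarrow> x \<in> U \<Longrightarrow> x \<in> W \<Longrightarrow> v (U, \<phi>) x = fval v x"
    and "holo_on (fval v \<circ> P) (P -` W)"
  using assms(1) unfolding vector_field_iff[OF assms(2)] by auto

lemma fval_eqI:
  assumes "x \<in> points M" "\<And>U \<phi>. (U, \<phi>) \<in> charts M \<Longrightarrow> x \<in> U \<Longrightarrow> v (U, \<phi>) x = a"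
  shows "fval v x = a"
proof -
  obtain U \<phi> where "(SOME \<kappa>. \<kappa> \<in> charts M \<and> x \<in> fst \<kappa>) = (U, \<phi>)" "(U, \<phi>) \<in> charts M" "x \<in> U"
    using assms(1) by (rule some_chart)
  then show ?thesis using assms(2) by (simp add: fval_def)
qed

lemma vector_fieldI:
  assumes W: "openin (mtop M) W"
    and v: "\<And>U \<phi> x. (U, \<phi>) \<in> charts M \<Longrightarrow> x \<in> U \<Longrightarrow> x \<in> W \<Longrightarrow> v (U, \<phi>) x = F x"
    and holo: "holo_on (\<lambda>z. F (P z)) (P -` W)"
  shows "vector_field M W v"
proof -
  have F: "fval v x = F x" if "x \<in> W" for x
    using that openin_subset[OF W] v by (intro fval_eqI) auto
  then have "holo_on (fval v \<circ> P) (P -` W)"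
    by (intro holo_on_transform[OF open_vimage_P[OF W] holo]) simp
  then show ?thesis using v F unfolding vector_field_iff[OF W] by auto
qed

lemma vector_field_subset:
  assumes "vector_field M W v" "openin (mtop M) W" "openin (mtop M) W'" "W' \<subseteq> W"
  shows "vector_field M W' v"
proof (rule vector_fieldI[OF assms(3)])
  show "v (U, \<phi>) x = fval v x" if "(U, \<phi>) \<in> charts M" "x \<in> U" "x \<in> W'" for U \<phi> x
    using vector_fieldD(1)[OF assms(1,2)] that assms(4) by blast
  have "P -` W' \<subseteq> P -` W" using assms(4) by blast
  then show "holo_on (\<lambda>z. fval v (P z)) (P -` W')"
    using holo_on_subset[OF vector_fieldD(2)[OF assms(1,2)]] by (simp add: comp_def)
qed

lemma vector_field_add:
  assumes "vector_field M W v" "vector_field M W w" "openin (mtop M) W"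
  shows "vector_field M W (vf_add v w)"
  using vector_fieldD[OF assms(1,3)] vector_fieldD[OF assms(2,3)]
  by (intro vector_fieldI[OF assms(3), where F = "\<lambda>x. fval v x + fval w x"] holo_on_add)
    (simp_all add: vf_add_def comp_def)

lemma vector_field_uminus:
  assumes "vector_field M W v" "openin (mtop M) W"
  shows "vector_field M W (\<lambda>\<kappa> p. - v \<kappa> p)"
  using vector_fieldD[OF assms]
  by (intro vector_fieldI[OF assms(2), where F = "\<lambda>x. - fval v x"] holo_on_uminus)
    (simp_all add: comp_def)

lemma vector_field_zero: "openin (mtop M) W \<Longrightarrow> vector_field M W (\<lambda>\<kappa> p. 0)"
  by (rule vector_fieldI[where F = "\<lambda>x. 0"]) (simp_all add: holo_on_const)

lemma vf_eq_onD:
  assumes "vf_eq_on M W v w" "x \<in> W" "x \<in> points M"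
  shows "fval v x = fval w x"
proof -
  obtain U \<phi> where "(SOME \<kappa>. \<kappa> \<in> charts M \<and> x \<in> fst \<kappa>) = (U, \<phi>)" "(U, \<phi>) \<in> charts M" "x \<in> U"
    using assms(3) by (rule some_chart)
  then show ?thesis using assms by (auto simp: fval_def vf_eq_on_def)
qed

lemma vf_eq_on_iff:
  "vf_eq_on M W v w \<longleftrightarrow>
    (\<forall>U \<phi> x. (U, \<phi>) \<in> charts M \<longrightarrow> x \<in> U \<longrightarrow> x \<in> W \<longrightarrow> v (U, \<phi>) x = w (U, \<phi>) x)"
  unfolding vf_eq_on_def by auto

lemma fval_diff [simp]: "fval (vf_diff v w) x = fval v x - fval w x"
  by (simp add: fval_def vf_diff_def)

lemma fval_add [simp]: "fval (vf_add v w) x = fval v x + fval w x"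
  by (simp add: fval_def vf_add_def)

section \<open>Cech cocycles and the cohomology relation\<close>

lemma cech_cocyclesD:
  assumes "(U, c) \<in> cech_cocycles M"
  shows "x \<in> points M \<Longrightarrow> openin (mtop M) (U x)" "x \<in> points M \<Longrightarrow> x \<in> U x"
    and "x \<in> points M \<Longrightarrow> y \<in> points M \<Longrightarrow> vector_field M (U x \<inter> U y) (c x y)"
    and "x \<in> points M \<Longrightarrow> y \<in> points M \<Longrightarrow> z \<in> points M \<Longrightarrow>
      vf_eq_on M (U x \<inter> U y \<inter> U z) (c x z) (vf_add (c x y) (c y z))"
  using assms by (auto simp: cech_cocycles_def pointed_cover_def)

lemma cech_cohomologousI:
  assumes "(U, c) \<in> cech_cocycles M" "(U', c') \<in> cech_cocycles M" "pointed_cover M W"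
    and "\<And>x. x \<in> points M \<Longrightarrow> W x \<subseteq> U x \<inter> U' x" "\<And>x. x \<in> points M \<Longrightarrow> vector_field M (W x) (b x)"
    and "\<And>x y. x \<in> points M \<Longrightarrow> y \<in> points M \<Longrightarrow>
      vf_eq_on M (W x \<inter> W y) (vf_diff (c x y) (c' x y)) (vf_diff (b y) (b x))"
  shows "((U, c), (U', c')) \<in> cech_cohomologous M"
  unfolding cech_cohomologous_def using assms by blast

lemma cech_cohomologousE:
  assumes "((U, c), (U', c')) \<in> cech_cohomologous M"
  obtains W b where "(U, c) \<in> cech_cocycles M" "(U', c') \<in> cech_cocycles M"
    and "\<forall>x\<in>points M. openin (mtop M) (W x) \<and> x \<in> W x"
    and "\<forall>x\<in>points M. W x \<subseteq> U x \<inter> U' x \<and> vector_field M (W x) (b x)"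
    and "\<forall>x\<in>points M. \<forall>y\<in>points M.
      vf_eq_on M (W x \<inter> W y) (vf_diff (c x y) (c' x y)) (vf_diff (b y) (b x))"
  using assms unfolding cech_cohomologous_def pointed_cover_def by blast

lemma cohomologous_refl:
  assumes "\<gamma> \<in> cech_cocycles M"
  shows "(\<gamma>, \<gamma>) \<in> cech_cohomologous M"
proof -
  obtain U c where \<gamma>: "\<gamma> = (U, c)" by (cases \<gamma>)
  note D = cech_cocyclesD[OF assms[unfolded \<gamma>]]
  show ?thesis unfolding \<gamma>
    by (rule cech_cohomologousI[where W = U and b = "\<lambda>x \<kappa> p. 0"])
      (use assms \<gamma> D vector_field_zero in \<open>auto simp: pointed_cover_def vf_eq_on_def vf_diff_def\<close>)
qed

lemma cohomologous_sym:
  assumes "(\<gamma>, \<delta>) \<in> cech_cohomologous M"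
  shows "(\<delta>, \<gamma>) \<in> cech_cohomologous M"
proof -
  obtain U c U' c' where e: "\<gamma> = (U, c)" "\<delta> = (U', c')" by (cases \<gamma>, cases \<delta>)
  obtain W b where D: "(U, c) \<in> cech_cocycles M" "(U', c') \<in> cech_cocycles M"
    and W: "\<forall>x\<in>points M. openin (mtop M) (W x) \<and> x \<in> W x"
    and b: "\<forall>x\<in>points M. W x \<subseteq> U x \<inter> U' x \<and> vector_field M (W x) (b x)"
    and cb: "\<forall>x\<in>points M. \<forall>y\<in>points M.
      vf_eq_on M (W x \<inter> W y) (vf_diff (c x y) (c' x y)) (vf_diff (b y) (b x))"
    using assms unfolding e by (rule cech_cohomologousE)
  show ?thesis unfolding e
  proof (rule cech_cohomologousI[where W = W and b = "\<lambda>x \<kappa> p. - b x \<kappa> p"])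
    fix x y assume xy: "x \<in> points M" "y \<in> points M"
    show "vf_eq_on M (W x \<inter> W y) (vf_diff (c' x y) (c x y)) (vf_diff (\<lambda>\<kappa> p. - b y \<kappa> p) (\<lambda>\<kappa> p. - b x \<kappa> p))"
      unfolding vf_eq_on_iff
    proof (intro allI impI)
      fix V \<phi> p assume "(V, \<phi>) \<in> charts M" "p \<in> V" "p \<in> W x \<inter> W y"
      then have "c x y (V, \<phi>) p - c' x y (V, \<phi>) p = b y (V, \<phi>) p - b x (V, \<phi>) p"
        using cb xy unfolding vf_eq_on_iff vf_diff_def by blast
      then show "vf_diff (c' x y) (c x y) (V, \<phi>) p =
          vf_diff (\<lambda>\<kappa> p. - b y \<kappa> p) (\<lambda>\<kappa> p. - b x \<kappa> p) (V, \<phi>) p"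
        by (simp add: vf_diff_def algebra_simps)
    qed
  qed (use D W b vector_field_uminus in \<open>auto simp: pointed_cover_def\<close>)
qed

text \<open>The two bounding cochains add up on the intersections of the two refining
  covers.\<close>

lemma cohomologous_trans:
  assumes "(\<gamma>, \<delta>) \<in> cech_cohomologous M" "(\<delta>, \<epsilon>) \<in> cech_cohomologous M"
  shows "(\<gamma>, \<epsilon>) \<in> cech_cohomologous M"
proof -
  obtain U c U' c' U'' c'' where e: "\<gamma> = (U, c)" "\<delta> = (U', c')" "\<epsilon> = (U'', c'')"
    by (cases \<gamma>, cases \<delta>, cases \<epsilon>)
  obtain W b where D: "(U, c) \<in> cech_cocycles M" "(U', c') \<in> cech_cocycles M"
    and W: "\<forall>x\<in>points M. openin (mtop M) (W x) \<and> x \<in> W x"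
    and b: "\<forall>x\<in>points M. W x \<subseteq> U x \<inter> U' x \<and> vector_field M (W x) (b x)"
    and cb: "\<forall>x\<in>points M. \<forall>y\<in>points M.
      vf_eq_on M (W x \<inter> W y) (vf_diff (c x y) (c' x y)) (vf_diff (b y) (b x))"
    using assms(1) unfolding e by (rule cech_cohomologousE)
  obtain W' b' where D': "(U', c') \<in> cech_cocycles M" "(U'', c'') \<in> cech_cocycles M"
    and W': "\<forall>x\<in>points M. openin (mtop M) (W' x) \<and> x \<in> W' x"
    and b': "\<forall>x\<in>points M. W' x \<subseteq> U' x \<inter> U'' x \<and> vector_field M (W' x) (b' x)"
    and cb': "\<forall>x\<in>points M. \<forall>y\<in>points M.
      vf_eq_on M (W' x \<inter> W' y) (vf_diff (c' x y) (c'' x y)) (vf_diff (b' y) (b' x))"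
    using assms(2) unfolding e by (rule cech_cohomologousE)
  show ?thesis unfolding e
  proof (rule cech_cohomologousI[where W = "\<lambda>x. W x \<inter> W' x" and b = "\<lambda>x. vf_add (b x) (b' x)"])
    fix x assume x: "x \<in> points M"
    have o: "openin (mtop M) (W x \<inter> W' x)" using W W' x by blast
    show "vector_field M (W x \<inter> W' x) (vf_add (b x) (b' x))"
      using b b' W W' x by (intro vector_field_add o vector_field_subset[OF _ _ o]) auto
    fix y assume y: "y \<in> points M"
    have 1: "vf_diff (c x y) (c'' x y) (U, \<phi>) p = vf_diff (vf_add (b y) (b' y)) (vf_add (b x) (b' x)) (U, \<phi>) p"
      if "(U, \<phi>) \<in> charts M" "p \<in> U" "p \<in> W x" "p \<in> W' x" "p \<in> W y" "p \<in> W' y" for U \<phi> p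
    proof -
      have "c x y (U, \<phi>) p - c' x y (U, \<phi>) p = b y (U, \<phi>) p - b x (U, \<phi>) p"
        using cb x y that unfolding vf_eq_on_def vf_diff_def by blast
      moreover have "c' x y (U, \<phi>) p - c'' x y (U, \<phi>) p = b' y (U, \<phi>) p - b' x (U, \<phi>) p"
        using cb' x y that unfolding vf_eq_on_def vf_diff_def by blast
      ultimately show ?thesis by (simp add: vf_diff_def vf_add_def algebra_simps)
    qed
    show "vf_eq_on M (W x \<inter> W' x \<inter> (W y \<inter> W' y)) (vf_diff (c x y) (c'' x y))
       (vf_diff (vf_add (b y) (b' y)) (vf_add (b x) (b' x)))"
      unfolding vf_eq_on_def using 1 by auto
  qed (use D D' W W' b b' in \<open>auto simp: pointed_cover_def\<close>)
qed

end

text \<open>This describes one group element by its affine lift. The inverse \<open>B\<close> of the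
  linear part is carried along so that the inverse automorphism \<open>h\<close> has the affine lift
  with linear part \<open>B\<close> and constant \<open>- B t\<close>.\<close>

locale flat_automorphism = flat_manifold M P K
  for M :: "('a, 'v::complex_euclidean) cmfd" and P K +
  fixes f :: "'a \<Rightarrow> 'a" and A B :: "'v \<Rightarrow> 'v" and t :: 'v
  assumes A: "complex_linear A" and B: "complex_linear B"
    and AB: "\<And>z. A (B z) = z" and BA: "\<And>z. B (A z) = z"
    and f_lift: "\<And>z. f (P z) = P (A z + t)" and f_inj: "inj_on f (points M)"
begin

definition h :: "'a \<Rightarrow> 'a" where "h = inv_into (points M) f"

lemma B_diff: "B (x - y) = B x - B y"
  using B linear_diff[of B x y] by (simp add: complex_linear_def bounded_linear.linear)

lemma h_lift: "h (P z) = P (B z + - B t)"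
proof -
  have "f (P (B (z - t))) = P z" by (simp add: f_lift AB)
  then have "h (P z) = P (B (z - t))" unfolding h_def using f_inj by (metis P_in_points inv_into_f_f)
  then show ?thesis by (simp add: B_diff)
qed

lemma fh: "y \<in> points M \<Longrightarrow> f (h y) = y" and h_points: "y \<in> points M \<Longrightarrow> h y \<in> points M"
proof -
  assume "y \<in> points M"
  then obtain z where z: "y = P z" by (auto simp: points_eq)
  have "B z + - B t = B (z - t)" by (simp add: B_diff)
  then show "f (h y) = y" "h y \<in> points M" by (simp_all add: z h_lift f_lift AB)
qed

lemma image_iff_h: "W \<subseteq> points M \<Longrightarrow> y \<in> f ` W \<longleftrightarrow> y \<in> points M \<and> h y \<in> W"
proof -
  assume W: "W \<subseteq> points M"
  have "h (f x) = x" if "x \<in> points M" for x using that f_inj by (simp add: h_def)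
  moreover have "f x \<in> points M" if "x \<in> points M" for x
    using that by (auto simp: points_eq f_lift)
  ultimately show ?thesis using W fh by (auto simp: image_iff) (metis subsetD)+
qed

lemma vimage_image:
  assumes "openin (mtop M) W"
  shows "P -` (f ` W) = (\<lambda>z. B z + - B t) -` (P -` W)"
  by (rule Set.set_eqI) (simp add: image_iff_h[OF openin_subset[OF assms]] h_lift)

lemma openin_image:
  assumes W: "openin (mtop M) W"
  shows "openin (mtop M) (f ` W)"
proof -
  have "continuous_on UNIV (\<lambda>z. B z + - B t)"
    using B by (intro continuous_intros linear_continuous_on) (simp add: complex_linear_def)
  then have "open (P -` (f ` W))"
    unfolding vimage_image[OF W] by (intro open_vimage open_vimage_P[OF W])
  moreover have "f ` W \<subseteq> range P"
    using image_iff_h[OF openin_subset[OF W]] points_eq by blast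
  ultimately show ?thesis by (simp add: open_iff)
qed

text \<open>In all charts the derivative of \<open>f\<close> is the same linear map
  \<open>A\<close>, so the choice of chart inside \<open>vf_push\<close> has no influence.\<close>

lemma vf_push_eq:
  assumes "(V, \<psi>) \<in> charts M" "y \<in> V"
  shows "vf_push M f v (V, \<psi>) y = A (fval v (h y))"
proof -
  have y: "y \<in> points M" using assms chart_subset by blast
  obtain U \<phi> where U: "(SOME \<kappa>. \<kappa> \<in> charts M \<and> h y \<in> fst \<kappa>) = (U, \<phi>)" "(U, \<phi>) \<in> charts M" "h y \<in> U"
    using h_points[OF y] by (rule some_chart)
  have "(\<psi> \<circ> f \<circ> inv_into U \<phi> has_derivative A) (at (\<phi> (h y)))"
    using assms y by (intro affine_map_in_charts[OF flat_manifold_axioms A f_lift U(2,3)]) (simp_all add: fh)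
  then have "frechet_derivative (\<psi> \<circ> f \<circ> inv_into U \<phi>) (at (\<phi> (h y))) = A"
    using frechet_derivative_at by metis
  then show ?thesis
    using U(1) unfolding vf_push_def h_def[symmetric] fval_def by (simp add: Let_def)
qed

lemma vector_field_push:
  assumes v: "vector_field M W v" and W: "openin (mtop M) W"
  shows "vector_field M (f ` W) (vf_push M f v)"
proof (rule vector_fieldI[OF openin_image[OF W], where F = "\<lambda>y. A (fval v (h y))"])
  have 1: "holo_on (\<lambda>z. (fval v \<circ> P) (B z + - B t)) (P -` (f ` W))"
    by (rule holo_on_compose[OF holo_on_affine[OF B] vector_fieldD(2)[OF v W]])
      (simp add: vimage_image[OF W] image_subset_iff)
  have "holo_on (\<lambda>z. A ((fval v \<circ> P) (B z + - B t)) + 0) (P -` (f ` W))"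
    by (rule holo_on_compose[OF 1 holo_on_affine[OF A] subset_UNIV])
  then show "holo_on (\<lambda>z. A (fval v (h (P z)))) (P -` (f ` W))"
    by (simp add: h_lift)
qed (rule vf_push_eq)

lemma cocycle_push_eq: "cocycle_push M f (U, c) = (\<lambda>x. f ` U (h x), \<lambda>x y. vf_push M f (c (h x) (h y)))"
  by (simp add: cocycle_push_def h_def Let_def)

lemma image_Int:
  assumes "openin (mtop M) W" "openin (mtop M) W'"
  shows "f ` (W \<inter> W') = f ` W \<inter> f ` W'"
  using inj_on_image_Int[OF f_inj openin_subset[OF assms(1)] openin_subset[OF assms(2)]] .

lemma vf_eq_on_push:
  assumes "openin (mtop M) W" "vf_eq_on M W v w"
  shows "vf_eq_on M (f ` W) (vf_push M f v) (vf_push M f w)"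
  unfolding vf_eq_on_iff
  using vf_eq_onD[OF assms(2)]
  by (simp add: vf_push_eq image_iff_h[OF openin_subset[OF assms(1)]] h_points)

lemma A_add: "A (x + y) = A x + A y" and A_diff: "A (x - y) = A x - A y"
  using A linear_add[of A x y] linear_diff[of A x y]
  by (simp_all add: complex_linear_def bounded_linear.linear)

lemma vf_push_add: "(V, \<psi>) \<in> charts M \<Longrightarrow> y \<in> V \<Longrightarrow>
    vf_push M f (vf_add v w) (V, \<psi>) y = vf_add (vf_push M f v) (vf_push M f w) (V, \<psi>) y"
  and vf_push_diff: "(V, \<psi>) \<in> charts M \<Longrightarrow> y \<in> V \<Longrightarrow>
    vf_push M f (vf_diff v w) (V, \<psi>) y = vf_diff (vf_push M f v) (vf_push M f w) (V, \<psi>) y"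
  by (simp_all add: vf_push_eq vf_add_def[of "vf_push M f v"] vf_diff_def[of "vf_push M f v"] A_add A_diff)

lemma cocycle_push_cocycle:
  assumes "\<gamma> \<in> cech_cocycles M"
  shows "cocycle_push M f \<gamma> \<in> cech_cocycles M"
proof -
  obtain U c where \<gamma>: "\<gamma> = (U, c)" by (cases \<gamma>)
  note D = cech_cocyclesD[OF assms[unfolded \<gamma>]]
  show ?thesis
    unfolding \<gamma> cocycle_push_eq cech_cocycles_def
  proof (clarsimp, intro conjI ballI)
    show "pointed_cover M (\<lambda>x. f ` U (h x))"
      unfolding pointed_cover_def using D(1,2) h_points openin_image fh by (metis imageI)
    fix x y assume x: "x \<in> points M" and y: "y \<in> points M"
    note o = D(1)[OF h_points[OF x]] D(1)[OF h_points[OF y]]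
    show "vector_field M (f ` U (h x) \<inter> f ` U (h y)) (vf_push M f (c (h x) (h y)))"
      using vector_field_push[OF D(3)[OF h_points[OF x] h_points[OF y]] openin_Int[OF o]]
      by (simp add: image_Int[OF o])
    fix z assume z: "z \<in> points M"
    note o' = D(1)[OF h_points[OF z]]
    have "vf_eq_on M (f ` (U (h x) \<inter> U (h y) \<inter> U (h z))) (vf_push M f (c (h x) (h z)))
      (vf_push M f (vf_add (c (h x) (h y)) (c (h y) (h z))))"
      by (rule vf_eq_on_push[OF openin_Int[OF openin_Int[OF o] o'] D(4)]) (use h_points x y z in auto)
    then show "vf_eq_on M (f ` U (h x) \<inter> f ` U (h y) \<inter> f ` U (h z)) (vf_push M f (c (h x) (h z)))
      (vf_add (vf_push M f (c (h x) (h y))) (vf_push M f (c (h y) (h z))))"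
      unfolding image_Int[OF openin_Int[OF o] o'] image_Int[OF o] vf_eq_on_iff
      by (simp add: vf_push_add)
  qed
qed

lemma cocycle_push_cohomologous:
  assumes "(\<gamma>, \<delta>) \<in> cech_cohomologous M"
  shows "(cocycle_push M f \<gamma>, cocycle_push M f \<delta>) \<in> cech_cohomologous M"
proof -
  obtain U c U' c' where e: "\<gamma> = (U, c)" "\<delta> = (U', c')" by (cases \<gamma>, cases \<delta>)
  obtain W b where D: "(U, c) \<in> cech_cocycles M" "(U', c') \<in> cech_cocycles M"
    and W: "\<forall>x\<in>points M. openin (mtop M) (W x) \<and> x \<in> W x"
    and b: "\<forall>x\<in>points M. W x \<subseteq> U x \<inter> U' x \<and> vector_field M (W x) (b x)"
    and cb: "\<forall>x\<in>points M. \<forall>y\<in>points M.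
      vf_eq_on M (W x \<inter> W y) (vf_diff (c x y) (c' x y)) (vf_diff (b y) (b x))"
    using assms unfolding e by (rule cech_cohomologousE)
  show ?thesis unfolding e cocycle_push_eq
  proof (rule cech_cohomologousI[where W = "\<lambda>x. f ` W (h x)" and b = "\<lambda>x. vf_push M f (b (h x))"])
    show "(\<lambda>x. f ` U (h x), \<lambda>x y. vf_push M f (c (h x) (h y))) \<in> cech_cocycles M"
      "(\<lambda>x. f ` U' (h x), \<lambda>x y. vf_push M f (c' (h x) (h y))) \<in> cech_cocycles M"
      using D[THEN cocycle_push_cocycle] by (simp_all add: cocycle_push_eq)
    show "pointed_cover M (\<lambda>x. f ` W (h x))"
      unfolding pointed_cover_def using W h_points openin_image fh by (metis imageI)
    fix x assume x: "x \<in> points M"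
    show "f ` W (h x) \<subseteq> f ` U (h x) \<inter> f ` U' (h x)" using b h_points[OF x] by blast
    show "vector_field M (f ` W (h x)) (vf_push M f (b (h x)))"
      using b W h_points[OF x] vector_field_push by blast
    fix y assume y: "y \<in> points M"
    have o: "openin (mtop M) (W (h x))" "openin (mtop M) (W (h y))" using W h_points x y by auto
    have "vf_eq_on M (f ` (W (h x) \<inter> W (h y)))
      (vf_push M f (vf_diff (c (h x) (h y)) (c' (h x) (h y)))) (vf_push M f (vf_diff (b (h y)) (b (h x))))"
      using cb h_points x y by (intro vf_eq_on_push openin_Int o) auto
    then show "vf_eq_on M (f ` W (h x) \<inter> f ` W (h y))
       (vf_diff (vf_push M f (c (h x) (h y))) (vf_push M f (c' (h x) (h y))))
       (vf_diff (vf_push M f (b (h y))) (vf_push M f (b (h x))))"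
      unfolding image_Int[OF o] vf_eq_on_iff by (simp add: vf_push_diff)
  qed
qed

text \<open>\<open>H1_push\<close> moves all representatives of a class. Since pushing respects the
  cohomology relation, invariance of the class can be checked on one representative.\<close>

lemma H1_push_class:
  assumes "(cocycle_push M f \<gamma>, \<gamma>) \<in> cech_cohomologous M" "\<gamma> \<in> cech_cocycles M"
  shows "H1_push M f (cech_cohomologous M `` {\<gamma>}) = cech_cohomologous M `` {\<gamma>}"
  unfolding H1_push_def
proof (intro equalityI subsetI)
  fix \<epsilon> assume "\<epsilon> \<in> cech_cohomologous M `` (cocycle_push M f ` (cech_cohomologous M `` {\<gamma>}))"
  then obtain \<delta> where "(\<gamma>, \<delta>) \<in> cech_cohomologous M" "(cocycle_push M f \<delta>, \<epsilon>) \<in> cech_cohomologous M"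
    by auto
  then have "(\<gamma>, \<epsilon>) \<in> cech_cohomologous M"
    using assms cocycle_push_cohomologous cohomologous_sym cohomologous_trans by blast
  then show "\<epsilon> \<in> cech_cohomologous M `` {\<gamma>}" by simp
next
  fix \<epsilon> assume "\<epsilon> \<in> cech_cohomologous M `` {\<gamma>}"
  then have "(cocycle_push M f \<gamma>, \<epsilon>) \<in> cech_cohomologous M"
    using assms cohomologous_trans by blast
  moreover have "\<gamma> \<in> cech_cohomologous M `` {\<gamma>}" using cohomologous_refl[OF assms(2)] by simp
  ultimately show "\<epsilon> \<in> cech_cohomologous M `` (cocycle_push M f ` (cech_cohomologous M `` {\<gamma>}))"
    by blast
qed

end

section \<open>A nonzero class in the first cohomology of the tangent sheaf\<close>

lemma scaleC_diff_left: "scaleC (a - b) x = scaleC a x - scaleC b (x :: 'v::complex_euclidean)"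
proof -
  have "scaleC (a - b) x + scaleC b x = scaleC a x" by (simp add: scaleC_add_left[symmetric])
  then show ?thesis by (simp add: algebra_simps)
qed

lemma complex_linear_scaleC: "complex_linear (\<lambda>s. scaleC s e)"
  unfolding complex_linear_def
proof (intro conjI allI)
  show "bounded_linear (\<lambda>s. scaleC s e)"
  proof (rule bounded_linear_intro[where K = "norm e"])
    fix x y :: complex and r :: real
    show "scaleC (x + y) e = scaleC x e + scaleC y e" by (rule scaleC_add_left)
    show "scaleC (r *\<^sub>R x) e = r *\<^sub>R scaleC x e"
      by (simp add: scaleR_conv_of_real scaleC_scaleC[symmetric] scaleC_of_real)
    show "norm (scaleC x e) \<le> norm x * norm e" by (simp add: norm_scaleC)
  qed
qed (simp add: scaleC_complex_def scaleC_scaleC)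

text \<open>For a linear form \<open>ell\<close> with \<open>ell e = 1\<close>, the Dolbeault class of \<open>d cnj ell\<close> times the
  constant vector field \<open>e\<close> is represented by the differences of the local primitives
  \<open>cnj ell\<close>, taken in the charts chosen by \<open>SOME\<close>.\<close>

locale flat_direction = flat_manifold M P K
  for M :: "('a, 'v::complex_euclidean) cmfd" and P K +
  fixes ell :: "'v \<Rightarrow> complex" and e :: 'v and L :: "complex set"
  assumes ell_linear: "complex_linear ell" and ell_e: "ell e = 1" and L: "is_lattice L"
    and L_e: "\<And>l. l \<in> L \<Longrightarrow> scaleC l e \<in> K"
begin

definition chart_at :: "'a \<Rightarrow> ('a, 'v) chart" where
  "chart_at x = (SOME \<kappa>. \<kappa> \<in> charts M \<and> x \<in> fst \<kappa>)"

definition dom :: "'a \<Rightarrow> 'a set" where "dom x = fst (chart_at x)"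

definition prim :: "'a \<Rightarrow> 'a \<Rightarrow> complex" where "prim x p = ell (snd (chart_at x) p)"

text \<open>Two primitives differ by a locally constant function, so the conjugate of their
  difference is holomorphic although conjugation is not. The chart argument is ignored because all
  charts give the same coordinate vector.\<close>

definition cnj_cocycle :: "'a \<Rightarrow> 'a \<Rightarrow> ('a, 'v) vfield" where
  "cnj_cocycle x y \<kappa> p = scaleC (cnj (prim y p - prim x p)) e"

lemma chart_at: "x \<in> points M \<Longrightarrow> (dom x, snd (chart_at x)) \<in> charts M" "x \<in> points M \<Longrightarrow> x \<in> dom x"
proof -
  assume "x \<in> points M"
  then obtain U \<phi> where "chart_at x = (U, \<phi>)" "(U, \<phi>) \<in> charts M" "x \<in> U"
    unfolding chart_at_def by (rule some_chart)
  then show "(dom x, snd (chart_at x)) \<in> charts M" "x \<in> dom x" by (simp_all add: dom_def)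
qed

lemma openin_dom: "x \<in> points M \<Longrightarrow> openin (mtop M) (dom x)"
  using chart_at(1) chart_openin by blast

lemma ell_add: "ell (v + w) = ell v + ell w" and ell_diff: "ell (v - w) = ell v - ell w"
  using ell_linear linear_add[of ell v w] linear_diff[of ell v w]
  by (simp_all add: complex_linear_def bounded_linear.linear)

lemma ell_scaleC: "ell (scaleC c v) = c * ell v"
  using ell_linear by (simp add: complex_linear_def scaleC_complex_def)

lemma prim_locally:
  assumes x: "x \<in> points M" and z: "P z \<in> dom x"
  obtains N c where "open N" "z \<in> N" "\<forall>w\<in>N. P w \<in> dom x \<and> prim x (P w) = ell w + c"
proof -
  obtain N k where "open N" "z \<in> N" "k \<in> K"
    "\<And>w. w \<in> N \<Longrightarrow> P w \<in> dom x \<and> snd (chart_at x) (P w) = w + k \<and> w + k \<in> snd (chart_at x) ` dom x"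
    using local_section_shift[OF chart_at(1)[OF x] z] by metis
  then show thesis using that[of N "ell k"] by (simp add: prim_def ell_add)
qed

lemma vector_field_locally_constant:
  assumes W: "openin (mtop M) W"
    and F: "\<And>z. P z \<in> W \<Longrightarrow> \<exists>N c. open N \<and> z \<in> N \<and> (\<forall>w\<in>N. F (P w) = c)"
  shows "vector_field M W (\<lambda>\<kappa> p. scaleC (cnj (F p)) e)"
proof (rule vector_fieldI[OF W, where F = "\<lambda>p. scaleC (cnj (F p)) e"])
  show "holo_on (\<lambda>z. scaleC (cnj (F (P z))) e) (P -` W)"
  proof (rule holo_on_locally)
    fix z assume "z \<in> P -` W"
    then obtain N c where N: "open N" "z \<in> N" "\<forall>w\<in>N. F (P w) = c" using F by (metis vimageD)
    have "holo_on (\<lambda>z. scaleC (cnj (F (P z))) e) N"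
      by (rule holo_on_transform[OF N(1) holo_on_const[of "scaleC (cnj c) e"]]) (use N in simp)
    then show "\<exists>N. z \<in> N \<and> holo_on (\<lambda>z. scaleC (cnj (F (P z))) e) N" using N(2) by (intro exI conjI)
  qed
qed simp

lemma cnj_cocycle: "(dom, cnj_cocycle) \<in> cech_cocycles M"
proof -
  have vf: "vector_field M (dom x \<inter> dom y) (cnj_cocycle x y)" if xy: "x \<in> points M" "y \<in> points M" for x y
  proof -
    have "vector_field M (dom x \<inter> dom y) (\<lambda>\<kappa> p. scaleC (cnj (prim y p - prim x p)) e)"
    proof (rule vector_field_locally_constant)
      show "openin (mtop M) (dom x \<inter> dom y)" using openin_dom xy by blast
      fix z assume z: "P z \<in> dom x \<inter> dom y"
      obtain N c where N: "open N" "z \<in> N" "\<forall>w\<in>N. P w \<in> dom x \<and> prim x (P w) = ell w + c"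
        using prim_locally[OF xy(1)] z by blast
      obtain N' c' where N': "open N'" "z \<in> N'" "\<forall>w\<in>N'. P w \<in> dom y \<and> prim y (P w) = ell w + c'"
        using prim_locally[OF xy(2)] z by blast
      show "\<exists>N c. open N \<and> z \<in> N \<and> (\<forall>w\<in>N. prim y (P w) - prim x (P w) = c)"
        using N N' by (intro exI[of _ "N \<inter> N'"] exI[of _ "c' - c"]) (simp add: open_Int)
    qed
    then show ?thesis unfolding cnj_cocycle_def .
  qed
  show ?thesis
    unfolding cech_cocycles_def
    using vf openin_dom chart_at(2)
    by (auto simp: pointed_cover_def vf_eq_on_iff cnj_cocycle_def vf_add_def scaleC_add_left[symmetric])
qed

text \<open>Subtracting a bounding cochain from the conjugated primitives makes them agree on
  overlaps, so they glue to a function \<open>g\<close> on all of \<open>M\<close>. Along the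
  direction \<open>e\<close> it differs from cnj s by a holomorphic function, while \<open>g\<close>
  itself is periodic under \<open>L\<close>; this is impossible.\<close>

lemma cnj_cocycle_nonzero: "((dom, cnj_cocycle), (\<lambda>x. points M, \<lambda>x y \<kappa> p. 0)) \<notin> cech_cohomologous M"
proof
  assume "((dom, cnj_cocycle), (\<lambda>x. points M, \<lambda>x y \<kappa> p. 0)) \<in> cech_cohomologous M"
  then obtain W b where W: "\<forall>x\<in>points M. openin (mtop M) (W x) \<and> x \<in> W x"
    and b: "\<forall>x\<in>points M. W x \<subseteq> dom x \<inter> points M \<and> vector_field M (W x) (b x)"
    and cb: "\<forall>x\<in>points M. \<forall>y\<in>points M.
      vf_eq_on M (W x \<inter> W y) (vf_diff (cnj_cocycle x y) (\<lambda>\<kappa> p. 0)) (vf_diff (b y) (b x))"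
    by (rule cech_cohomologousE)
  \<comment> \<open>The cover is indexed by points, so \<open>p\<close> itself can serve as the
    index at \<open>p\<close>. The next fact shows that every other admissible index gives the same
    value.\<close>
  define g where "g p = cnj (prim p p) - ell (fval (b p) p)" for p
  have g: "g p = cnj (prim x p) - ell (fval (b x) p)" if x: "x \<in> points M" and p: "p \<in> W x" for x p
  proof -
    have p': "p \<in> points M" using b x p by blast
    have "fval (vf_diff (cnj_cocycle x p) (\<lambda>\<kappa> p. 0)) p = fval (vf_diff (b p) (b x)) p"
      using cb W x p p' by (intro vf_eq_onD[of "W x \<inter> W p"]) auto
    then have "scaleC (cnj (prim p p - prim x p)) e = fval (b p) p - fval (b x) p"
      by (simp add: fval_def[of "cnj_cocycle x p"] fval_def[of "\<lambda>\<kappa> p. 0"] cnj_cocycle_def)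
    from arg_cong[OF this, of ell]
    have "cnj (prim p p) - cnj (prim x p) = ell (fval (b p) p) - ell (fval (b x) p)"
      by (simp add: ell_scaleC ell_e ell_diff)
    then show ?thesis by (simp add: g_def algebra_simps)
  qed
  \<comment> \<open>On the line through \<open>e\<close> the form \<open>ell\<close> has the value
    \<open>s\<close>, so cnj s cancels the conjugated primitive up to a constant. What remains is
    locally \<open>ell\<close> of the holomorphic field \<open>b\<close>, up to a constant.\<close>
  define H where "H s = cnj s - g (P (scaleC s e))" for s
  have "holo_on H UNIV"
  proof (rule holo_on_locally)
    fix s :: complex
    let ?j = "\<lambda>s. scaleC s e" and ?x = "P (scaleC s e)"
    have x: "?x \<in> points M" by simp
    have Wx: "openin (mtop M) (W ?x)" "?x \<in> W ?x" "vector_field M (W ?x) (b ?x)" "W ?x \<subseteq> dom ?x"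
      using W b x by auto
    obtain N c where N: "open N" "?j s \<in> N" "\<forall>w\<in>N. P w \<in> dom ?x \<and> prim ?x (P w) = ell w + c"
      using prim_locally[OF x chart_at(2)[OF x]] by metis
    let ?N = "?j -` (N \<inter> P -` W ?x)"
    have "continuous_on UNIV ?j"
      using complex_linear_scaleC[of e] by (intro linear_continuous_on) (simp add: complex_linear_def)
    then have o: "open ?N" using N(1) open_vimage_P[OF Wx(1)] by (intro open_vimage open_Int)
    have 1: "holo_on (\<lambda>s. scaleC s e + 0) ?N" by (rule holo_on_affine[OF complex_linear_scaleC])
    have 2: "holo_on (\<lambda>s. (fval (b ?x) \<circ> P) (scaleC s e + 0)) ?N"
      by (rule holo_on_compose[OF 1 vector_fieldD(2)[OF Wx(3,1)]]) auto
    have 3: "holo_on (\<lambda>s. ell ((fval (b ?x) \<circ> P) (scaleC s e + 0)) + - cnj c) ?N"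
      by (rule holo_on_compose[OF 2 holo_on_affine[OF ell_linear] subset_UNIV])
    have "holo_on H ?N"
    proof (rule holo_on_transform[OF o 3])
      fix r assume "r \<in> ?N"
      then have r: "P (?j r) \<in> W ?x" "prim ?x (P (?j r)) = ell (?j r) + c" using N(3) by auto
      show "ell ((fval (b ?x) \<circ> P) (scaleC r e + 0)) + - cnj c = H r"
        using g[OF x r(1)] by (simp add: H_def r(2) ell_scaleC ell_e)
    qed
    moreover have "s \<in> ?N" using N(2) Wx(2) by simp
    ultimately show "\<exists>N. s \<in> N \<and> holo_on H N" by (intro exI conjI)
  qed
  then have "H holomorphic_on UNIV" by (simp add: holo_on_complex_iff)
  then show False
  proof (rule no_holomorphic_cnj_periods[OF L])
    fix s l assume "l \<in> L"
    then have "P (scaleC (s + l) e) = P (scaleC s e)" by (simp add: scaleC_add_left P_add L_e)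
    then show "H (s + l) = H s + cnj l" by (simp add: H_def)
  qed
qed

text \<open>Pushing multiplies the field by \<sigma>, and since \<sigma> is real this factor can be
  moved inside the conjugation. Composition with the inverse automorphism multiplies
  \<open>ell\<close> by \<sigma> once more, and \<sigma>^2 = 1 turns it back into the original form
  up to a constant.\<close>

lemma cnj_cocycle_invariant:
  assumes f: "flat_automorphism M P K f A B t"
    and A_e: "A e = scaleC (of_real \<sigma>) e" and ell_B: "\<And>z. ell (B z) = of_real \<sigma> * ell z"
    and \<sigma>: "\<sigma>\<^sup>2 = (1::real)"
  shows "(cocycle_push M f (dom, cnj_cocycle), (dom, cnj_cocycle)) \<in> cech_cohomologous M"
proof -
  interpret flat_automorphism M P K f A B t by (rule f)
  define W where "W x = f ` dom (h x) \<inter> dom x" for x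
  \<comment> \<open>This compares the transported primitive with the original one. Both have linear
    part \<open>ell\<close>, so their difference is locally constant and its conjugate gives the
    bounding cochain.\<close>
  define F where "F x p = of_real \<sigma> * prim (h x) (h p) - prim x p" for x p
  have oW: "openin (mtop M) (W x)" if "x \<in> points M" for x
    unfolding W_def using that openin_dom openin_image h_points by blast
  show ?thesis
    unfolding cocycle_push_eq
  proof (rule cech_cohomologousI[where W = W and b = "\<lambda>x \<kappa> p. scaleC (cnj (F x p)) e"])
    show "(\<lambda>x. f ` dom (h x), \<lambda>x y. vf_push M f (cnj_cocycle (h x) (h y))) \<in> cech_cocycles M"
      using cocycle_push_cocycle[OF cnj_cocycle] by (simp add: cocycle_push_eq)
    show "(dom, cnj_cocycle) \<in> cech_cocycles M" by (rule cnj_cocycle)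
    show "pointed_cover M W"
      unfolding pointed_cover_def
    proof (intro ballI conjI oW)
      fix x assume x: "x \<in> points M"
      have "f (h x) \<in> f ` dom (h x)" using chart_at(2)[OF h_points[OF x]] by (rule imageI)
      then show "x \<in> W x" using fh[OF x] chart_at(2)[OF x] by (simp add: W_def)
    qed
    fix x assume x: "x \<in> points M"
    show "W x \<subseteq> f ` dom (h x) \<inter> dom x" by (simp add: W_def)
    show "vector_field M (W x) (\<lambda>\<kappa> p. scaleC (cnj (F x p)) e)"
    proof (rule vector_field_locally_constant[OF oW[OF x]])
      fix z assume z: "P z \<in> W x"
      then have "P z \<in> f ` dom (h x)" by (simp add: W_def)
      then have "P (B z + - B t) \<in> dom (h x)"
        using image_iff_h[OF openin_subset[OF openin_dom[OF h_points[OF x]]]] by (simp add: h_lift)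
      then obtain N c where N: "open N" "B z + - B t \<in> N"
        "\<forall>w\<in>N. P w \<in> dom (h x) \<and> prim (h x) (P w) = ell w + c"
        using prim_locally[OF h_points[OF x]] by metis
      have "P z \<in> dom x" using z by (simp add: W_def)
      then obtain N' c' where N': "open N'" "z \<in> N'" "\<forall>w\<in>N'. P w \<in> dom x \<and> prim x (P w) = ell w + c'"
        using prim_locally[OF x] by metis
      let ?N = "(\<lambda>w. B w + - B t) -` N \<inter> N'"
      have "continuous_on UNIV (\<lambda>z. B z + - B t)"
        using B by (intro continuous_intros linear_continuous_on) (simp add: complex_linear_def)
      then have "open ?N" using N(1) N'(1) by (intro open_Int open_vimage)
      moreover have "z \<in> ?N" using N N' by simp
      moreover have "F x (P w) = of_real \<sigma> * (c - ell (B t)) - c'" if "w \<in> ?N" for w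
      proof -
        have w: "prim (h x) (P (B w + - B t)) = ell (B w + - B t) + c" "prim x (P w) = ell w + c'"
          using that N N' by auto
        have "of_real \<sigma> * (of_real \<sigma> * ell w) = ell w"
          using \<sigma> by (simp add: power2_eq_square mult.assoc[symmetric] of_real_mult[symmetric] del: of_real_mult)
        moreover have "ell (B w + - B t) = of_real \<sigma> * ell w - ell (B t)"
          by (simp add: ell_diff ell_B)
        ultimately show ?thesis by (simp only: F_def h_lift w) (simp add: algebra_simps)
      qed
      ultimately show "\<exists>N c. open N \<and> z \<in> N \<and> (\<forall>w\<in>N. F x (P w) = c)" by blast
    qed
    fix y assume y: "y \<in> points M"
    show "vf_eq_on M (W x \<inter> W y) (vf_diff (vf_push M f (cnj_cocycle (h x) (h y))) (cnj_cocycle x y))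
       (vf_diff (\<lambda>\<kappa> p. scaleC (cnj (F y p)) e) (\<lambda>\<kappa> p. scaleC (cnj (F x p)) e))"
      unfolding vf_eq_on_iff
    proof (intro allI impI)
      fix V \<psi> p assume V: "(V, \<psi>) \<in> charts M" "p \<in> V"
      have lin: "A (scaleC c v) = scaleC c (A v)" for c v using A by (simp add: complex_linear_def)
      have "fval (cnj_cocycle (h x) (h y)) (h p) = scaleC (cnj (prim (h y) (h p) - prim (h x) (h p))) e"
        by (simp add: fval_def cnj_cocycle_def)
      then show "vf_diff (vf_push M f (cnj_cocycle (h x) (h y))) (cnj_cocycle x y) (V, \<psi>) p =
          vf_diff (\<lambda>\<kappa> p. scaleC (cnj (F y p)) e) (\<lambda>\<kappa> p. scaleC (cnj (F x p)) e) (V, \<psi>) p"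
        by (simp add: vf_diff_def vf_push_eq[OF V] lin A_e scaleC_scaleC cnj_cocycle_def
            scaleC_diff_left[symmetric] F_def algebra_simps)
    qed
  qed
qed

lemma not_rigid:
  assumes "\<And>g. g \<in> carrier G \<Longrightarrow> \<exists>A B t \<sigma>. flat_automorphism M P K (\<rho> g) A B t \<and>
      A e = scaleC (of_real \<sigma>) e \<and> (\<forall>z. ell (B z) = of_real \<sigma> * ell z) \<and> \<sigma>\<^sup>2 = (1::real)"
  shows "\<not> rigid_action G M \<rho>"
proof
  assume r: "rigid_action G M \<rho>"
  let ?\<xi> = "cech_cohomologous M `` {(dom, cnj_cocycle)}"
  have "H1_push M (\<rho> g) ?\<xi> = ?\<xi>" if g: "g \<in> carrier G" for g
  proof -
    obtain A B t \<sigma> where f: "flat_automorphism M P K (\<rho> g) A B t"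
      and s: "A e = scaleC (of_real \<sigma>) e" "\<And>z. ell (B z) = of_real \<sigma> * ell z" "\<sigma>\<^sup>2 = (1::real)"
      using assms[OF g] by blast
    show ?thesis
      by (rule flat_automorphism.H1_push_class[OF f cnj_cocycle_invariant[OF f s] cnj_cocycle])
  qed
  then have "?\<xi> \<in> H1_invariants G M \<rho>"
    using cnj_cocycle by (auto simp: H1_invariants_def H1_tangent_def intro: quotientI)
  then have "?\<xi> = H1_zero M" using r by (simp add: rigid_action_def)
  moreover have "(dom, cnj_cocycle) \<in> ?\<xi>" using cohomologous_refl[OF cnj_cocycle] by simp
  ultimately have "((\<lambda>x. points M, \<lambda>x y \<kappa> p. 0), (dom, cnj_cocycle)) \<in> cech_cohomologous M"
    by (simp add: H1_zero_def)
  then show False using cohomologous_sym cnj_cocycle_nonzero by blast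
qed

end

section \<open>Complex tori and their products\<close>

lemma flat_manifold_complex_torus:
  assumes L: "is_lattice L"
  shows "flat_manifold (complex_torus L) (torus_proj L) L"
proof
  let ?p = "torus_proj L"
  have cm: "complex_manifold (complex_torus L)" by (rule complex_manifold_complex_torus[OF L])
  have ch: "\<exists>D. U = ?p ` D \<and> \<phi> = inv_into D ?p \<and> open D \<and> inj_on ?p D"
    if "(U, \<phi>) \<in> charts (complex_torus L)" for U \<phi>
    using that by (auto simp: complex_torus_def)
  show "points (complex_torus L) = range ?p" by (simp add: complex_torus_def)
  show "?p z = ?p w \<longleftrightarrow> z - w \<in> L" for z w by (rule torus_proj_eq_iff[OF L])
  show "openin (mtop (complex_torus L)) W \<longleftrightarrow> W \<subseteq> range ?p \<and> open (?p -` W)" for W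
    by (simp add: complex_torus_def openin_quotient_top)
  show "openin (mtop (complex_torus L)) U" if "(U, \<phi>) \<in> charts (complex_torus L)" for U \<phi>
    using ch[OF that] open_map_torus_proj[OF L] by (auto simp: complex_torus_def)
  show "open (\<phi> ` U)" if "(U, \<phi>) \<in> charts (complex_torus L)" for U \<phi>
    using ch[OF that] by (auto simp: torus_chart_inv(1))
  show "?p (\<phi> x) = x" if "(U, \<phi>) \<in> charts (complex_torus L)" "x \<in> U" for U \<phi> x
    using ch[OF that(1)] that(2) by (auto simp: f_inv_into_f)
  show "\<exists>\<kappa>\<in>charts (complex_torus L). x \<in> fst \<kappa>" if "x \<in> range ?p" for x
  proof -
    have "\<Union>(fst ` charts (complex_torus L)) = range ?p"
      using cm by (simp add: complex_manifold_def complex_torus_def)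
    then show ?thesis using that by blast
  qed
qed

text \<open>The topology is the point that needs more than working coordinatewise. The product of
  the quotient topologies is the quotient topology of the product because each \<open>p i\<close> is
  an open map: the image of an open box around a preimage is an open box.\<close>

lemma flat_manifold_product_cmfd:
  fixes E :: "'n::finite \<Rightarrow> ('a, complex) cmfd"
  assumes "\<And>i. flat_manifold (E i) (p i) (K i)"
  shows "flat_manifold (product_cmfd E) (\<lambda>z i. p i (z $ i)) {k. \<forall>i. k $ i \<in> K i}"
proof
  interpret T: flat_manifold "E i" "p i" "K i" for i by (rule assms)
  let ?M = "product_cmfd E" and ?P = "\<lambda>z i. p i (z $ i)"
  have top: "mtop ?M = product_topology (\<lambda>i. mtop (E i)) UNIV" by (simp add: product_cmfd_def)
  have pts: "points ?M = PiE UNIV (\<lambda>i. range (p i))" by (simp add: top T.points_eq)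
  have rangeP: "range ?P = PiE UNIV (\<lambda>i. range (p i))"
  proof (intro equalityI subsetI)
    fix x assume "x \<in> PiE UNIV (\<lambda>i. range (p i))"
    then have "\<forall>i. \<exists>z. x i = p i z" by (auto simp: PiE_iff)
    then obtain z where "\<And>i. x i = p i (z i)" by metis
    then have "x = ?P (\<chi> i. z i)" by auto
    then show "x \<in> range ?P" by blast
  qed auto
  show "points ?M = range ?P" unfolding pts rangeP ..
  show "?P z = ?P w \<longleftrightarrow> z - w \<in> {k. \<forall>i. k $ i \<in> K i}" for z w
    by (simp add: fun_eq_iff T.P_eq_iff)
  have ch: "\<exists>V \<psi>. U = PiE UNIV V \<and> \<phi> = (\<lambda>x. \<chi> i. \<psi> i (x i)) \<and> (\<forall>i. (V i, \<psi> i) \<in> charts (E i))"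
    if "(U, \<phi>) \<in> charts ?M" for U \<phi>
    using that by (simp add: product_cmfd_def)
  show "openin (mtop ?M) U" if c: "(U, \<phi>) \<in> charts ?M" for U \<phi>
  proof -
    obtain V \<psi> where "U = PiE UNIV V" "\<forall>i. (V i, \<psi> i) \<in> charts (E i)" using ch[OF c] by blast
    then show ?thesis using T.chart_openin unfolding top by (simp add: openin_PiE) blast
  qed
  show sec: "?P (\<phi> x) = x" if c: "(U, \<phi>) \<in> charts ?M" "x \<in> U" for U \<phi> x
  proof -
    obtain V \<psi> where "U = PiE UNIV V" "\<phi> = (\<lambda>x. \<chi> i. \<psi> i (x i))" "\<forall>i. (V i, \<psi> i) \<in> charts (E i)"
      using ch[OF c(1)] by blast
    then show ?thesis using T.chart_section c(2) by (simp add: PiE_iff fun_eq_iff) blast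
  qed
  show "open (\<phi> ` U)" if c: "(U, \<phi>) \<in> charts ?M" for U \<phi>
  proof -
    obtain V \<psi> where V: "U = PiE UNIV V" "\<phi> = (\<lambda>x. \<chi> i. \<psi> i (x i))" "\<forall>i. (V i, \<psi> i) \<in> charts (E i)"
      using ch[OF c(1)] by blast
    have "\<phi> ` U = (\<Inter>i. (\<lambda>v. v $ i) -` (\<psi> i ` V i))"
    proof (intro equalityI subsetI)
      fix v assume "v \<in> (\<Inter>i. (\<lambda>v. v $ i) -` (\<psi> i ` V i))"
      then have "\<forall>i. \<exists>x. x \<in> V i \<and> v $ i = \<psi> i x" by auto
      then obtain x where "\<And>i. x i \<in> V i" "\<And>i. v $ i = \<psi> i (x i)" by metis
      then have "x \<in> U" "v = \<phi> x" by (auto simp: V(1,2) PiE_iff vec_eq_iff)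
      then show "v \<in> \<phi> ` U" by blast
    qed (auto simp: V(1,2) PiE_iff)
    moreover have "open ((\<lambda>v::complex ^ 'n. v $ i) -` (\<psi> i ` V i))" for i
      using T.chart_image_open V(3) by (intro open_vimage continuous_intros) blast
    ultimately show ?thesis by (auto intro!: open_INT)
  qed
  show "\<exists>\<kappa>\<in>charts ?M. x \<in> fst \<kappa>" if x: "x \<in> range ?P" for x
  proof -
    have "\<forall>i. \<exists>\<kappa>. \<kappa> \<in> charts (E i) \<and> x i \<in> fst \<kappa>" using T.chart_exists x by blast
    then obtain k where k: "\<And>i. k i \<in> charts (E i)" "\<And>i. x i \<in> fst (k i)" by metis
    let ?V = "\<lambda>i. fst (k i)" and ?\<psi> = "\<lambda>i. snd (k i)"
    have "(PiE UNIV ?V, \<lambda>x. \<chi> i. ?\<psi> i (x i)) \<in> charts ?M"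
      unfolding product_cmfd_def using k(1) by (auto intro!: exI[of _ ?V] exI[of _ ?\<psi>])
    moreover have "x \<in> fst (PiE UNIV ?V, \<lambda>x. \<chi> i. ?\<psi> i (x i))" using k(2) by (simp add: PiE_iff)
    ultimately show ?thesis by blast
  qed
  show "openin (mtop ?M) W \<longleftrightarrow> W \<subseteq> range ?P \<and> open (?P -` W)" for W
  proof
    assume W: "openin (mtop ?M) W"
    have "continuous_map euclidean (mtop ?M) ?P"
      unfolding top continuous_map_componentwise_UNIV
    proof
      fix i
      have 1: "continuous_map euclidean (mtop (E i)) (p i)"
        unfolding continuous_map_def using T.open_vimage_P[of i] T.points_eq by (auto simp: vimage_def)
      have 2: "continuous_map euclidean euclidean (\<lambda>z::complex ^ 'n. z $ i)"
        by (simp add: continuous_on_component)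
      show "continuous_map euclidean (mtop (E i)) (\<lambda>z. p i (z $ i))"
        using continuous_map_compose[OF 2 1] by (simp only: o_def)
    qed
    then have "open (?P -` W)" using W by (auto simp: continuous_map_def vimage_def)
    moreover have "W \<subseteq> range ?P" using openin_subset[OF W] unfolding pts rangeP .
    ultimately show "W \<subseteq> range ?P \<and> open (?P -` W)" by blast
  next
    assume W: "W \<subseteq> range ?P \<and> open (?P -` W)"
    show "openin (mtop ?M) W"
    proof (subst openin_subopen, intro ballI)
      fix x assume x: "x \<in> W"
      then obtain z where z: "x = ?P z" using W by blast
      then have "z \<in> ?P -` W" using x by simp
      then obtain A where A: "\<forall>i. open (A i) \<and> z $ i \<in> A i" "\<forall>y. (\<forall>i. y $ i \<in> A i) \<longrightarrow> y \<in> ?P -` W"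
        using W unfolding open_vec_def by blast
      let ?T = "PiE UNIV (\<lambda>i. p i ` A i)"
      have "openin (mtop ?M) ?T"
        unfolding top using A(1) T.openin_image_P by (simp add: openin_PiE)
      moreover have "x \<in> ?T" using A(1) by (auto simp: z PiE_iff)
      moreover have "?T \<subseteq> W"
      proof
        fix y assume "y \<in> ?T"
        then have "\<forall>i. \<exists>a. a \<in> A i \<and> y i = p i a" by (auto simp: PiE_iff)
        then obtain a where a: "\<And>i. a i \<in> A i" "\<And>i. y i = p i (a i)" by metis
        then have "(\<chi> i. a i) \<in> ?P -` W" using A(2)[rule_format, of "\<chi> i. a i"] by simp
        moreover have "y = ?P (\<chi> i. a i)" using a by auto
        ultimately show "y \<in> W" by simp
      qed
      ultimately show "\<exists>T. openin (mtop ?M) T \<and> x \<in> T \<and> T \<subseteq> W" by blast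
    qed
  qed
qed

lemma holomorphic_map_affine_lift:
  assumes M: "flat_manifold M P K" and N: "flat_manifold M' P' K'"
    and A: "complex_linear A" and f: "\<And>z. f (P z) = P' (A z + t)"
  shows "holomorphic_map M M' f"
proof -
  interpret M: flat_manifold M P K by (rule M)
  interpret N: flat_manifold M' P' K' by (rule N)
  have cont: "continuous_on UNIV (\<lambda>z. A z + t)"
    using A by (intro continuous_intros linear_continuous_on) (simp add: complex_linear_def)
  have "continuous_map (mtop M) (mtop M') f"
    unfolding continuous_map_def
  proof (intro conjI allI impI)
    show "f \<in> points M \<rightarrow> points M'" by (auto simp: M.points_eq f)
    fix V assume V: "openin (mtop M') V"
    have "P -` {x \<in> points M. f x \<in> V} = (\<lambda>z. A z + t) -` (P' -` V)" by (auto simp: f)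
    then have "open (P -` {x \<in> points M. f x \<in> V})"
      using cont N.open_vimage_P[OF V] by (simp add: open_vimage)
    then show "openin (mtop M) {x \<in> points M. f x \<in> V}"
      unfolding M.open_iff by (auto simp: M.points_eq)
  qed
  moreover have "holo_on (\<psi> \<circ> f \<circ> inv_into U \<phi>) (\<phi> ` {x \<in> U. f x \<in> V})"
    if c: "(U, \<phi>) \<in> charts M" and d: "(V, \<psi>) \<in> charts M'" for U \<phi> V \<psi>
    unfolding holo_on_def
  proof
    fix w assume "w \<in> \<phi> ` {x \<in> U. f x \<in> V}"
    then obtain x where x: "x \<in> U" "f x \<in> V" "w = \<phi> x" by blast
    have "(\<psi> \<circ> f \<circ> inv_into U \<phi> has_derivative A) (at w)"
      using M.affine_map_in_charts[OF N A f c x(1) d x(2)] x(3) by simp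
    then show "\<exists>D. (\<psi> \<circ> f \<circ> inv_into U \<phi> has_derivative D) (at w) \<and> (\<forall>c v. D (scaleC c v) = scaleC c (D v))"
      using A by (auto simp: complex_linear_def)
  qed
  ultimately show ?thesis unfolding holomorphic_map_def by auto
qed

section \<open>Scaling maps between tori and the Fermat curve\<close>

lemma complex_linear_mult: "complex_linear (\<lambda>z::complex. a * z)"
  by (simp add: complex_linear_def scaleC_complex_def bounded_linear_mult_right)

text \<open>The map picks any preimage by \<open>SOME\<close>. Two preimages differ by an element of
  \<open>L\<close>, which multiplication by \<open>a\<close> sends into \<open>L'\<close>.\<close>

lemma torus_scaling_map:
  assumes L: "is_lattice L" "is_lattice L'" and a: "\<And>l. l \<in> L \<Longrightarrow> a * l \<in> L'"
  obtains f where "holomorphic_map (complex_torus L) (complex_torus L') f"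
    "\<forall>z. f (torus_proj L z) = torus_proj L' (a * z)"
proof -
  define f where "f = (\<lambda>x. torus_proj L' (a * (SOME z. torus_proj L z = x)))"
  have f: "f (torus_proj L z) = torus_proj L' (a * z)" for z
  proof -
    let ?w = "SOME w. torus_proj L w = torus_proj L z"
    have "torus_proj L ?w = torus_proj L z" by (rule someI) (rule refl)
    then have "a * (?w - z) \<in> L'" by (intro a) (simp add: torus_proj_eq_iff[OF L(1)])
    then show ?thesis unfolding f_def by (simp add: torus_proj_eq_iff[OF L(2)] algebra_simps)
  qed
  have "holomorphic_map (complex_torus L) (complex_torus L') f"
    by (rule holomorphic_map_affine_lift[OF flat_manifold_complex_torus[OF L(1)]
          flat_manifold_complex_torus[OF L(2)] complex_linear_mult[of a], where t = 0]) (simp add: f)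
  then show thesis using that f by blast
qed

lemma zeta3_eq: "zeta3 = Complex (-1/2) (sqrt 3 / 2)"
proof -
  have "zeta3 = cis (2 * pi / 3)" by (simp add: zeta3_def cis_conv_exp mult_ac)
  then show ?thesis by (simp add: cis.ctr cos_120 sin_120)
qed

lemma zeta3_root: "zeta3\<^sup>2 + zeta3 + 1 = 0"
  by (simp add: zeta3_eq complex_eq_iff power2_eq_square)

lemma is_lattice_eisenstein: "is_lattice eisenstein_integers"
proof -
  have im: "Im zeta3 \<noteq> 0" by (simp add: zeta3_eq)
  then have ne: "zeta3 \<noteq> 1" by auto
  have "zeta3 \<notin> span {1}"
  proof
    assume "zeta3 \<in> span {1}"
    then obtain r where "zeta3 = r *\<^sub>R 1" by (auto simp: span_singleton)
    then have "Im zeta3 = Im (r *\<^sub>R 1)" by (rule arg_cong)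
    then have "Im zeta3 = 0" by simp
    then show False using im by contradiction
  qed
  then have "independent {zeta3, 1}" by (simp add: independent_insert ne)
  then have "independent {1, zeta3}" by (simp add: insert_commute)
  moreover have "eisenstein_integers = {of_int m * 1 + of_int n * zeta3 | m n. True}"
    by (simp add: eisenstein_integers_def)
  ultimately show ?thesis unfolding is_lattice_def using ne by metis
qed

text \<open>By \<open>lattice_eisenstein\<close> the lattice is a multiple by some \<open>v\<close>
  of the ring generated by \<omega>, which is the ring of Eisenstein integers. Scaling by 1 / v and
  by v gives the two inverse maps.\<close>

theorem biholomorphic_fermat_curve:
  assumes L: "is_lattice L" and w: "\<omega>\<^sup>2 + \<omega> + 1 = 0" and cl: "\<And>l. l \<in> L \<Longrightarrow> \<omega> * l \<in> L"
  shows "biholomorphic (complex_torus L) fermat_curve"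
proof -
  obtain v where v: "v \<noteq> 0" and Lv: "L = {(of_int m + of_int n * \<omega>) * v | m n. True}"
    by (rule lattice_eisenstein[OF L w cl])
  \<comment> \<open>The two primitive cube roots of unity have sum -1, so each is an integer
    combination of 1 and the other.\<close>
  have wz: "\<omega> = zeta3 \<or> \<omega> = - 1 - zeta3"
    using omega_roots[OF w zeta3_root] zeta3_root by (auto simp: algebra_simps eq_neg_iff_add_eq_0)
  have 1: "\<exists>m' n'. of_int m + of_int n * \<omega> = of_int m' + of_int n' * zeta3" for m n
    using wz
  proof
    assume h: "\<omega> = - 1 - zeta3"
    have "of_int m + of_int n * \<omega> = of_int (m - n) + of_int (- n) * zeta3"
      unfolding h by (simp add: algebra_simps)
    then show ?thesis by blast
  qed blast
  have 2: "\<exists>m' n'. of_int m + of_int n * zeta3 = of_int m' + of_int n' * \<omega>" for m n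
    using wz
  proof
    assume h: "\<omega> = - 1 - zeta3"
    have "of_int m + of_int n * zeta3 = of_int (m - n) + of_int (- n) * \<omega>"
      unfolding h by (simp add: algebra_simps)
    then show ?thesis by blast
  qed blast
  note Eis = is_lattice_eisenstein
  have "1 / v * l \<in> eisenstein_integers" if "l \<in> L" for l
    using that v 1 unfolding Lv eisenstein_integers_def by auto
  then obtain f where f: "holomorphic_map (complex_torus L) fermat_curve f"
    "\<forall>z. f (torus_proj L z) = torus_proj eisenstein_integers (1 / v * z)"
    unfolding fermat_curve_def by (rule torus_scaling_map[OF L Eis])
  have "v * l \<in> L" if l: "l \<in> eisenstein_integers" for l
  proof -
    obtain m n where "l = of_int m + of_int n * zeta3" using l unfolding eisenstein_integers_def by blast
    moreover obtain m' n' where "of_int m + of_int n * zeta3 = of_int m' + of_int n' * \<omega>" using 2 by blast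
    ultimately have "v * l = (of_int m' + of_int n' * \<omega>) * v" by simp
    then show ?thesis unfolding Lv by blast
  qed
  then obtain g where g: "holomorphic_map fermat_curve (complex_torus L) g"
    "\<forall>z. g (torus_proj eisenstein_integers z) = torus_proj L (v * z)"
    unfolding fermat_curve_def by (rule torus_scaling_map[OF Eis L])
  have "g (f x) = x" if "x \<in> points (complex_torus L)" for x
    using that f(2) g(2) v by (auto simp: complex_torus_def)
  moreover have "f (g y) = y" if "y \<in> points fermat_curve" for y
    using that f(2) g(2) v by (auto simp: complex_torus_def fermat_curve_def)
  ultimately show ?thesis unfolding biholomorphic_def using f(1) g(1) by blast
qed

section \<open>Holomorphic maps between tori are affine\<close>

text \<open>The derivative of the local lifts is a periodic entire function, hence constant.\<close>

locale torus_map =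
  fixes L L' :: "complex set" and f :: "complex set \<Rightarrow> complex set"
  assumes L: "is_lattice L" and L': "is_lattice L'"
    and holo: "holomorphic_map (complex_torus L) (complex_torus L') f"
begin

sublocale T: flat_manifold "complex_torus L" "torus_proj L" L
  by (rule flat_manifold_complex_torus[OF L])

sublocale T': flat_manifold "complex_torus L'" "torus_proj L'" L'
  by (rule flat_manifold_complex_torus[OF L'])

definition lifts_on :: "(complex \<Rightarrow> complex) \<Rightarrow> complex set \<Rightarrow> bool" where
  "lifts_on g N \<longleftrightarrow> open N \<and> g holomorphic_on N \<and> (\<forall>w\<in>N. f (torus_proj L w) = torus_proj L' (g w))"

text \<open>The lift is \<open>\<psi> \<circ> f \<circ> torus_proj L\<close> for a chart
  \<open>\<psi>\<close> at the image point; it lifts \<open>f\<close> because charts are sections of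
  the projection.\<close>

lemma ex_local_lift: "\<exists>g N. z \<in> N \<and> lifts_on g N"
proof -
  let ?p = "torus_proj L" and ?p' = "torus_proj L'"
  have cont: "continuous_map (mtop (complex_torus L)) (mtop (complex_torus L')) f"
    and hol: "\<And>U \<phi> V \<psi>. (U, \<phi>) \<in> charts (complex_torus L) \<Longrightarrow> (V, \<psi>) \<in> charts (complex_torus L') \<Longrightarrow>
      holo_on (\<psi> \<circ> f \<circ> inv_into U \<phi>) (\<phi> ` {x \<in> U. f x \<in> V})"
    using holo by (auto simp: holomorphic_map_def)
  obtain U \<phi> where U: "(U, \<phi>) \<in> charts (complex_torus L)" "?p z \<in> U"
    using T.ex_chart_at[OF T.P_in_points] .
  have "f (?p z) \<in> points (complex_torus L')"
    using cont T.P_in_points by (auto simp: continuous_map_def)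
  then obtain V \<psi> where V: "(V, \<psi>) \<in> charts (complex_torus L')" "f (?p z) \<in> V"
    using T'.ex_chart_at by blast
  obtain N k where N: "open N" "z \<in> N"
    and k: "\<And>w. w \<in> N \<Longrightarrow> ?p w \<in> U \<and> \<phi> (?p w) = w + k \<and> w + k \<in> \<phi> ` U"
    using T.local_section_shift[OF U] by metis
  let ?V = "{x \<in> points (complex_torus L). f x \<in> V}"
  let ?N = "N \<inter> ?p -` ?V" and ?g = "\<lambda>w. \<psi> (f (?p w))"
  have "openin (mtop (complex_torus L)) ?V"
    using cont T'.chart_openin[OF V(1)] by (simp add: continuous_map_def)
  then have o: "open ?N" using N(1) T.open_vimage_P by (intro open_Int)
  have "holo_on ?g ?N"
  proof (rule holo_on_transform[OF o])
    show "holo_on (\<lambda>w. (\<psi> \<circ> f \<circ> inv_into U \<phi>) (w + k)) ?N"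
    proof (rule holo_on_compose[OF _ hol[OF U(1) V(1)]])
      show "holo_on (\<lambda>w. w + k) ?N" by (rule holo_on_affine[OF complex_linear_id])
      show "(\<lambda>w. w + k) ` ?N \<subseteq> \<phi> ` {x \<in> U. f x \<in> V}"
      proof (rule image_subsetI)
        fix w assume "w \<in> ?N"
        then have "w + k = \<phi> (?p w)" "?p w \<in> {x \<in> U. f x \<in> V}" using k[of w] by auto
        then show "w + k \<in> \<phi> ` {x \<in> U. f x \<in> V}" by (rule image_eqI)
      qed
    qed
    fix w assume "w \<in> ?N"
    then have w: "w + k \<in> \<phi> ` U" "\<phi> (?p w) = w + k" "?p w \<in> U" using k[of w] by auto
    have "inv_into U \<phi> (w + k) = ?p w" using T.chart_inj[OF U(1)] w by (metis inv_into_f_f)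
    then show "(\<psi> \<circ> f \<circ> inv_into U \<phi>) (w + k) = ?g w" by simp
  qed
  then have "?g holomorphic_on ?N" using holo_on_complex_iff[OF o] by blast
  moreover have "f (?p w) = ?p' (?g w)" if "w \<in> ?N" for w
    using that T'.chart_section[OF V(1)] by auto
  ultimately have "lifts_on ?g ?N" using o by (simp add: lifts_on_def)
  moreover have "z \<in> ?N" using N(2) V(2) by simp
  ultimately show ?thesis by (intro exI conjI)
qed

text \<open>Two lifts differ by a continuous function with values in the discrete set
  \<open>L'\<close>, which is locally constant.\<close>

lemma lift_deriv_unique:
  assumes g: "lifts_on g N" and h: "lifts_on h N'" and z: "z \<in> N" "z \<in> N'"
  shows "deriv g z = deriv h z"
proof -
  obtain e where e: "e > 0" "\<And>l. l \<in> L' \<Longrightarrow> norm l < e \<Longrightarrow> l = 0"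
    using lattice_discrete[OF L'] by blast
  let ?N = "N \<inter> N'" and ?d = "\<lambda>w. g w - h w"
  have o: "open ?N" using g h by (simp add: lifts_on_def open_Int)
  have hol: "g holomorphic_on N" "h holomorphic_on N'" "open N" "open N'" using g h by (simp_all add: lifts_on_def)
  have d: "?d w \<in> L'" if "w \<in> ?N" for w
    using that g h torus_proj_eq_iff[OF L', of "g w" "h w"] by (auto simp: lifts_on_def)
  have "continuous_on ?N ?d"
    by (intro continuous_intros holomorphic_on_imp_continuous_on holomorphic_on_subset[OF hol(1)]
        holomorphic_on_subset[OF hol(2)]) auto
  then have "open (?N \<inter> ?d -` ball (?d z) e)"
    using o by (simp add: continuous_on_open_vimage Int_commute)
  moreover have "z \<in> ?N \<inter> ?d -` ball (?d z) e" using z e(1) by simp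
  moreover have "h w + ?d z = g w" if "w \<in> ?N \<inter> ?d -` ball (?d z) e" for w
  proof -
    have "?d z - ?d w \<in> L'" using lattice_diff[OF L' d[of z] d[of w]] z that by auto
    then have "?d z - ?d w = 0" using that by (intro e(2)) (auto simp: dist_norm)
    then show ?thesis by (simp add: algebra_simps)
  qed
  moreover have "((\<lambda>w. h w + ?d z) has_field_derivative deriv h z) (at z)"
    by (rule derivative_eq_intros holomorphic_derivI[OF hol(2,4) z(2)] refl | simp)+
  ultimately have "(g has_field_derivative deriv h z) (at z)"
    using has_field_derivative_transform_within_open by blast
  then show ?thesis by (rule DERIV_imp_deriv)
qed

text \<open>The derivative does not depend on the lift, so it is defined on the whole plane although
  the lifts are only local.\<close>

definition slope :: "complex \<Rightarrow> complex" where
  "slope z = (SOME d. \<exists>g N. z \<in> N \<and> lifts_on g N \<and> d = deriv g z)"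

lemma slope_eq:
  assumes "lifts_on g N" "z \<in> N"
  shows "slope z = deriv g z"
proof -
  have "\<exists>g N. z \<in> N \<and> lifts_on g N \<and> slope z = deriv g z"
    unfolding slope_def by (rule someI_ex) (use assms in blast)
  then show ?thesis using lift_deriv_unique assms by metis
qed

lemma slope_constant: "\<exists>a. \<forall>z. slope z = a"
proof -
  have "slope holomorphic_on UNIV"
  proof -
    have "\<exists>d. (slope has_field_derivative d) (at z)" for z
    proof -
      obtain g N where g: "z \<in> N" "lifts_on g N" using ex_local_lift by blast
      then have o: "open N" and "g holomorphic_on N" by (simp_all add: lifts_on_def)
      then have "deriv g holomorphic_on N" by (simp add: holomorphic_deriv)
      then have "(deriv g has_field_derivative deriv (deriv g) z) (at z)"
        using o g(1) by (rule holomorphic_derivI)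
      then have "(slope has_field_derivative deriv (deriv g) z) (at z)"
        by (rule has_field_derivative_transform_within_open[OF _ o g(1)]) (simp add: slope_eq[OF g(2)])
      then show ?thesis by blast
    qed
    then show ?thesis by (auto simp: holomorphic_on_def field_differentiable_def)
  qed
  moreover have "slope (z + l) = slope z" if l: "l \<in> L" for z l
  proof -
    obtain g N where g: "z + l \<in> N" "lifts_on g N" using ex_local_lift by blast
    \<comment> \<open>A lift near \<open>z + l\<close>, shifted by \<open>l\<close>, is a lift near
      \<open>z\<close>, since the projection does not distinguish these points.\<close>
    let ?g = "\<lambda>w. g (w + l)" and ?N = "(\<lambda>w. w + l) -` N"
    have o: "open ?N" using g(2) by (intro open_vimage) (auto simp: lifts_on_def intro!: continuous_intros)
    have gN: "open N" "g holomorphic_on N" using g(2) by (simp_all add: lifts_on_def)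
    have D: "(?g has_field_derivative deriv g (w + l)) (at w)" if "w \<in> ?N" for w
      by (rule DERIV_shift[THEN iffD1], rule holomorphic_derivI[OF gN(2,1)]) (use that in simp)
    then have "?g holomorphic_on ?N" by (subst holomorphic_on_open[OF o]) blast
    moreover have "f (torus_proj L w) = torus_proj L' (?g w)" if "w \<in> ?N" for w
      using that g(2) T.P_add[OF l, of w] by (auto simp: lifts_on_def)
    ultimately have "lifts_on ?g ?N" using o by (simp add: lifts_on_def)
    moreover have zN: "z \<in> ?N" using g(1) by (rule vimageI2)
    ultimately have "slope z = deriv ?g z" by (rule slope_eq)
    also have "\<dots> = deriv g (z + l)" using D[OF zN] by (rule DERIV_imp_deriv)
    also have "\<dots> = slope (z + l)" using slope_eq[OF g(2,1)] by simp
    finally show ?thesis by simp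
  qed
  ultimately obtain a where "\<And>z. slope z = a" using periodic_holomorphic_constant[OF L] by metis
  then show ?thesis by blast
qed

text \<open>With constant slope every local lift has the form a w + c. On a small ball the constant
  \<open>t\<close> chosen at 0 is correct either everywhere or nowhere, according to whether
  \<open>c - t\<close> lies in \<open>L'\<close>. The set where it is correct is therefore open and
  closed.\<close>

theorem affine: "\<exists>a t. \<forall>z. f (torus_proj L z) = torus_proj L' (a * z + t)"
proof -
  let ?p = "torus_proj L" and ?p' = "torus_proj L'"
  obtain a where a: "\<And>z. slope z = a" using slope_constant by blast
  have loc: "\<exists>r>0. \<exists>c. \<forall>w\<in>ball z r. f (?p w) = ?p' (a * w + c)" for z
  proof -
    obtain g N where g: "z \<in> N" "lifts_on g N" using ex_local_lift by blast
    then have N: "open N" "g holomorphic_on N" by (simp_all add: lifts_on_def)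
    obtain r where r: "r > 0" "ball z r \<subseteq> N" using N(1) g(1) by (meson openE)
    have "((\<lambda>w. g w - a * w) has_field_derivative 0) (at w within ball z r)" if "w \<in> ball z r" for w
    proof -
      have "w \<in> N" using that r by blast
      then have "(g has_field_derivative a) (at w)"
        using holomorphic_derivI[OF N(2,1)] slope_eq[OF g(2)] a by metis
      then have "((\<lambda>w. g w - a * w) has_field_derivative 0) (at w)"
        by (auto intro!: derivative_eq_intros)
      then show ?thesis by (rule has_field_derivative_at_within)
    qed
    then have "\<exists>c. \<forall>w\<in>ball z r. g w - a * w = c"
      by (rule has_field_derivative_zero_constant[OF convex_ball])
    then obtain c where c: "\<And>w. w \<in> ball z r \<Longrightarrow> g w - a * w = c" by blast
    have "f (?p w) = ?p' (a * w + c)" if "w \<in> ball z r" for w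
    proof -
      have "g w = a * w + c" using c[OF that] by (simp add: algebra_simps)
      then show ?thesis using g(2) r that by (auto simp: lifts_on_def)
    qed
    then show ?thesis using r(1) by blast
  qed
  obtain r0 t where r0: "r0 > 0" "\<forall>w\<in>ball 0 r0. f (?p w) = ?p' (a * w + t)" using loc by blast
  define S where "S = {z. f (?p z) = ?p' (a * z + t)}"
  have "\<exists>r>0. ball z r \<subseteq> S \<or> ball z r \<subseteq> - S" for z
  proof -
    obtain r c where r: "r > 0" "\<forall>w\<in>ball z r. f (?p w) = ?p' (a * w + c)" using loc by blast
    have "w \<in> S \<longleftrightarrow> c - t \<in> L'" if "w \<in> ball z r" for w
      using r(2) that by (simp add: S_def torus_proj_eq_iff[OF L'])
    then show ?thesis using r(1) by blast
  qed
  then have nb: "\<exists>r>0. ball z r \<subseteq> S \<or> ball z r \<subseteq> - S" for z by blast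
  have "open S"
    unfolding open_contains_ball by (metis nb centre_in_ball Compl_iff subsetD)
  moreover have "open (- S)"
    unfolding open_contains_ball by (metis nb centre_in_ball Compl_iff subsetD)
  ultimately have "S = {} \<or> S = UNIV" using clopen[of S] by (simp add: closed_def)
  moreover have "0 \<in> S" using r0 by (simp add: S_def)
  ultimately have "S = UNIV" by blast
  then show ?thesis unfolding S_def by blast
qed

end

section \<open>Group actions on tori\<close>

locale torus_action = group G for G (structure) +
  fixes L :: "complex set" and \<rho> :: "'a \<Rightarrow> complex set \<Rightarrow> complex set"
  assumes L: "is_lattice L" and finite_G: "finite (carrier G)"
    and holo: "holomorphic_action G (complex_torus L) \<rho>"
    and faithful: "faithful_action G (points (complex_torus L)) \<rho>"
begin

abbreviation p :: "complex \<Rightarrow> complex set" where "p \<equiv> torus_proj L"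

lemma p_points: "p z \<in> points (complex_torus L)" "x \<in> points (complex_torus L) \<Longrightarrow> \<exists>z. x = p z"
  by (auto simp: complex_torus_def)

sublocale act: group_action G "points (complex_torus L)" \<rho>
  using holo by (simp add: holomorphic_action_def)

definition rot :: "'a \<Rightarrow> complex" where
  "rot g = (SOME a. \<exists>t. \<forall>z. \<rho> g (p z) = p (a * z + t))"

text \<open>The action determines this vector only modulo \<open>L\<close>, unlike
  \<open>rot\<close>, which is unique. Statements about \<open>trl\<close> are accordingly
  meaningful modulo \<open>L\<close>.\<close>

definition trl :: "'a \<Rightarrow> complex" where
  "trl g = (SOME t. \<forall>z. \<rho> g (p z) = p (rot g * z + t))"

lemma action_eq: "\<rho> g (p z) = p (rot g * z + trl g)" if g: "g \<in> carrier G"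
proof -
  interpret torus_map L L "\<rho> g"
    using L holo g by unfold_locales (simp_all add: holomorphic_action_def)
  have "\<exists>t. \<forall>z. \<rho> g (p z) = p (rot g * z + t)"
    unfolding rot_def by (rule someI_ex) (rule affine)
  then have "\<forall>z. \<rho> g (p z) = p (rot g * z + trl g)"
    unfolding trl_def by (rule someI_ex)
  then show ?thesis by blast
qed

lemma affine_unique:
  assumes "\<And>z. p (a * z + t) = p (a' * z + t')"
  shows "a = a'" "t - t' \<in> L"
proof -
  have "(a - a') * z + (t - t') \<in> L" for z
    using assms[of z] by (simp add: torus_proj_eq_iff[OF L] algebra_simps)
  from lattice_shift_eq[OF L this] show "a = a'" "t - t' \<in> L" by simp_all
qed

lemma action_mult: "g \<in> carrier G \<Longrightarrow> h \<in> carrier G \<Longrightarrow> \<rho> (g \<otimes> h) (p z) = \<rho> g (\<rho> h (p z))"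
  using act.composition_rule p_points(1) by blast

lemma action_one: "\<rho> \<one> (p z) = p z"
  using act.id_eq_one p_points(1) by (metis restrict_apply')

text \<open>The maps of a \<open>group_action\<close> are extensional, so agreement on the torus
  makes them equal, and faithfulness carries this to the group elements.\<close>

lemma action_eqI:
  assumes g: "g \<in> carrier G" "h \<in> carrier G" and eq: "\<And>z. \<rho> g (p z) = \<rho> h (p z)"
  shows "g = h"
proof -
  have "\<rho> g \<in> extensional (points (complex_torus L))" "\<rho> h \<in> extensional (points (complex_torus L))"
    using act.bij_prop0 g by (auto simp: BijGroup_def Bij_def)
  then have "\<rho> g = \<rho> h"
    by (rule extensionalityI) (use eq p_points(2) in blast)
  moreover have "inj_on \<rho> (carrier G)"
    using faithful by (simp add: faithful_action_def faithful_action_axioms_def)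
  ultimately show ?thesis using g by (simp add: inj_on_def)
qed

lemma rot_mult: "rot (g \<otimes> h) = rot g * rot h" if g: "g \<in> carrier G" "h \<in> carrier G"
proof -
  have "p (rot (g \<otimes> h) * z + trl (g \<otimes> h)) = p ((rot g * rot h) * z + (rot g * trl h + trl g))" for z
    using action_mult[OF g, of z] g by (simp add: action_eq algebra_simps)
  then show ?thesis by (rule affine_unique(1))
qed

lemma rot_one: "rot \<one> = 1"
proof -
  have "p (rot \<one> * z + trl \<one>) = p (1 * z + 0)" for z
    using action_one[of z] by (simp add: action_eq)
  then show ?thesis by (rule affine_unique(1))
qed

lemma rot_pow: "g \<in> carrier G \<Longrightarrow> rot (g [^] (k::nat)) = rot g ^ k"
  by (induction k) (simp_all add: rot_one rot_mult)

lemma rot_lattice: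
  assumes g: "g \<in> carrier G" and l: "l \<in> L"
  shows "rot g * l \<in> L"
proof -
  have "p l = p 0" using l by (simp add: torus_proj_eq_iff[OF L])
  then have "p (rot g * l + trl g) = p (rot g * 0 + trl g)"
    using action_eq[OF g, of l] action_eq[OF g, of 0] by simp
  then show ?thesis by (simp add: torus_proj_eq_iff[OF L])
qed

lemma rot_values:
  assumes g: "g \<in> carrier G"
  shows "rot g = 1 \<or> rot g = -1 \<or> (rot g)\<^sup>2 = -1 \<or> (rot g)\<^sup>2 + rot g + 1 = 0 \<or> (rot g)\<^sup>2 - rot g + 1 = 0"
proof (rule root_of_unity_lattice[OF L rot_lattice[OF g]])
  show "rot g ^ order G = 1" using pow_order_eq_1[OF g] rot_pow[OF g, of "order G"] rot_one by simp
  show "order G > 0" using finite_G by (simp add: order_gt_0_iff_finite)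
qed

lemma rot_nonzero: "g \<in> carrier G \<Longrightarrow> rot g \<noteq> 0"
  using rot_values[of g] by auto

lemma translations_commute:
  assumes g: "g \<in> carrier G" "h \<in> carrier G" "rot g = 1" "rot h = 1"
  shows "g \<otimes> h = h \<otimes> g"
proof (rule action_eqI)
  show "\<rho> (g \<otimes> h) (p z) = \<rho> (h \<otimes> g) (p z)" for z
    unfolding action_mult[OF g(1,2)] action_mult[OF g(2,1)] using g by (simp add: action_eq add_ac)
qed (use g in simp_all)

text \<open>The point with w = 0 is fixed, and around it \<open>g\<close> acts as the pure rotation
  by \<open>rot g\<close>. The case w = 0 is used against freeness, general \<open>w\<close> to
  compute powers of \<open>g\<close>.\<close>

lemma rot_fixed_point:
  assumes g: "g \<in> carrier G" "rot g \<noteq> 1"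
  shows "\<rho> g (p (trl g / (1 - rot g) + w)) = p (trl g / (1 - rot g) + rot g * w)"
proof -
  define z where "z = trl g / (1 - rot g)"
  have "trl g = z * (1 - rot g)" using g(2) by (simp add: z_def)
  then have "rot g * (z + w) + trl g = z + rot g * w" by (simp add: algebra_simps)
  then show ?thesis by (simp only: action_eq[OF g(1)] z_def[symmetric])
qed

lemma rot_pow_eq_one:
  assumes g: "g \<in> carrier G" "rot g \<noteq> 1" "rot g ^ k = 1"
  shows "g [^] k = \<one>"
proof (rule action_eqI)
  let ?z = "trl g / (1 - rot g)"
  have pow: "\<rho> (g [^] k) (p (?z + w)) = p (?z + rot g ^ k * w)" for k :: nat and w
  proof (induction k arbitrary: w)
    case (Suc k)
    have "\<rho> (g [^] Suc k) (p (?z + w)) = \<rho> (g [^] k) (\<rho> g (p (?z + w)))"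
      using g(1) by (simp add: action_mult)
    also have "\<dots> = p (?z + rot g ^ k * (rot g * w))"
      unfolding rot_fixed_point[OF g(1,2)] by (rule Suc.IH)
    finally show ?case by (simp add: mult_ac)
  qed (simp add: action_one)
  show "\<rho> (g [^] k) (p z) = \<rho> \<one> (p z)" for z
    using pow[of k "z - ?z"] g(3) by (simp add: action_one)
qed (use g in simp_all)

lemma trl_inj:
  assumes "g \<in> carrier G" "h \<in> carrier G" "rot g = 1" "rot h = 1" "trl g - trl h \<in> L"
  shows "g = h"
  by (rule action_eqI) (use assms in \<open>simp_all add: action_eq torus_proj_eq_iff[OF L]\<close>)

lemma card_3_torsion_le: "card {t \<in> carrier G. rot t = 1 \<and> t [^] (3::nat) = \<one>} \<le> 9"
proof (rule card_torsion_le_9[OF L, where f = trl])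
  fix t assume t: "t \<in> {t \<in> carrier G. rot t = 1 \<and> t [^] (3::nat) = \<one>}"
  have "\<rho> (t [^] k) (p 0) = p (of_nat k * trl t)" for k :: nat
  proof (induction k)
    case (Suc k)
    have "t [^] Suc k = t \<otimes> t [^] k" using t nat_pow_Suc2 by simp
    moreover have "\<rho> (t \<otimes> t [^] k) (p 0) = \<rho> t (\<rho> (t [^] k) (p 0))"
      using t by (intro action_mult) simp_all
    ultimately show ?case using t Suc by (simp add: action_eq algebra_simps)
  qed (simp add: action_one)
  from this[of 3] show "3 * trl t \<in> L"
    using t by (simp add: action_one torus_proj_eq_iff[OF L]) (metis L lattice_uminus minus_minus torus_proj_eq_iff diff_0)
qed (use finite_G trl_inj in auto)

lemma card_centralizer_le:
  assumes g: "g \<in> carrier G" "(rot g)\<^sup>2 + rot g + 1 = 0"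
  shows "card {t \<in> carrier G. rot t = 1 \<and> g \<otimes> t = t \<otimes> g} \<le> 3"
proof (rule card_fixed_le_3[OF L g(2) rot_lattice[OF g(1)], where f = trl])
  fix t assume t: "t \<in> {t \<in> carrier G. rot t = 1 \<and> g \<otimes> t = t \<otimes> g}"
  then have "\<rho> (g \<otimes> t) (p 0) = \<rho> (t \<otimes> g) (p 0)" "t \<in> carrier G" by simp_all
  then have "\<rho> g (\<rho> t (p 0)) = \<rho> t (\<rho> g (p 0))"
    using g(1) by (simp only: action_mult)
  then have "p (rot g * trl t + trl g) = p (trl g + trl t)"
    using t g(1) by (simp add: action_eq)
  then show "(rot g - 1) * trl t \<in> L"
    by (simp add: torus_proj_eq_iff[OF L] algebra_simps)
qed (use finite_G trl_inj in auto)

end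

section \<open>The diagonal action on the product of the tori\<close>

lemma scaleC_axis_mem:
  "k \<in> L i \<Longrightarrow> (\<And>j. 0 \<in> L j) \<Longrightarrow> scaleC k (axis i 1 :: complex ^ 'n) \<in> {v. \<forall>j. v $ j \<in> L j}"
  by (auto simp: scaleC_vec_def scaleC_complex_def axis_def)

lemma complex_linear_diag: "complex_linear (\<lambda>v. \<chi> i. (a i :: complex) * v $ i)"
  unfolding complex_linear_def
proof (intro conjI allI)
  show "bounded_linear (\<lambda>v. \<chi> i. a i * v $ i)"
    by (intro linear_conv_bounded_linear[THEN iffD1] linearI)
      (simp_all add: vec_eq_iff algebra_simps scaleR_conv_of_real)
qed (simp add: vec_eq_iff scaleC_vec_def scaleC_complex_def)

lemma complex_linear_component: "complex_linear (\<lambda>v::complex ^ 'n. v $ i)"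
  unfolding complex_linear_def
  by (simp add: bounded_linear_vec_nth scaleC_vec_def)

theorem theorem1p4:
  fixes \<Lambda> :: "'n::finite \<Rightarrow> complex set"
    and G :: "('g, 'm) monoid_scheme"
    and \<rho> :: "'n \<Rightarrow> 'g \<Rightarrow> complex set \<Rightarrow> complex set"
  defines "E \<equiv> \<lambda>i. complex_torus (\<Lambda> i)"
  assumes "\<And>i. is_lattice (\<Lambda> i)"
    and "group G" and "finite (carrier G)"
    and "\<And>i. holomorphic_action G (E i) (\<rho> i)"
    and "\<And>i. faithful_action G (points (E i)) (\<rho> i)"
    and "rigid_action G (product_cmfd E) (diagonal_action E \<rho>)"
    and "free_action G (product_cmfd E) (diagonal_action E \<rho>)"
  shows "CARD('n) \<ge> 4 \<and>
         (\<forall>i. biholomorphic (E i) fermat_curve) \<and>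
         (G \<cong> integer_mod_group 3 \<times>\<times> integer_mod_group 3 \<or> G \<cong> Heis3)"
proof -
  interpret group G by fact
  interpret T: torus_action G "\<Lambda> i" "\<rho> i" for i
    using assms(2,4-6) by (intro torus_action.intro assms(3) torus_action_axioms.intro) (simp_all add: E_def)
  let ?M = "product_cmfd E" and ?P = "\<lambda>z i. torus_proj (\<Lambda> i) (z $ i)"
    and ?K = "{k :: complex ^ 'n. \<forall>i. k $ i \<in> \<Lambda> i}"
  interpret P: flat_manifold ?M ?P ?K
    unfolding E_def by (rule flat_manifold_product_cmfd[OF flat_manifold_complex_torus[OF T.L]])
  have diag: "diagonal_action E \<rho> g (?P z) = (\<lambda>i. \<rho> i g (torus_proj (\<Lambda> i) (z $ i)))" for g z
    using P.P_in_points[of z] by (simp add: diagonal_action_def)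
  have cover: "\<exists>i. T.rot i g = 1" if g: "g \<in> carrier G" for g
  proof (rule ccontr)
    assume "\<nexists>i. T.rot i g = 1"
    then have r: "T.rot i g \<noteq> 1" for i by blast
    let ?z = "\<chi> i. T.trl i g / (1 - T.rot i g)"
    have "diagonal_action E \<rho> g (?P ?z) = ?P ?z"
      unfolding diag using T.rot_fixed_point[OF g r, of _ 0] by (simp add: fun_eq_iff)
    then have "g = \<one>\<^bsub>G\<^esub>"
      using assms(8) g P.P_in_points unfolding free_action_def by blast
    then show False using r T.rot_one by blast
  qed
  have square: "\<exists>g\<in>carrier G. (T.rot i g)\<^sup>2 \<noteq> 1" for i
  proof (rule ccontr)
    assume "\<not> (\<exists>g\<in>carrier G. (T.rot i g)\<^sup>2 \<noteq> 1)"
    then have sq: "(T.rot i g)\<^sup>2 = 1" if "g \<in> carrier G" for g using that by blast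
    \<comment> \<open>The class lives on factor \<open>i\<close>: the form is the i-th coordinate,
      the vector the i-th axis, and the lattice of that factor embeds along this axis into the
      lattice of the product.\<close>
    interpret D: flat_direction ?M ?P ?K "\<lambda>v. v $ i" "axis i 1" "\<Lambda> i"
    proof
      show "scaleC l (axis i 1) \<in> ?K" if "l \<in> \<Lambda> i" for l
        using that by (rule scaleC_axis_mem) (rule lattice_zero[OF T.L])
    qed (simp_all add: complex_linear_component T.L)
    have "\<exists>A B t \<sigma>. flat_automorphism ?M ?P ?K (diagonal_action E \<rho> g) A B t \<and>
      A (axis i 1) = scaleC (of_real \<sigma>) (axis i 1) \<and> (\<forall>z. B z $ i = of_real \<sigma> * z $ i) \<and> \<sigma>\<^sup>2 = (1::real)"
      if g: "g \<in> carrier G" for g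
    proof -
      let ?A = "\<lambda>v. \<chi> j. T.rot j g * v $ j" and ?B = "\<lambda>v. \<chi> j. inverse (T.rot j g) * v $ j"
      let ?t = "\<chi> j. T.trl j g"
      have aut: "flat_automorphism ?M ?P ?K (diagonal_action E \<rho> g) ?A ?B ?t"
      proof
        show "complex_linear ?A" "complex_linear ?B" by (rule complex_linear_diag)+
        show "?A (?B z) = z" "?B (?A z) = z" for z
          using T.rot_nonzero[OF g] by (simp_all add: vec_eq_iff)
        show "diagonal_action E \<rho> g (?P z) = ?P (?A z + ?t)" for z
          unfolding diag by (simp add: T.action_eq[OF g])
        show "inj_on (diagonal_action E \<rho> g) (points ?M)"
        proof (rule inj_onI)
          fix x y assume xy: "x \<in> points ?M" "y \<in> points ?M"
            and eq: "diagonal_action E \<rho> g x = diagonal_action E \<rho> g y"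
          obtain z w where zw: "x = ?P z" "y = ?P w" using xy P.points_eq by auto
          have "x j = y j" for j
          proof -
            have "\<rho> j g (x j) = \<rho> j g (y j)" using eq unfolding zw diag by (simp add: fun_eq_iff)
            then show ?thesis
              using inj_onD[OF T.act.inj_prop[OF g]] T.p_points(1) unfolding zw by blast
          qed
          then show "x = y" by blast
        qed
      qed
      have "T.rot i g = 1 \<or> T.rot i g = -1" using sq[OF g] by (simp add: power2_eq_1_iff)
      then obtain \<sigma> :: real where s: "T.rot i g = of_real \<sigma>" "\<sigma>\<^sup>2 = 1"
        by (metis of_real_1 of_real_minus power2_minus power_one)
      \<comment> \<open>A number with square 1 is its own inverse, so the same \<sigma> scales the
        axis under the linear part and the coordinate under its inverse.\<close>
      have "inverse (T.rot i g) = T.rot i g"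
        using sq[OF g] by (intro inverse_unique) (simp add: power2_eq_square)
      then have "\<forall>z. ?B z $ i = of_real \<sigma> * z $ i" using s(1) by simp
      moreover have "?A (axis i 1) = scaleC (of_real \<sigma>) (axis i 1)"
        using s(1) by (simp add: vec_eq_iff scaleC_vec_def scaleC_complex_def axis_def)
      ultimately show ?thesis using aut s(2) by blast
    qed
    then have "\<not> rigid_action G ?M (diagonal_action E \<rho>)" by (rule D.not_rigid)
    then show False using assms(7) by contradiction
  qed
  interpret torus_characters G T.rot
    using T.finite_G T.rot_mult T.translations_commute T.rot_pow_eq_one T.rot_values cover square
      T.card_3_torsion_le T.card_centralizer_le
    by (intro torus_characters.intro assms(3) torus_characters_axioms.intro)
  have "biholomorphic (E i) fermat_curve" for i
  proof -
    obtain g where g: "g \<in> carrier G" "(T.rot i g)\<^sup>2 + T.rot i g + 1 = 0" using ex_alpha_omega by blast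
    show ?thesis
      unfolding E_def by (rule biholomorphic_fermat_curve[OF T.L g(2) T.rot_lattice[OF g(1)]])
  qed
  then show ?thesis using four_le_card iso_elementary_or_heisenberg by blast
qed

end
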